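(* Let $f(\cos\theta,\sin\theta)$ be a $2\pi$-periodic function and take $b\in\{-1,0\}$ together with a grid $\boldsymbol\theta=(\theta_1,\ldots,\theta_{n+1})^{\mathsf T}$, $n\ge2$, $-\pi=\theta_1<\cdots<\theta_{n+1}=\pi$. Let $F_i(\theta)$ be the restriction of $F(\theta):=f(\cos\theta,\sin\theta)$ to $[\theta_i,\theta_{i+1}]$. Suppose each $F_i$ is analytic in $[\theta_i,\theta_{i+1}]$ and analytically continuable to $$D_{h_i}^i(\rho_i):=\Big\{\theta+\tfrac{\theta_i+\theta_{i+1}}2:\ \theta\in D_{h_i}(\rho_i)\Big\}$$ with $\rho_i>1$, and assume $F_i$ is bounded in $D_{h_i}^i(\rho_i)$, $i=1,\ldots,n$. Define $\rho:=\min_{1\le i\le n}\rho_i$. Then $$\big\|f-S_m^{(b),\boldsymbol\theta}[f]\big\|_{(b),\boldsymbol\theta}=\mathcal O(\rho^{-m})\quad\text{as }m\to\infty.$$ Similarly, all the coefficients in the expansion are $\mathcal O(\rho^{-m})$ as $m\to\infty$ (where $m$ is the degree of the basis functions they multiply).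
   Context: Elements: $E_i=[\theta_i,\theta_{i+1}]$, $\ell_i=\theta_{i+1}-\theta_i$, $\varphi_i=\ell_i/2$, $h_i=\cos\varphi_i$, $a_i(\theta)=\theta-(\theta_i+\theta_{i+1})/2$ ($i=1,\ldots,n$), with index $0$ identified with $n$. Region: for $|h|<1$, $\rho>1$, $D_h(\rho)=\{\theta:\cos\theta\in E\}$ (complex $\theta$), where $E$ is the open ellipse with foci $h$ and $1$, centre $(1+h)/2$, whose semimajor and semiminor axis lengths sum to $\rho(1-h)/2$. Semiclassical Jacobi polynomials: for $t>1$, $a,b>-1$, $P_k^{t,(a,b,c)}$ ($k\ge0$, degree exactly $k$) are the orthogonal polynomials on $[0,1]$ with weight $x^a(1-x)^b(t-x)^c$, normalised so that $P_0=1$ and all have the same norm as $1$. For $b=-1$: $P_0^{t,(a,-1,c)}=1$, $P_k^{t,(a,-1,c)}(x)=(1-x)P_{k-1}^{t,(a,1,c)}(x)$, $k\ge1$. Arc polynomials: with $\tau=2/(1-h)$, $\sigma=(\cos\theta-1)/(h-1)$: $p_k^{(b,h)}(\theta)=P_k^{\tau,(-1/2,b,-1/2)}(\sigma)$ ($k\ge0$), $q_k^{(b,h)}(\theta)=\sin\theta\,P_{k-1}^{\tau,(1/2,b,1/2)}(\sigma)$ ($k\ge1$). Hat functions: $\phi_i$ equals $\tfrac12(1+\sin a_{i-1}(\theta)/\sin\varphi_{i-1})$ on $E_{i-1}$, $\tfrac12(1-\sin a_i(\theta)/\sin\varphi_i)$ on $E_i$, and $0$ elsewhere ($E_0=E_n$).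 Bases. In the following, functions of $a_i(\theta)$ are taken to vanish outside $E_i$. The basis $\mathbf P^{(0),\boldsymbol\theta}$ is the row of functions $p_0^{(0,h_i)}(a_i(\theta))$ ($i=1,\ldots,n$), then $q_1^{(0,h_i)}(a_i(\theta))$ ($i=1,\ldots,n$), $p_1^{(0,h_i)}(a_i(\theta))$ ($i=1,\ldots,n$), $q_2,p_2,\ldots$ likewise. The basis $\mathbf P^{(-1),\boldsymbol\theta}$ is the row of hat functions $\phi_1,\ldots,\phi_n$, followed by $p_1^{(-1,h_i)}(a_i(\theta))$ ($i=1,\ldots,n$), then $q_2^{(-1,h_i)}(a_i(\theta))$, $p_2^{(-1,h_i)}(a_i(\theta))$, $q_3,p_3,\ldots$ likewise. The matrix $R$ is defined by $\mathbf P^{(-1),\boldsymbol\theta}=\mathbf P^{(0),\boldsymbol\theta}R$. Partial sums. For $b=0$: $S_m^{(0),\boldsymbol\theta}[f]=\sum_{i=1}^n\big\{\hat f_0^{(0,h_i)}p_0^{(0,h_i)}(a_i(\theta))+\sum_{j=1}^m[\hat f_{j1}^{(0,h_i)}q_j^{(0,h_i)}(a_i(\theta))+\hat f_{j2}^{(0,h_i)}p_j^{(0,h_i)}(a_i(\theta))]\big\}$, where the coefficients are those of the expansion $f=\mathbf P^{(0),\boldsymbol\theta}\mathbf f^{(0),\boldsymbol\theta}$, i.e. on each element the orthogonal expansion coefficients of $F_i$ in $L^2(E_i)$. For $b=-1$: $S_m^{(-1),\boldsymbol\theta}[f]=\sum_{i=1}^n\big\{\hat f_i^{(-1,h_i)}\phi_i(\theta)+\hat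 f_{12}^{(-1,h_i)}p_1^{(-1,h_i)}(a_i(\theta))+\sum_{j=2}^m[\hat f_{j1}^{(-1,h_i)}q_j^{(-1,h_i)}(a_i(\theta))+\hat f_{j2}^{(-1,h_i)}p_j^{(-1,h_i)}(a_i(\theta))]\big\}$, where the coefficients are those of the expansion $f=\mathbf P^{(-1),\boldsymbol\theta}\mathbf f^{(-1),\boldsymbol\theta}$, given by the solution of $R\,\mathbf f^{(-1),\boldsymbol\theta}=\mathbf f^{(0),\boldsymbol\theta}$. Norms: $\|g\|_{(0),\boldsymbol\theta}^2=\int_{-\pi}^{\pi}g(\theta)^2\,d\theta$ and $\|g\|_{(-1),\boldsymbol\theta}^2=\sum_{i=1}^n\int_{\theta_i}^{\theta_{i+1}}g(\theta)^2\frac{1}{\cos a_i(\theta)-h_i}\,d\theta$.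
   Formalization: The analytic continuation of each F_i to D is additionally required to be 2π-periodic; without this the claim fails when the ellipse contains -1 (e.g. F = cos(a_i/2) on the grid (-π,0,π) with ρ_i = 10). *)

theory Defs
  imports
    "HOL-Analysis.Analysis"
    "HOL-Computational_Algebra.Polynomial"
    "HOL-Library.Landau_Symbols"
begin

text \<open>Grids: \<open>\<theta> 1 < \<dots> < \<theta> (n + 1)\<close>; other values of \<open>\<theta> :: nat \<Rightarrow> real\<close> are irrelevant.\<close>

definition is_grid :: "nat \<Rightarrow> (nat \<Rightarrow> real) \<Rightarrow> bool" where
  "is_grid n \<theta> \<longleftrightarrow> n \<ge> 2 \<and> \<theta> 1 = - pi \<and> \<theta> (n + 1) = pi \<and> strict_mono_on {1..n+1} \<theta>"

definition elem :: "(nat \<Rightarrow> real) \<Rightarrow> nat \<Rightarrow> real set" where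
  "elem \<theta> i = {\<theta> i..\<theta> (i + 1)}"

definition midpt :: "(nat \<Rightarrow> real) \<Rightarrow> nat \<Rightarrow> real" where
  "midpt \<theta> i = (\<theta> i + \<theta> (i + 1)) / 2"

definition half_len :: "(nat \<Rightarrow> real) \<Rightarrow> nat \<Rightarrow> real" where
  "half_len \<theta> i = (\<theta> (i + 1) - \<theta> i) / 2"

definition elem_h :: "(nat \<Rightarrow> real) \<Rightarrow> nat \<Rightarrow> real" where
  "elem_h \<theta> i = cos (half_len \<theta> i)"

definition loc :: "(nat \<Rightarrow> real) \<Rightarrow> nat \<Rightarrow> real \<Rightarrow> real" where
  "loc \<theta> i x = x - midpt \<theta> i"

text \<open>In \<open>ellipse_region\<close>, \<open>A\<close> and \<open>B\<close> are the semiaxis lengths; the condition on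
  \<open>A\<^sup>2 - B\<^sup>2\<close> (half the focal distance, squared) places the foci at \<open>h\<close> and \<open>1\<close>.\<close>

definition ellipse_region :: "real \<Rightarrow> real \<Rightarrow> complex set" where
  "ellipse_region h \<rho> =
     {z. \<exists>A B. 0 < B \<and> B < A \<and> A\<^sup>2 - B\<^sup>2 = ((1 - h) / 2)\<^sup>2 \<and> A + B = \<rho> * (1 - h) / 2 \<and>
        ((Re z - (1 + h) / 2) / A)\<^sup>2 + (Im z / B)\<^sup>2 < 1}"

definition D_region :: "real \<Rightarrow> real \<Rightarrow> complex set" where
  "D_region h \<rho> = {z. cos z \<in> ellipse_region h \<rho>}"

definition D_elem :: "(nat \<Rightarrow> real) \<Rightarrow> nat \<Rightarrow> real \<Rightarrow> complex set" where
  "D_elem \<theta> i \<rho> = (\<lambda>z. z + of_real (midpt \<theta> i)) ` D_region (elem_h \<theta> i) \<rho>"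

text \<open>The region is invariant under translation by \<open>2\<pi>\<close>, and it is connected (it contains the
  whole real line) as soon as \<open>-1\<close> lies in the ellipse. The continued function is a function of
  \<open>(cos z, sin z)\<close>, so it is required to be \<open>2\<pi>\<close>-periodic. If \<open>-1\<close> is not in the ellipse, this
  is no restriction, because distinct translates of the component around the element are
  disjoint. Without periodicity, \<open>cos (z / 2)\<close> would count as bounded and continuable for every
  \<open>\<rho>\<close>, although \<open>sqrt ((1 + x) / 2)\<close> is singular at \<open>x = -1\<close>.\<close>

definition bounded_continuation ::
    "(nat \<Rightarrow> real) \<Rightarrow> nat \<Rightarrow> real \<Rightarrow> (real \<Rightarrow> real) \<Rightarrow> bool" where
  "bounded_continuation \<theta> i \<rho> F \<longleftrightarrow>
     (\<exists>G. G holomorphic_on D_elem \<theta> i \<rho> \<and>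
          bounded (G ` D_elem \<theta> i \<rho>) \<and>
          (\<forall>z\<in>D_elem \<theta> i \<rho>. G (z + 2 * of_real pi) = G z) \<and>
          (\<forall>x\<in>elem \<theta> i. G (of_real x) = of_real (F x)))"

definition sj_inner :: "real \<Rightarrow> real \<Rightarrow> real \<Rightarrow> real \<Rightarrow> real poly \<Rightarrow> real poly \<Rightarrow> real" where
  "sj_inner t a b c p q =
     integral {0..1} (\<lambda>x. poly p x * poly q x * (x powr a * (1 - x) powr b * (t - x) powr c))"

definition is_sj_family ::
    "real \<Rightarrow> real \<Rightarrow> real \<Rightarrow> real \<Rightarrow> (nat \<Rightarrow> real poly) \<Rightarrow> bool" where
  "is_sj_family t a b c P \<longleftrightarrow>
     P 0 = 1 \<and> (\<forall>k. degree (P k) = k) \<and>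
     (\<forall>j k. j \<noteq> k \<longrightarrow> sj_inner t a b c (P j) (P k) = 0) \<and>
     (\<forall>k. sj_inner t a b c (P k) (P k) = sj_inner t a b c 1 1)"

text \<open>For \<open>t > 1\<close> and \<open>a, b > -1\<close> such a family exists and is unique up to the signs of the
  \<open>P k\<close> with \<open>k \<ge> 1\<close>; the signs are left unspecified.\<close>

definition sj_family :: "real \<Rightarrow> real \<Rightarrow> real \<Rightarrow> real \<Rightarrow> nat \<Rightarrow> real poly" where
  "sj_family t a b c = (SOME P. is_sj_family t a b c P)"

definition semiclassical_jacobi :: "real \<Rightarrow> real \<Rightarrow> real \<Rightarrow> real \<Rightarrow> nat \<Rightarrow> real poly" where
  "semiclassical_jacobi t a b c k =
     (if b = -1
      then (if k = 0 then 1 else [:1, -1:] * sj_family t a 1 c (k - 1))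
      else sj_family t a b c k)"

definition arc_p :: "real \<Rightarrow> real \<Rightarrow> nat \<Rightarrow> real \<Rightarrow> real" where
  "arc_p b h k x =
     poly (semiclassical_jacobi (2 / (1 - h)) (-1/2) b (-1/2) k) ((cos x - 1) / (h - 1))"

definition arc_q :: "real \<Rightarrow> real \<Rightarrow> nat \<Rightarrow> real \<Rightarrow> real" where
  "arc_q b h k x =
     sin x * poly (semiclassical_jacobi (2 / (1 - h)) (1/2) b (1/2) (k - 1)) ((cos x - 1) / (h - 1))"

definition hat :: "nat \<Rightarrow> (nat \<Rightarrow> real) \<Rightarrow> nat \<Rightarrow> real \<Rightarrow> real" where
  "hat n \<theta> i x =
     (let j = (if i = 1 then n else i - 1) in
      if x \<in> elem \<theta> j then (1 + sin (loc \<theta> j x) / sin (half_len \<theta> j)) / 2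
      else if x \<in> elem \<theta> i then (1 - sin (loc \<theta> i x) / sin (half_len \<theta> i)) / 2
      else 0)"

text \<open>Labels of basis functions: \<open>Hat i\<close> for the hat function of node \<open>i\<close>, \<open>Ev i k\<close> and
  \<open>Od i k\<close> for \<open>p\<^sub>k\<close> and \<open>q\<^sub>k\<close> on element \<open>i\<close>.\<close>

datatype label = Hat nat | Ev nat nat | Od nat nat

fun basis :: "real \<Rightarrow> nat \<Rightarrow> (nat \<Rightarrow> real) \<Rightarrow> label \<Rightarrow> real \<Rightarrow> real" where
  "basis b n \<theta> (Hat i) x = hat n \<theta> i x"
| "basis b n \<theta> (Ev i k) x =
     (if x \<in> elem \<theta> i then arc_p b (elem_h \<theta> i) k (loc \<theta> i x) else 0)"
| "basis b n \<theta> (Od i k) x =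
     (if x \<in> elem \<theta> i then arc_q b (elem_h \<theta> i) k (loc \<theta> i x) else 0)"

definition labels0 :: "nat \<Rightarrow> label set" where
  "labels0 n = {Ev i k | i k. i \<in> {1..n}} \<union> {Od i k | i k. i \<in> {1..n} \<and> k \<ge> 1}"

definition labels1 :: "nat \<Rightarrow> label set" where
  "labels1 n = {Hat i | i. i \<in> {1..n}} \<union> {Ev i k | i k. i \<in> {1..n} \<and> k \<ge> 1} \<union>
     {Od i k | i k. i \<in> {1..n} \<and> k \<ge> 2}"

text \<open>The connection matrix, with rows in \<open>labels0 n\<close> and finitely supported columns in
  \<open>labels1 n\<close>. The grid points are excluded in the defining identity because there the bases
  of both adjacent elements are nonzero.\<close>

definition is_connection_matrix ::
    "nat \<Rightarrow> (nat \<Rightarrow> real) \<Rightarrow> (label \<Rightarrow> label \<Rightarrow> real) \<Rightarrow> bool" where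
  "is_connection_matrix n \<theta> R \<longleftrightarrow>
     (\<forall>r s. R r s \<noteq> 0 \<longrightarrow> r \<in> labels0 n \<and> s \<in> labels1 n) \<and>
     (\<forall>s\<in>labels1 n. finite {r. R r s \<noteq> 0} \<and>
        (\<forall>x\<in>{-pi..pi} - \<theta> ` {1..n+1}.
           basis (-1) n \<theta> s x = (\<Sum>r | R r s \<noteq> 0. basis 0 n \<theta> r x * R r s)))"

definition connection_matrix :: "nat \<Rightarrow> (nat \<Rightarrow> real) \<Rightarrow> label \<Rightarrow> label \<Rightarrow> real" where
  "connection_matrix n \<theta> = (THE R. is_connection_matrix n \<theta> R)"

fun coeffs0 :: "nat \<Rightarrow> (nat \<Rightarrow> real) \<Rightarrow> (real \<Rightarrow> real) \<Rightarrow> label \<Rightarrow> real" where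
  "coeffs0 n \<theta> F (Hat i) = 0"
| "coeffs0 n \<theta> F (Ev i k) =
     integral (elem \<theta> i) (\<lambda>x. F x * basis 0 n \<theta> (Ev i k) x) /
     integral (elem \<theta> i) (\<lambda>x. (basis 0 n \<theta> (Ev i k) x)\<^sup>2)"
| "coeffs0 n \<theta> F (Od i k) =
     integral (elem \<theta> i) (\<lambda>x. F x * basis 0 n \<theta> (Od i k) x) /
     integral (elem \<theta> i) (\<lambda>x. (basis 0 n \<theta> (Od i k) x)\<^sup>2)"

definition partial_sum ::
    "real \<Rightarrow> nat \<Rightarrow> (nat \<Rightarrow> real) \<Rightarrow> (label \<Rightarrow> real) \<Rightarrow> nat \<Rightarrow> real \<Rightarrow> real" where
  "partial_sum b n \<theta> c m x =
     (if b = 0 then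
        (\<Sum>i=1..n. c (Ev i 0) * basis 0 n \<theta> (Ev i 0) x +
           (\<Sum>j=1..m. c (Od i j) * basis 0 n \<theta> (Od i j) x + c (Ev i j) * basis 0 n \<theta> (Ev i j) x))
      else
        (\<Sum>i=1..n. c (Hat i) * basis (-1) n \<theta> (Hat i) x + c (Ev i 1) * basis (-1) n \<theta> (Ev i 1) x +
           (\<Sum>j=2..m. c (Od i j) * basis (-1) n \<theta> (Od i j) x +
                      c (Ev i j) * basis (-1) n \<theta> (Ev i j) x)))"

text \<open>The infinite linear system alone does not determine the coefficients: the hat coefficients
  can be prescribed freely and the remaining unknowns found by forward substitution. The
  pointwise expansion of \<open>F\<close>, in particular at the grid points, selects the solution.\<close>

definition is_expansion1 ::
    "nat \<Rightarrow> (nat \<Rightarrow> real) \<Rightarrow> (real \<Rightarrow> real) \<Rightarrow> (label \<Rightarrow> real) \<Rightarrow> bool" where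
  "is_expansion1 n \<theta> F c \<longleftrightarrow>
     (\<forall>s. s \<notin> labels1 n \<longrightarrow> c s = 0) \<and>
     (\<forall>r\<in>labels0 n. ((\<lambda>s. connection_matrix n \<theta> r s * c s) has_sum coeffs0 n \<theta> F r) (labels1 n)) \<and>
     (\<forall>x\<in>{-pi..pi}. (\<lambda>m. partial_sum (-1) n \<theta> c m x) \<longlonglongrightarrow> F x)"

definition arc_coeffs :: "real \<Rightarrow> nat \<Rightarrow> (nat \<Rightarrow> real) \<Rightarrow> (real \<Rightarrow> real) \<Rightarrow> label \<Rightarrow> real" where
  "arc_coeffs b n \<theta> F = (if b = 0 then coeffs0 n \<theta> F else (THE c. is_expansion1 n \<theta> F c))"

definition S_sum :: "real \<Rightarrow> nat \<Rightarrow> (nat \<Rightarrow> real) \<Rightarrow> (real \<Rightarrow> real) \<Rightarrow> nat \<Rightarrow> real \<Rightarrow> real" where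
  "S_sum b n \<theta> F m = partial_sum b n \<theta> (arc_coeffs b n \<theta> F) m"

text \<open>\<open>integral\<close> is \<open>0\<close> for a non-integrable function, so \<open>arc_norm\<close> is meaningful only together
  with \<open>arc_norm_finite\<close>.\<close>

definition arc_norm_finite :: "real \<Rightarrow> nat \<Rightarrow> (nat \<Rightarrow> real) \<Rightarrow> (real \<Rightarrow> real) \<Rightarrow> bool" where
  "arc_norm_finite b n \<theta> g \<longleftrightarrow>
     (if b = 0 then (\<lambda>x. (g x)\<^sup>2) integrable_on {-pi..pi}
      else (\<forall>i\<in>{1..n}. (\<lambda>x. (g x)\<^sup>2 * (1 / (cos (loc \<theta> i x) - elem_h \<theta> i)))
              integrable_on {\<theta> i..\<theta> (i + 1)}))"

definition arc_norm :: "real \<Rightarrow> nat \<Rightarrow> (nat \<Rightarrow> real) \<Rightarrow> (real \<Rightarrow> real) \<Rightarrow> real" where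
  "arc_norm b n \<theta> g =
     sqrt (if b = 0 then integral {-pi..pi} (\<lambda>x. (g x)\<^sup>2)
           else (\<Sum>i=1..n. integral {\<theta> i..\<theta> (i + 1)}
                   (\<lambda>x. (g x)\<^sup>2 * (1 / (cos (loc \<theta> i x) - elem_h \<theta> i)))))"

end

theory Submission
  imports Defs "HOL-Complex_Analysis.Complex_Analysis"
begin

text \<open>On an element, in the local angle \<open>x\<close>, the function splits as \<open>u (cos x) + sin x * v (cos x)\<close>.
  Evenness and periodicity make \<open>u\<close> and \<open>v\<close> holomorphic in the ellipse, including at the critical
  values \<open>\<plusminus>1\<close> of the cosine; \<open>u\<close> is bounded, and \<open>v\<close> is bounded by a constant over
  \<open>\<bar>1 - y\<^sup>2\<bar>\<close> to the power \<open>1/2\<close>, which is integrable along confocal ellipses uniformly up to the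
  boundary. The Cauchy formula on these ellipses gives polynomials of degree \<open>m\<close> that approximate \<open>u\<close> and
  \<open>v\<close> uniformly on \<open>[h, 1]\<close> up to \<open>O(\<rho>\<^sup>-\<^sup>m)\<close>. Both bases are orthogonal polynomials in
  \<open>\<sigma> = (cos x - 1) / (h - 1)\<close>, times \<open>sin x\<close> for the odd part, so the error estimate and the
  coefficient estimate follow from best approximation and Cauchy-Schwarz.

  For \<open>b = -1\<close> the hat functions interpolate at the nodes, and the remainder is divisible by
  \<open>cos x - h\<close>; the quotients of \<open>u\<close> and \<open>v\<close> are again holomorphic with the same bounds, and their
  expansions for the weight with \<open>b = 1\<close> yield the coefficients. A Nikolskii inequality upgrades
  convergence in norm to pointwise convergence, and the linear system determines the coefficients
  because the diagonals that couple \<open>P\<^sub>k\<close> for \<open>b = 1\<close> with \<open>P\<^sub>k\<close> for \<open>b = 0\<close> do not vanish.\<close>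

subsection \<open>Orthogonal families of polynomials\<close>

text \<open>Holomorphy is given only in the open ellipse, and the exact rate \<open>\<rho>\<close>
  forces contours that approach its boundary as \<open>m\<close> grows. Hence all bounds are needed
  uniformly on the contours, and only there. The delicate point is \<open>y = -1\<close>. The odd
  part is divided by the sine, whose square is \<open>(1 - y) * (1 + y)\<close>; the focus 1 keeps
  its distance from the contours, but -1 may lie inside, outside or on the limiting ellipse, so the
  majorant can be no better than integrable. The family with \<open>b = 1\<close> enters for
  \<open>b = -1\<close> by cancellation: an error divisible by \<open>1 - \<sigma>\<close>, squared
  and divided by \<open>cos x - h\<close>, leaves exactly one factor \<open>1 - \<sigma>\<close> as
  weight. Pointwise convergence serves to identify the coefficients, since for \<open>b = -1\<close>
  they are defined through it. Convergence in norm does not give it, because the weight degenerates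
  at the ends; the polynomial loss in the Nikolskii inequality is harmless against geometric
  decay.\<close>

lemma poly_expand_degree_family:
  fixes Q :: "nat \<Rightarrow> 'a::field poly"
  assumes deg: "\<And>j. j < k \<Longrightarrow> degree (Q j) = j \<and> Q j \<noteq> 0" and p: "p = 0 \<or> degree p < k"
  shows "\<exists>a. p = (\<Sum>j<k. smult (a j) (Q j))"
  using assms
proof (induction k arbitrary: p)
  case 0
  then show ?case by simp
next
  case (Suc k)
  define c where "c = coeff p k / lead_coeff (Q k)"
  have Qk: "degree (Q k) = k" "Q k \<noteq> 0" using Suc.prems(1)[of k] by auto
  have dp: "degree p \<le> k" using Suc.prems(2) by auto
  have "coeff (p - smult c (Q k)) k = 0"
    using Qk leading_coeff_0_iff[of "Q k"] by (auto simp: c_def)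
  moreover have "degree (p - smult c (Q k)) \<le> k"
    using dp Qk by (intro degree_diff_le) (auto intro: order_trans[OF degree_smult_le])
  ultimately have "p - smult c (Q k) = 0 \<or> degree (p - smult c (Q k)) < k"
    by (metis antisym_conv2 leading_coeff_0_iff)
  then obtain a where a: "p - smult c (Q k) = (\<Sum>j<k. smult (a j) (Q j))"
    using Suc.IH[of "p - smult c (Q k)"] Suc.prems(1) by auto
  have "p = (\<Sum>j<Suc k. smult ((a(k := c)) j) (Q j))"
    using a by (simp add: algebra_simps)
  then show ?case by blast
qed

text \<open>Gram-Schmidt on the monomials for an abstract positive definite form, followed by a
  rescaling that gives every member the norm of 1.\<close>

lemma exists_orthogonal_poly_family:
  fixes B :: "real poly \<Rightarrow> real poly \<Rightarrow> real"
  assumes add: "\<And>p q r. B (p + q) r = B p r + B q r"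
    and smult: "\<And>c p r. B (smult c p) r = c * B p r"
    and sym: "\<And>p q. B p q = B q p"
    and pos: "\<And>p. p \<noteq> 0 \<Longrightarrow> B p p > 0"
  shows "\<exists>P. P 0 = 1 \<and> (\<forall>k. degree (P k) = k) \<and> (\<forall>j k. j \<noteq> k \<longrightarrow> B (P j) (P k) = 0) \<and>
    (\<forall>k. B (P k) (P k) = B 1 1)"
proof -
  have zero: "B 0 r = 0" for r using smult[of 0 0 r] by simp
  have sumB: "B (\<Sum>j\<in>A. smult (a j) (Q j)) r = (\<Sum>j\<in>A. a j * B (Q j) r)"
    if "finite A" for A :: "nat set" and a Q r
    using that by (induction A) (auto simp: zero add smult)
  have diff: "B (p - q) r = B p r - B q r" for p q r
    using add[of p "smult (-1) q" r] smult[of "-1" q r] by simp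
  have "\<exists>q. degree q = k \<and> q \<noteq> 0 \<and> (\<forall>p. degree p < k \<longrightarrow> B q p = 0)" for k
  proof (induction k rule: less_induct)
    case (less k)
    then obtain Q where Q: "\<And>j. j < k \<Longrightarrow> degree (Q j) = j \<and> Q j \<noteq> 0 \<and> (\<forall>p. degree p < j \<longrightarrow> B (Q j) p = 0)"
      by metis
    \<comment> \<open>The projection of the monomial onto the earlier members. Its degree is below
      \<open>k\<close>, so \<open>q\<close> stays monic of degree \<open>k\<close>.\<close>
    define s where "s = (\<Sum>j<k. smult (B (monom 1 k) (Q j) / B (Q j) (Q j)) (Q j))"
    define q where "q = monom 1 k - s"
    have ds: "s = 0 \<or> degree s < k"
    proof (cases "k = 0")
      case False
      then show ?thesis unfolding s_def using Q
        by (intro disjI2 degree_sum_less) (auto intro: le_less_trans[OF degree_smult_le])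
    qed (simp add: s_def)
    have "coeff s k = 0" using ds coeff_eq_0 by auto
    hence "coeff q k = 1" by (simp add: q_def)
    moreover have "degree q \<le> k"
      unfolding q_def using ds by (intro degree_diff_le) (auto simp: degree_monom_eq)
    ultimately have dq: "degree q = k" "q \<noteq> 0"
      using le_degree[of q k] by auto
    have orth: "B q (Q i) = 0" if "i < k" for i
    proof -
      have "B (Q j) (Q i) = 0" if "j < k" "j \<noteq> i" for j
        using Q[of i] Q[of j] \<open>i < k\<close> that sym by (metis linorder_neqE_nat)
      hence "(\<Sum>j<k. B (monom 1 k) (Q j) / B (Q j) (Q j) * B (Q j) (Q i)) =
          (\<Sum>j<k. if j = i then B (monom 1 k) (Q i) else 0)"
        using Q[of i] pos[of "Q i"] that by (intro sum.cong) auto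
      thus ?thesis using that by (simp add: q_def diff s_def sumB)
    qed
    have "B q p = 0" if "degree p < k" for p
    proof -
      have "\<exists>a. p = (\<Sum>j<k. smult (a j) (Q j))"
        by (rule poly_expand_degree_family) (use Q that in auto)
      then obtain a where "p = (\<Sum>j<k. smult (a j) (Q j))" by blast
      thus ?thesis using orth by (simp add: sym[of q] sumB)
    qed
    thus ?case using dq by blast
  qed
  then obtain Q where Q: "\<And>k. degree (Q k) = k \<and> Q k \<noteq> 0 \<and> (\<forall>p. degree p < k \<longrightarrow> B (Q k) p = 0)"
    by metis
  define P where "P k = (if k = 0 then 1 else smult (sqrt (B 1 1 / B (Q k) (Q k))) (Q k))" for k
  have B1: "B 1 1 > 0" using pos by simp
  have sq: "B 1 1 / B (Q k) (Q k) > 0" for k using B1 pos Q by simp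
  have smult': "B r (smult c p) = c * B r p" for c p r using smult sym by metis
  have d: "degree (P k) = k" for k using Q sq[of k] by (auto simp: P_def)
  have o: "B (P k) (P j) = 0" if "j < k" for j k
    using that d[of j] Q[of k] by (auto simp: P_def[of k] smult)
  have "B (P k) (P k) = B 1 1" for k
  proof (cases "k = 0")
    case False
    define c where "c = sqrt (B 1 1 / B (Q k) (Q k))"
    have "c * c = B 1 1 / B (Q k) (Q k)"
      unfolding c_def using sq[of k] by (intro real_sqrt_mult_self[THEN trans] abs_of_pos)
    hence "c * (c * B (Q k) (Q k)) = B 1 1"
      using pos[of "Q k"] Q[of k] by (simp flip: mult.assoc)
    thus ?thesis using False by (simp add: P_def smult smult' c_def)
  qed (simp add: P_def)
  moreover have "B (P j) (P k) = 0" if "j < k" for j k using o[OF that] sym by metis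
  ultimately show ?thesis using d o
    by (intro exI[of _ P]) (auto simp: P_def[of 0] neq_iff )
qed

subsection \<open>Semiclassical Jacobi polynomials in the angular variable\<close>

definition sig :: "real \<Rightarrow> real \<Rightarrow> real" where
  "sig h x = (cos x - 1) / (h - 1)"

text \<open>The measure with density \<open>\<sigma> powr (e - 1/2) * (1 - \<sigma>) ^ b * (\<tau> -
  \<sigma>) powr (e - 1/2)\<close>, written in the angle. The half-integer powers and the Jacobian
  merge into an even power of the sine, so this weight is continuous up to the ends.\<close>

definition wt :: "real \<Rightarrow> nat \<Rightarrow> nat \<Rightarrow> real \<Rightarrow> real" where
  "wt h e b x = (1 - sig h x) ^ b * (sin x / (1 - h)) ^ (2 * e)"

lemma sig_minus [simp]: "sig h (- x) = sig h x"
  by (simp add: sig_def)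

lemma sig_0 [simp]: "sig h 0 = 0"
  by (simp add: sig_def)

lemma cos_less_one: "0 < x \<Longrightarrow> x \<le> pi \<Longrightarrow> cos x < (1::real)"
  using cos_monotone_0_pi[of 0 x] by simp

lemma sig_bounds:
  assumes "\<bar>x\<bar> \<le> \<phi>" "0 < \<phi>" "\<phi> \<le> pi"
  shows "sig (cos \<phi>) x \<in> {0..1}"
proof -
  have "cos \<phi> \<le> cos x" using cos_mono_le_eq[of \<phi> "\<bar>x\<bar>"] assms by simp
  thus ?thesis using cos_less_one[OF assms(2,3)] by (simp add: sig_def divide_simps)
qed

lemma sig_less_one:
  assumes "\<bar>x\<bar> < \<phi>" "0 < \<phi>" "\<phi> \<le> pi"
  shows "sig (cos \<phi>) x < 1"
proof -
  have "cos \<phi> < cos x" using cos_mono_less_eq[of \<phi> "\<bar>x\<bar>"] assms by simp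
  thus ?thesis using cos_less_one[OF assms(2,3)] by (simp add: sig_def divide_simps)
qed

lemma sig_pos:
  assumes "x \<noteq> 0" "\<bar>x\<bar> \<le> \<phi>" "0 < \<phi>" "\<phi> \<le> pi"
  shows "sig (cos \<phi>) x > 0"
  using cos_less_one[of "\<bar>x\<bar>"] cos_less_one[of \<phi>] assms by (simp add: sig_def divide_simps)

lemma sig_endpoint [simp]:
  assumes "0 < \<phi>" "\<phi> \<le> pi" shows "sig (cos \<phi>) \<phi> = 1"
  using cos_less_one[of \<phi>] assms by (simp add: sig_def)

lemma continuous_sig: "continuous_on A (sig h)"
proof -
  have "sig h = (\<lambda>x. inverse (h - 1) * (cos x - 1))"
    by (auto simp: sig_def field_simps)
  thus ?thesis by (auto intro!: continuous_on_mult_left continuous_intros)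
qed

lemma continuous_comp_sig:
  assumes "continuous_on {0..1} f" "0 < \<phi>" "\<phi> \<le> pi"
  shows "continuous_on {-\<phi>..\<phi>} (\<lambda>x. f (sig (cos \<phi>) x))"
  using sig_bounds[of _ \<phi>] assms
  by (intro continuous_on_compose2[OF assms(1)] continuous_sig) auto

lemma continuous_wt: "continuous_on A (wt h e b)"
proof -
  have "wt h e b = (\<lambda>x. inverse (1 - h) ^ (2 * e) * ((1 - sig h x) ^ b * sin x ^ (2 * e)))"
    by (auto simp: wt_def field_simps)
  thus ?thesis by (auto intro!: continuous_on_mult_left continuous_intros continuous_sig)
qed

lemma sig_image:
  assumes "0 < \<phi>" "\<phi> \<le> pi"
  shows "sig (cos \<phi>) ` {0<..<\<phi>} = {0<..<1}"
proof
  show "sig (cos \<phi>) ` {0<..<\<phi>} \<subseteq> {0<..<1}"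
    using sig_pos[of _ \<phi>] sig_less_one[of _ \<phi>] assms by auto
  show "{0<..<1} \<subseteq> sig (cos \<phi>) ` {0<..<\<phi>}"
  proof
    fix y :: real assume y: "y \<in> {0<..<1}"
    then obtain x where x: "0 \<le> x" "x \<le> \<phi>" "sig (cos \<phi>) x = y"
      using IVT'[of "sig (cos \<phi>)" 0 y \<phi>] assms continuous_sig by auto
    moreover have "x \<noteq> 0" "x \<noteq> \<phi>" using y x assms by auto
    ultimately show "y \<in> sig (cos \<phi>) ` {0<..<\<phi>}" by force
  qed
qed

text \<open>The equivalence transfers integrability together with the value: the weight in \<sigma>,
  possibly singular at the ends, inherits both from the continuous integrand in the angle. On the
  open interval the sine is positive, so the Jacobian needs no absolute value.\<close>

lemma sig_change_of_variables:
  assumes \<phi>: "0 < \<phi>" "\<phi> \<le> pi"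
  shows "(\<lambda>x. sin x / (1 - cos \<phi>) * f (sig (cos \<phi>) x)) absolutely_integrable_on {0<..<\<phi>} \<and>
           integral {0<..<\<phi>} (\<lambda>x. sin x / (1 - cos \<phi>) * f (sig (cos \<phi>) x)) = v \<longleftrightarrow>
         f absolutely_integrable_on {0<..<1} \<and> integral {0<..<1} f = v"
proof -
  have h: "cos \<phi> < 1" using cos_less_one \<phi> by auto
  have inj: "inj_on (sig (cos \<phi>)) {0<..<\<phi>}"
    using \<phi> h by (intro inj_onI) (auto simp: sig_def intro: cos_inj_pi)
  have der: "(sig (cos \<phi>) has_field_derivative (sin x / (1 - cos \<phi>))) (at x within {0<..<\<phi>})" for x
  proof -
    have "- sin x / (cos \<phi> - 1) = sin x / (1 - cos \<phi>)"
      by (metis minus_diff_eq minus_divide_divide)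
    moreover have "(sig (cos \<phi>) has_field_derivative ((- sin x - 0) / (cos \<phi> - 1))) (at x within {0<..<\<phi>})"
      unfolding sig_def by (intro DERIV_cdivide DERIV_diff DERIV_const DERIV_subset[OF DERIV_cos]) auto
    ultimately show ?thesis by simp
  qed
  have meas: "{0<..<\<phi>} \<in> sets lebesgue" by simp
  have abs: "\<bar>sin x / (1 - cos \<phi>)\<bar> = sin x / (1 - cos \<phi>)" if "x \<in> {0<..<\<phi>}" for x
    using that \<phi> h sin_gt_zero[of x] by auto
  have "(\<lambda>x. \<bar>sin x / (1 - cos \<phi>)\<bar> * f (sig (cos \<phi>) x)) absolutely_integrable_on {0<..<\<phi>} \<longleftrightarrow>
     (\<lambda>x. sin x / (1 - cos \<phi>) * f (sig (cos \<phi>) x)) absolutely_integrable_on {0<..<\<phi>}"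
    using abs by (intro absolutely_integrable_spike_eq[of "{}"]) auto
  moreover have "integral {0<..<\<phi>} (\<lambda>x. \<bar>sin x / (1 - cos \<phi>)\<bar> * f (sig (cos \<phi>) x)) =
      integral {0<..<\<phi>} (\<lambda>x. sin x / (1 - cos \<phi>) * f (sig (cos \<phi>) x))"
    using abs by (intro integral_cong) auto
  ultimately show ?thesis
    using has_absolute_integral_change_of_variables_1'[OF meas der inj, of f v]
    unfolding sig_image[OF \<phi>] by (simp only:)
qed

lemma continuous_imp_abs_integrable_open:
  fixes f :: "real \<Rightarrow> real"
  assumes "continuous_on {a..b} f"
  shows "f absolutely_integrable_on {a<..<b}" "integral {a<..<b} f = integral {a..b} f"
  using absolutely_integrable_continuous_real[OF assms]
  by (auto intro: set_integrable_subset simp: integral_open_interval_real)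

text \<open>The identity \<open>\<sigma> * (\<tau> - \<sigma>) = (sin x / (1 - h))\<^sup>2\<close>
  turns the two powers \<open>e - 1/2\<close> into the power \<open>2 * e - 1\<close> of
  \<open>s = sin x / (1 - h)\<close>; the Jacobian is the missing factor \<open>s\<close>.\<close>

lemma sj_weight_sig:
  assumes \<phi>: "0 < \<phi>" "\<phi> \<le> pi" and x: "x \<in> {0<..<\<phi>}"
  defines "h \<equiv> cos \<phi>"
  shows "sin x / (1 - h) * (sig h x powr (real e - 1/2) * (1 - sig h x) powr real b *
           (2 / (1 - h) - sig h x) powr (real e - 1/2)) = wt h e b x"
proof -
  define s where "s = sin x / (1 - h)"
  have h: "h < 1" using cos_less_one \<phi> by (auto simp: h_def)
  have s: "s > 0" using x \<phi> h sin_gt_zero[of x] by (auto simp: s_def)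
  have sg: "0 < sig h x" "sig h x < 1" using sig_pos[of x \<phi>] sig_less_one[of x \<phi>] x \<phi> by (auto simp: h_def)
  have "2 / (1 - h) \<ge> 1" using h cos_ge_minus_one[of \<phi>] by (simp add: h_def)
  hence pos: "2 / (1 - h) - sig h x > 0" using sg by simp
  have "sig h x * (2 / (1 - h) - sig h x) = s\<^sup>2"
  proof -
    have "sig h x = (1 - cos x) / (1 - h)" unfolding sig_def by (metis minus_diff_eq minus_divide_divide)
    hence "sig h x * (2 / (1 - h) - sig h x) = (1 - cos x) * (2 - (1 - cos x)) / ((1 - h) * (1 - h))"
      by (simp only: diff_divide_distrib[symmetric] times_divide_times_eq)
    also have "(1 - cos x) * (2 - (1 - cos x)) = (sin x)\<^sup>2"
      by (simp add: sin_squared_eq power2_eq_square algebra_simps)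
    finally show ?thesis by (simp add: s_def power_divide power2_eq_square)
  qed
  hence "sig h x powr (real e - 1/2) * (2 / (1 - h) - sig h x) powr (real e - 1/2) = (s\<^sup>2) powr (real e - 1/2)"
    using sg pos by (simp flip: powr_mult)
  also have "\<dots> = s powr (2 * real e - 1)"
  proof -
    have "s\<^sup>2 = s powr 2" using s by simp
    hence "(s\<^sup>2) powr (real e - 1/2) = s powr (2 * (real e - 1/2))" by (simp only: powr_powr)
    thus ?thesis by (simp add: algebra_simps)
  qed
  finally have "sin x / (1 - h) * (sig h x powr (real e - 1/2) * (1 - sig h x) powr real b *
           (2 / (1 - h) - sig h x) powr (real e - 1/2)) = (s powr 1 * s powr (2 * real e - 1)) * (1 - sig h x) powr real b"
    unfolding s_def[symmetric] using s by (simp add: ac_simps)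
  also have "s powr 1 * s powr (2 * real e - 1) = s ^ (2 * e)"
    using s powr_add[of s 1 "2 * real e - 1"] powr_realpow[of s "2 * e"] by simp
  finally show ?thesis
    unfolding wt_def s_def[symmetric] using sg powr_realpow[of "1 - sig h x" b] by (simp only: mult.commute diff_gt_0_iff_gt)
qed

lemma sj_inner_trig:
  assumes \<phi>: "0 < \<phi>" "\<phi> \<le> pi"
  shows "sj_inner (2 / (1 - cos \<phi>)) (real e - 1/2) (real b) (real e - 1/2) p q =
    integral {0..\<phi>} (\<lambda>x. poly p (sig (cos \<phi>) x) * poly q (sig (cos \<phi>) x) * wt (cos \<phi>) e b x)"
    (is "_ = integral _ ?g")
proof -
  define f where "f = (\<lambda>x. poly p x * poly q x * (x powr (real e - 1/2) * (1 - x) powr (real b) *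
     (2 / (1 - cos \<phi>) - x) powr (real e - 1/2)))"
  have eq: "sin x / (1 - cos \<phi>) * f (sig (cos \<phi>) x) = ?g x" if "x \<in> {0<..<\<phi>}" for x
    unfolding f_def sj_weight_sig[OF \<phi> that, symmetric] by simp
  have cont: "continuous_on {0..\<phi>} ?g"
    by (intro continuous_intros continuous_wt continuous_sig)
  have "(\<lambda>x. sin x / (1 - cos \<phi>) * f (sig (cos \<phi>) x)) absolutely_integrable_on {0<..<\<phi>} \<longleftrightarrow>
     ?g absolutely_integrable_on {0<..<\<phi>}"
    using eq by (intro absolutely_integrable_spike_eq[of "{}"]) auto
  moreover have "integral {0<..<\<phi>} (\<lambda>x. sin x / (1 - cos \<phi>) * f (sig (cos \<phi>) x)) = integral {0<..<\<phi>} ?g"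
    using eq by (intro integral_cong) auto
  ultimately have "integral {0<..<1} f = integral {0..\<phi>} ?g"
    using sig_change_of_variables[OF \<phi>, of f "integral {0..\<phi>} ?g"]
      continuous_imp_abs_integrable_open[OF cont] by auto
  thus ?thesis by (simp add: sj_inner_def f_def integral_open_interval_real)
qed

lemma integral_Cauchy_Schwarz:
  fixes f g :: "real \<Rightarrow> real"
  assumes f: "continuous_on {a..b} f" and g: "continuous_on {a..b} g"
  shows "(integral {a..b} (\<lambda>x. f x * g x))\<^sup>2 \<le>
    integral {a..b} (\<lambda>x. (f x)\<^sup>2) * integral {a..b} (\<lambda>x. (g x)\<^sup>2)"
proof -
  define A B D where "A = integral {a..b} (\<lambda>x. (f x)\<^sup>2)" and "B = integral {a..b} (\<lambda>x. f x * g x)"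
    and "D = integral {a..b} (\<lambda>x. (g x)\<^sup>2)"
  have "(\<lambda>x. (f x)\<^sup>2) integrable_on {a..b}" "(\<lambda>x. f x * g x) integrable_on {a..b}"
     "(\<lambda>x. (g x)\<^sup>2) integrable_on {a..b}"
    using f g by (auto intro!: integrable_continuous_real continuous_intros)
  hence I: "((\<lambda>x. (f x)\<^sup>2) has_integral A) {a..b}" "((\<lambda>x. f x * g x) has_integral B) {a..b}"
     "((\<lambda>x. (g x)\<^sup>2) has_integral D) {a..b}"
    unfolding A_def B_def D_def by (auto simp: integrable_integral)
  have D0: "D \<ge> 0" by (rule has_integral_nonneg[OF I(3)]) auto
  have quad: "0 \<le> s\<^sup>2 * A + 2 * s * t * B + t\<^sup>2 * D" for s t
  proof -
    have "((\<lambda>x. s\<^sup>2 * (f x)\<^sup>2 + 2 * s * t * (f x * g x) + t\<^sup>2 * (g x)\<^sup>2) has_integral (s\<^sup>2 * A + 2 * s * t * B + t\<^sup>2 * D)) {a..b}"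
      by (intro has_integral_add has_integral_mult_right I)
    moreover have "s\<^sup>2 * (f x)\<^sup>2 + 2 * s * t * (f x * g x) + t\<^sup>2 * (g x)\<^sup>2 = (s * f x + t * g x)\<^sup>2" for x
      by (simp add: power2_eq_square algebra_simps)
    ultimately show ?thesis by (metis (no_types, lifting) has_integral_nonneg zero_le_power2)
  qed
  have "B\<^sup>2 \<le> A * D"
  proof (cases "D = 0")
    case True
    have "B = 0"
    proof (rule ccontr)
      assume "B \<noteq> 0"
      \<comment> \<open>With \<open>D = 0\<close> the form is linear in \<open>t\<close>, and at
        this argument it equals -1.\<close>
      thus False using quad[of 1 "- (A + 1) / (2 * B)"] True by (auto simp: field_simps)
    qed
    thus ?thesis using True by simp
  next
    case False
    have "0 \<le> D * (A * D - B\<^sup>2)" using quad[of D "-B"] by (simp add: power2_eq_square algebra_simps)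
    thus ?thesis using False D0 by (simp add: zero_le_mult_iff)
  qed
  thus ?thesis by (simp add: A_def B_def D_def)
qed

lemma wt_nonneg:
  assumes "\<bar>x\<bar> \<le> \<phi>" "0 < \<phi>" "\<phi> \<le> pi" shows "wt (cos \<phi>) e b x \<ge> 0"
  using sig_bounds[OF assms] by (simp add: wt_def)

lemma wt_pos:
  assumes "0 < x" "x < \<phi>" "\<phi> \<le> pi" shows "wt (cos \<phi>) e b x > 0"
proof -
  have "sin x / (1 - cos \<phi>) > 0" using assms sin_gt_zero[of x] cos_less_one[of \<phi>] by simp
  thus ?thesis using sig_less_one[of x \<phi>] assms by (simp add: wt_def)
qed

text \<open>Geometric decay of the best polynomial approximation on [0,1]. This is the only form in
  which analyticity reaches the orthogonal expansions.\<close>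

definition rapprox :: "real \<Rightarrow> (real \<Rightarrow> real) \<Rightarrow> bool" where
  "rapprox \<rho> g \<longleftrightarrow> (\<exists>C. \<forall>m. \<exists>p. degree p \<le> m \<and> (\<forall>y\<in>{0..1}. \<bar>g y - poly p y\<bar> \<le> C / \<rho> ^ m))"

lemma rapprox_continuous:
  assumes "rapprox \<rho> g" "\<rho> > 1"
  shows "continuous_on {0..1} g"
proof -
  obtain C p where p: "\<And>m y. y \<in> {0..1} \<Longrightarrow> \<bar>g y - poly (p m) y\<bar> \<le> C / \<rho> ^ m"
    using assms(1) unfolding rapprox_def by metis
  have lim: "(\<lambda>m. C / \<rho> ^ m) \<longlonglongrightarrow> 0"
    using tendsto_mult_right_zero[OF LIMSEQ_inverse_realpow_zero[OF assms(2)], of C] by (simp add: divide_inverse)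
  have "uniform_limit {0..1} (\<lambda>m. poly (p m)) g sequentially"
  proof (rule uniform_limitI)
    fix \<epsilon> :: real assume "\<epsilon> > 0"
    hence "\<forall>\<^sub>F m in sequentially. C / \<rho> ^ m < \<epsilon>" using order_tendstoD(2)[OF lim] by simp
    thus "\<forall>\<^sub>F m in sequentially. \<forall>x\<in>{0..1}. dist (poly (p m) x) (g x) < \<epsilon>"
    proof eventually_elim
      case (elim m)
      show ?case
        using p[of _ m] elim by (metis abs_minus_commute dist_real_def order_le_less_trans)
    qed
  qed
  thus ?thesis by (rule uniform_limit_theorem[rotated]) (auto intro!: always_eventually continuous_intros)
qed

lemma rapprox_mono:
  assumes "rapprox \<rho>' g" "1 < \<rho>" "\<rho> \<le> \<rho>'"
  shows "rapprox \<rho> g"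
proof -
  obtain C p where p: "\<And>m. degree (p m) \<le> m" "\<And>m y. y \<in> {0..1} \<Longrightarrow> \<bar>g y - poly (p m) y\<bar> \<le> C / \<rho>' ^ m"
    using assms(1) unfolding rapprox_def by metis
  have "\<bar>g y - poly (p m) y\<bar> \<le> \<bar>C\<bar> / \<rho> ^ m" if "y \<in> {0..1}" for m y
  proof -
    have "C / \<rho>' ^ m \<le> \<bar>C\<bar> / \<rho> ^ m" using assms by (intro frac_le power_mono) auto
    thus ?thesis using p(2)[OF that, of m] by linarith
  qed
  thus ?thesis unfolding rapprox_def using p(1) by blast
qed

section \<open>Orthogonal expansions for one parity and one weight\<close>

locale arc_weight =
  fixes \<phi> :: real and e b :: nat
  assumes \<phi>: "0 < \<phi>" "\<phi> < pi"
begin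

text \<open>Here \<open>e\<close> is the power of the sine carried by the basis function: 0 for
  \<open>p\<^sub>k\<close>, 1 for \<open>q\<^sub>k\<close>. The exponent \<open>b\<close> is 0 for
  the first basis and 1 for the quotients behind the second. Half of the element suffices because
  these integrands are even in the angle.\<close>

definition ip :: "(real \<Rightarrow> real) \<Rightarrow> (real \<Rightarrow> real) \<Rightarrow> real" where
  "ip f g = integral {0..\<phi>} (\<lambda>x. f (sig (cos \<phi>) x) * g (sig (cos \<phi>) x) * wt (cos \<phi>) e b x)"

lemma cont_sig: "continuous_on {0..1} f \<Longrightarrow> continuous_on {0..\<phi>} (\<lambda>x. f (sig (cos \<phi>) x))"
  using continuous_comp_sig[of f \<phi>] \<phi> continuous_on_subset[of "{-\<phi>..\<phi>}" _ "{0..\<phi>}"] by auto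

lemma has_integral_ip:
  assumes "continuous_on {0..1} f" "continuous_on {0..1} g"
  shows "((\<lambda>x. f (sig (cos \<phi>) x) * g (sig (cos \<phi>) x) * wt (cos \<phi>) e b x) has_integral ip f g) {0..\<phi>}"
  unfolding ip_def
  by (intro integrable_integral integrable_continuous_real continuous_intros cont_sig assms continuous_wt)

lemma ip_commute: "ip f g = ip g f"
  by (simp add: ip_def mult.commute)

lemma ip_cong: "(\<And>y. y \<in> {0..1} \<Longrightarrow> f y = f' y) \<Longrightarrow> (\<And>y. y \<in> {0..1} \<Longrightarrow> g y = g' y) \<Longrightarrow> ip f g = ip f' g'"
  unfolding ip_def using \<phi> sig_bounds[of _ \<phi>] by (intro integral_cong) auto

lemma ip_add:
  assumes "continuous_on {0..1} f" "continuous_on {0..1} f'" "continuous_on {0..1} g"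
  shows "ip (\<lambda>y. f y + f' y) g = ip f g + ip f' g"
  using has_integral_add[OF has_integral_ip[OF assms(1,3)] has_integral_ip[OF assms(2,3)]]
  unfolding ip_def[of "\<lambda>y. f y + f' y"] by (intro integral_unique) (simp add: algebra_simps)

lemma ip_cmult: "ip (\<lambda>y. c * f y) g = c * ip f g"
  unfolding ip_def by (simp flip: integral_mult_right add: mult.assoc)

lemma ip_diff:
  assumes "continuous_on {0..1} f" "continuous_on {0..1} f'" "continuous_on {0..1} g"
  shows "ip (\<lambda>y. f y - f' y) g = ip f g - ip f' g"
  using ip_add[of f "\<lambda>y. -1 * f' y" g] assms ip_cmult[of "-1" f' g] by (simp add: continuous_intros)

lemma ip_sum:
  assumes "\<And>k. k \<in> A \<Longrightarrow> continuous_on {0..1} (f k)" "continuous_on {0..1} g" "finite A"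
  shows "ip (\<lambda>y. \<Sum>k\<in>A. f k y) g = (\<Sum>k\<in>A. ip (f k) g)"
  using assms(3,1,2)
proof (induction A)
  case empty
  then show ?case using ip_cmult[of 0 "\<lambda>_. 0" g] by simp
next
  case (insert x A)
  then show ?case by (simp add: ip_add continuous_intros)
qed

lemma ip_nonneg: assumes "continuous_on {0..1} f" shows "ip f f \<ge> 0"
  by (rule has_integral_nonneg[OF has_integral_ip[OF assms assms]]) (use wt_nonneg[of _ \<phi>] \<phi> in auto)

lemma ip_mono:
  assumes "continuous_on {0..1} f" "continuous_on {0..1} g" "\<And>y. y \<in> {0..1} \<Longrightarrow> \<bar>f y\<bar> \<le> \<bar>g y\<bar>"
  shows "ip f f \<le> ip g g"
proof (rule has_integral_le[OF has_integral_ip[OF assms(1,1)] has_integral_ip[OF assms(2,2)]])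
  fix x assume x: "x \<in> {0..\<phi>}"
  have "f (sig (cos \<phi>) x) * f (sig (cos \<phi>) x) \<le> g (sig (cos \<phi>) x) * g (sig (cos \<phi>) x)"
    using assms(3)[OF sig_bounds[of x \<phi>]] x \<phi> by (simp add: abs_le_square_iff flip: power2_eq_square)
  thus "f (sig (cos \<phi>) x) * f (sig (cos \<phi>) x) * wt (cos \<phi>) e b x \<le> g (sig (cos \<phi>) x) * g (sig (cos \<phi>) x) * wt (cos \<phi>) e b x"
    using wt_nonneg[of x \<phi>] x \<phi> by (intro mult_right_mono) auto
qed

text \<open>The weight may vanish at both ends, so nothing is claimed there; the open interval is
  enough to annihilate a polynomial.\<close>

lemma ip_eq_0D:
  assumes "continuous_on {0..1} f" "ip f f = 0" "y \<in> {0<..<1}"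
  shows "f y = 0"
proof -
  obtain x where x: "x \<in> {0<..<\<phi>}" "sig (cos \<phi>) x = y" using sig_image[of \<phi>] assms(3) \<phi> by (metis imageE less_imp_le)
  let ?g = "\<lambda>x. f (sig (cos \<phi>) x) * f (sig (cos \<phi>) x) * wt (cos \<phi>) e b x"
  have "?g x = 0"
  proof (rule has_integral_0_cbox_imp_0[of 0 \<phi> ?g x])
    show "continuous_on (cbox 0 \<phi>) ?g"
      unfolding cbox_interval by (intro continuous_intros cont_sig assms(1) continuous_wt)
    show "(?g has_integral 0) (cbox 0 \<phi>)" using has_integral_ip[OF assms(1,1)] assms(2) by simp
    show "0 \<le> ?g y" if "y \<in> box 0 \<phi>" for y using that wt_nonneg[of y \<phi>] \<phi> by simp
  qed (use x in auto)
  thus ?thesis using wt_pos[of x \<phi> e b] x \<phi> by auto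
qed

lemma ip_Cauchy_Schwarz:
  assumes "continuous_on {0..1} f" "continuous_on {0..1} g"
  shows "(ip f g)\<^sup>2 \<le> ip f f * ip g g"
proof -
  define w where "w = (\<lambda>x. sqrt (wt (cos \<phi>) e b x))"
  have w: "w x * w x = wt (cos \<phi>) e b x" if "x \<in> {0..\<phi>}" for x
    using that wt_nonneg[of x \<phi> e b] \<phi> by (auto simp: w_def)
  have eq: "integral {0..\<phi>} (\<lambda>x. (f (sig (cos \<phi>) x) * w x) * (g (sig (cos \<phi>) x) * w x)) = ip f g" for f g
    unfolding ip_def by (intro integral_cong) (simp flip: w add: ac_simps)
  have "continuous_on {0..\<phi>} w" unfolding w_def by (intro continuous_intros continuous_wt)
  thus ?thesis
    using integral_Cauchy_Schwarz[of 0 \<phi> "\<lambda>x. f (sig (cos \<phi>) x) * w x" "\<lambda>x. g (sig (cos \<phi>) x) * w x"] assms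
    by (simp add: eq continuous_intros cont_sig power2_eq_square)
qed

lemma poly_ip_pos:
  assumes "p \<noteq> 0" shows "ip (poly p) (poly p) > 0"
proof (rule ccontr)
  have c: "continuous_on {0..1} (poly p)" by (intro continuous_intros)
  assume "\<not> ip (poly p) (poly p) > 0"
  hence "ip (poly p) (poly p) = 0" using ip_nonneg[OF c] by simp
  hence "{0<..<1} \<subseteq> {x. poly p x = 0}" using ip_eq_0D[OF c] by auto
  thus False using poly_roots_finite[OF assms] infinite_Ioo[OF zero_less_one[where 'a = real]] finite_subset by blast
qed

definition fam :: "nat \<Rightarrow> real poly" where
  "fam = sj_family (2 / (1 - cos \<phi>)) (real e - 1/2) (real b) (real e - 1/2)"

definition nrm :: real where "nrm = ip (\<lambda>_. 1) (\<lambda>_. 1)"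

text \<open>Gram-Schmidt makes the \<open>SOME\<close> in \<open>sj_family\<close> meaningful. Only
  degree, orthogonality and normalisation are extracted, so the arbitrary signs never
  matter.\<close>

lemma fam_props: "fam 0 = 1 \<and> (\<forall>k. degree (fam k) = k) \<and>
   (\<forall>j k. j \<noteq> k \<longrightarrow> ip (poly (fam j)) (poly (fam k)) = 0) \<and>
   (\<forall>k. ip (poly (fam k)) (poly (fam k)) = ip (poly 1) (poly 1))"
proof -
  have eq: "sj_inner (2 / (1 - cos \<phi>)) (real e - 1/2) (real b) (real e - 1/2) p q = ip (poly p) (poly q)" for p q
    using sj_inner_trig[of \<phi> e b p q] \<phi> by (simp add: ip_def)
  have [simp]: "continuous_on {0..1} (poly p)" for p :: "real poly" by (intro continuous_intros)
  have "\<exists>P. is_sj_family (2 / (1 - cos \<phi>)) (real e - 1/2) (real b) (real e - 1/2) P"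
    unfolding is_sj_family_def eq
  proof (rule exists_orthogonal_poly_family)
    show "ip (poly (p + q)) (poly r) = ip (poly p) (poly r) + ip (poly q) (poly r)" for p q r
    proof -
      have "poly (p + q) = (\<lambda>y. poly p y + poly q y)" by (rule ext) simp
      thus ?thesis using ip_add[of "poly p" "poly q" "poly r"] by simp
    qed
    show "ip (poly (smult c p)) (poly r) = c * ip (poly p) (poly r)" for c p r
    proof -
      have "poly (smult c p) = (\<lambda>y. c * poly p y)" by (rule ext) simp
      thus ?thesis using ip_cmult[of c "poly p" "poly r"] by simp
    qed
  qed (auto simp: poly_ip_pos intro: ip_commute)
  hence "is_sj_family (2 / (1 - cos \<phi>)) (real e - 1/2) (real b) (real e - 1/2) fam"
    unfolding fam_def sj_family_def by (rule someI_ex)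
  thus ?thesis unfolding is_sj_family_def eq .
qed

lemma cont_poly [simp]: "continuous_on {0..1} (poly p)" for p :: "real poly"
  by (intro continuous_intros)

lemma fam_0 [simp]: "fam 0 = 1" and degree_fam [simp]: "degree (fam k) = k"
  and ip_fam: "ip (poly (fam j)) (poly (fam k)) = (if j = k then nrm else 0)"
  using fam_props by (auto simp: nrm_def poly_1[abs_def])

lemma fam_nonzero [simp]: "fam k \<noteq> 0"
  by (metis degree_0 degree_fam fam_0 one_neq_zero)

lemma nrm_pos: "nrm > 0"
  using poly_ip_pos[of 1] by (simp add: nrm_def poly_1[abs_def])

definition coeff_of :: "(real \<Rightarrow> real) \<Rightarrow> nat \<Rightarrow> real" where
  "coeff_of f k = ip f (poly (fam k)) / nrm"

text \<open>The orthogonal projection onto polynomials of degree below \<open>N\<close>. Since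
  \<open>N\<close> counts terms, a degree bound \<open>m\<close> corresponds to
  \<open>N = Suc m\<close>.\<close>

definition psum :: "(real \<Rightarrow> real) \<Rightarrow> nat \<Rightarrow> real poly" where
  "psum f N = (\<Sum>k<N. smult (coeff_of f k) (fam k))"

lemma poly_psum: "poly (psum f N) y = (\<Sum>k<N. coeff_of f k * poly (fam k) y)"
  by (simp add: psum_def poly_sum)

lemma degree_psum: "N > 0 \<Longrightarrow> degree (psum f N) < N"
  unfolding psum_def by (rule degree_sum_less) (auto intro: le_less_trans[OF degree_smult_le])

lemma ip_fam_span:
  assumes "continuous_on {0..1} f" "\<And>j. j < N \<Longrightarrow> ip f (poly (fam j)) = 0" "p = 0 \<or> degree p < N"
  shows "ip f (poly p) = 0"
proof -
  obtain a where a: "p = (\<Sum>j<N. smult (a j) (fam j))"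
    using poly_expand_degree_family[of N fam p] assms(3) by auto
  have "poly p = (\<lambda>y. \<Sum>j<N. a j * poly (fam j) y)" by (auto simp: a poly_sum)
  thus ?thesis using assms(1,2)
    by (simp add: ip_commute[of f] ip_sum continuous_intros ip_cmult)
qed

lemma ip_psum_fam: "ip (poly (psum f N)) (poly (fam j)) = (if j < N then ip f (poly (fam j)) else 0)"
proof -
  have "poly (psum f N) = (\<lambda>y. \<Sum>k<N. coeff_of f k * poly (fam k) y)" by (auto simp: poly_psum)
  hence "ip (poly (psum f N)) (poly (fam j)) = (\<Sum>k<N. coeff_of f k * (if k = j then nrm else 0))"
    by (simp add: ip_sum continuous_intros ip_cmult ip_fam)
  also have "\<dots> = (\<Sum>k<N. if k = j then coeff_of f j * nrm else 0)" by (intro sum.cong) auto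
  finally show ?thesis using nrm_pos by (simp add: coeff_of_def)
qed

lemma psum_orthogonal:
  assumes "continuous_on {0..1} f" "p = 0 \<or> degree p < N"
  shows "ip (\<lambda>y. f y - poly (psum f N) y) (poly p) = 0"
  using assms(1) by (intro ip_fam_span[OF _ _ assms(2)] continuous_on_diff cont_poly) (simp_all add: ip_diff ip_psum_fam)

lemma ip_poly_fam_eq_0: "p = 0 \<or> degree p < k \<Longrightarrow> ip (poly p) (poly (fam k)) = 0"
  unfolding ip_commute[of "poly p"] by (rule ip_fam_span[of _ k]) (auto simp: ip_fam)

lemma psum_poly:
  assumes "p = 0 \<or> degree p < N" shows "psum (poly p) N = p"
proof (rule ccontr)
  define q where "q = p - psum (poly p) N"
  assume "psum (poly p) N \<noteq> p"
  hence q: "q \<noteq> 0" by (simp add: q_def)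
  have "q = 0 \<or> degree q < N"
  proof (cases "N = 0")
    case False
    thus ?thesis using degree_psum[of N "poly p"] assms degree_diff_less[of p N] unfolding q_def by auto
  qed (use assms in \<open>auto simp: q_def psum_def\<close>)
  hence "ip (\<lambda>y. poly p y - poly (psum (poly p) N) y) (poly q) = 0" by (intro psum_orthogonal) auto
  moreover have "(\<lambda>y. poly p y - poly (psum (poly p) N) y) = poly q" by (auto simp: q_def)
  ultimately show False using poly_ip_pos[OF q] by simp
qed

abbreviation sq_error :: "(real \<Rightarrow> real) \<Rightarrow> nat \<Rightarrow> real" where
  "sq_error f N \<equiv> ip (\<lambda>y. f y - poly (psum f N) y) (\<lambda>y. f y - poly (psum f N) y)"

text \<open>Pythagoras: the residual is orthogonal to the difference between the projection and the
  competitor.\<close>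

lemma psum_best:
  assumes f: "continuous_on {0..1} f" and p: "p = 0 \<or> degree p < N"
  shows "sq_error f N \<le>
         ip (\<lambda>y. f y - poly p y) (\<lambda>y. f y - poly p y)"
proof -
  define u where "u = (\<lambda>y. f y - poly (psum f N) y)"
  define v where "v = poly (psum f N - p)"
  have c: "continuous_on {0..1} u" "continuous_on {0..1} v"
    unfolding u_def v_def by (intro continuous_intros f)+
  have "psum f N - p = 0 \<or> degree (psum f N - p) < N"
  proof (cases "N = 0")
    case False
    thus ?thesis using degree_psum[of N f] p degree_diff_less[of _ N p] by auto
  qed (use p in \<open>auto simp: psum_def\<close>)
  hence uv: "ip u v = 0" unfolding u_def v_def by (intro psum_orthogonal f)
  have eq: "(\<lambda>y. f y - poly p y) = (\<lambda>y. u y + v y)" by (auto simp: u_def v_def)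
  have exp: "ip (\<lambda>y. u y + v y) (\<lambda>y. u y + v y) = ip u u + 2 * ip u v + ip v v"
  proof -
    have c': "continuous_on {0..1} (\<lambda>y. u y + v y)" using c by (intro continuous_intros)
    have "ip w (\<lambda>y. u y + v y) = ip u w + ip v w" if "continuous_on {0..1} w" for w
      using ip_add[OF c that] ip_commute by simp
    thus ?thesis using ip_add[OF c c'] c ip_commute[of v u] by simp
  qed
  show ?thesis unfolding eq exp u_def[symmetric] using uv ip_nonneg[OF c(2)] by simp
qed

lemma rapprox_psum_error:
  assumes "rapprox \<rho> f" "\<rho> > 1"
  shows "\<exists>C. \<forall>N. sq_error f N \<le> (C / \<rho> ^ N)\<^sup>2"
proof -
  have f: "continuous_on {0..1} f" using rapprox_continuous assms by blast
  obtain C p where p: "\<And>m. degree (p m) \<le> m" "\<And>m y. y \<in> {0..1} \<Longrightarrow> \<bar>f y - poly (p m) y\<bar> \<le> C / \<rho> ^ m"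
    using assms(1) unfolding rapprox_def by metis
  \<comment> \<open>The factor \<open>\<rho>\<close> pays for an approximant of degree
    \<open>N - 1\<close> at rate \<open>\<rho> ^ N\<close>; the last summand covers
    \<open>N = 0\<close>, where the partial sum is zero.\<close>
  define K where "K = \<bar>C\<bar> * \<rho> * sqrt nrm + sqrt (ip f f)"
  have "sq_error f N \<le> (K / \<rho> ^ N)\<^sup>2" for N
  proof (cases N)
    case 0
    have "sqrt (ip f f) \<le> K" using nrm_pos assms by (simp add: K_def)
    hence "ip f f \<le> K\<^sup>2" using ip_nonneg[OF f] by (simp add: sqrt_le_D)
    thus ?thesis using 0 by (simp add: psum_def)
  next
    case (Suc m)
    have "sq_error f N \<le>
         ip (\<lambda>y. f y - poly (p m) y) (\<lambda>y. f y - poly (p m) y)"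
      using p(1)[of m] Suc by (intro psum_best f) auto
    also have "\<dots> \<le> ip (\<lambda>y. C / \<rho> ^ m * 1) (\<lambda>y. C / \<rho> ^ m * 1)"
    proof (intro ip_mono continuous_intros f cont_poly)
      show "\<bar>f y - poly (p m) y\<bar> \<le> \<bar>C / \<rho> ^ m * 1\<bar>" if "y \<in> {0..1}" for y
        using p(2)[OF that, of m] by linarith
    qed
    also have "\<dots> = (\<bar>C\<bar> / \<rho> ^ m * sqrt nrm)\<^sup>2"
    proof -
      have "ip (\<lambda>y. c * 1) (\<lambda>y. c * 1) = c * (c * nrm)" for c :: real
        using ip_cmult[of c "\<lambda>_. 1" "\<lambda>y. c * 1"] ip_cmult[of c "\<lambda>_. 1" "\<lambda>_. 1"]
          ip_commute[of "\<lambda>_. 1" "\<lambda>y. c * 1"] by (simp add: nrm_def)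
      hence "ip (\<lambda>y. C / \<rho> ^ m * 1) (\<lambda>y. C / \<rho> ^ m * 1) = (C / \<rho> ^ m)\<^sup>2 * nrm"
        by (simp only: power2_eq_square mult.assoc)
      also have "\<dots> = (\<bar>C\<bar> / \<rho> ^ m)\<^sup>2 * (sqrt nrm)\<^sup>2"
        using nrm_pos by (simp add: power_divide)
      finally show ?thesis by (simp only: power_mult_distrib)
    qed
    also have "\<dots> \<le> (K / \<rho> ^ N)\<^sup>2"
    proof (rule power_mono)
      have "\<bar>C\<bar> / \<rho> ^ m * sqrt nrm = \<bar>C\<bar> * \<rho> * sqrt nrm / \<rho> ^ N" using Suc assms by simp
      also have "\<dots> \<le> K / \<rho> ^ N" using ip_nonneg[OF f] assms by (intro divide_right_mono) (auto simp: K_def)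
      finally show "\<bar>C\<bar> / \<rho> ^ m * sqrt nrm \<le> K / \<rho> ^ N" .
    qed (use nrm_pos assms in auto)
    finally show ?thesis .
  qed
  thus ?thesis by blast
qed

text \<open>The first \<open>k\<close> terms are orthogonal to \<open>fam k\<close>, so the
  coefficient of \<open>f\<close> is also that of the residual, to which Cauchy-Schwarz
  applies.\<close>

lemma rapprox_coeff_of:
  assumes "rapprox \<rho> f" "\<rho> > 1"
  shows "\<exists>C. \<forall>k. \<bar>coeff_of f k\<bar> \<le> C / \<rho> ^ k"
proof -
  have f: "continuous_on {0..1} f" using rapprox_continuous assms by blast
  obtain C where C: "\<And>N. sq_error f N \<le> (C / \<rho> ^ N)\<^sup>2"
    using rapprox_psum_error[OF assms] by blast
  have "\<bar>coeff_of f k\<bar> \<le> (\<bar>C\<bar> / sqrt nrm) / \<rho> ^ k" for k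
  proof -
    let ?d = "\<lambda>y. f y - poly (psum f k) y"
    have "ip ?d (poly (fam k)) = ip f (poly (fam k))"
      by (simp add: ip_diff f ip_psum_fam)
    hence "(coeff_of f k * nrm)\<^sup>2 = (ip ?d (poly (fam k)))\<^sup>2" using nrm_pos by (simp add: coeff_of_def)
    also have "\<dots> \<le> ip ?d ?d * nrm"
      using ip_Cauchy_Schwarz[of ?d "poly (fam k)"] f by (simp add: ip_fam continuous_intros)
    also have "\<dots> \<le> (C / \<rho> ^ k)\<^sup>2 * nrm" using C[of k] nrm_pos by simp
    also have "\<dots> = (\<bar>C\<bar> / \<rho> ^ k * sqrt nrm)\<^sup>2" using nrm_pos by (simp add: power_mult_distrib power_divide)
    finally have "\<bar>coeff_of f k * nrm\<bar> \<le> \<bar>C\<bar> / \<rho> ^ k * sqrt nrm"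
      using assms nrm_pos by (simp flip: abs_le_square_iff)
    moreover have "\<bar>coeff_of f k * nrm\<bar> = (\<bar>coeff_of f k\<bar> * sqrt nrm) * sqrt nrm" using nrm_pos by (simp add: abs_mult)
    ultimately have "(\<bar>coeff_of f k\<bar> * sqrt nrm) * sqrt nrm \<le> (\<bar>C\<bar> / \<rho> ^ k) * sqrt nrm" by (simp only:)
    hence "\<bar>coeff_of f k\<bar> * sqrt nrm \<le> \<bar>C\<bar> / \<rho> ^ k" using nrm_pos by (simp only: mult_le_cancel_right_pos real_sqrt_gt_0_iff)
    hence "\<bar>coeff_of f k\<bar> \<le> \<bar>C\<bar> / \<rho> ^ k / sqrt nrm" using nrm_pos by (simp only: pos_le_divide_eq real_sqrt_gt_0_iff)
    thus ?thesis by (simp add: mult.commute)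
  qed
  thus ?thesis by blast
qed

end

subsection \<open>Approximation of functions holomorphic in an ellipse\<close>

lemma periodic_int_multiple:
  fixes A :: "complex \<Rightarrow> complex"
  assumes per: "\<And>z. P z \<Longrightarrow> A (z + 2 * of_real pi) = A z" and P: "\<And>z. P (z + 2 * of_real pi) = P z"
    and "P z" "k \<in> \<int>"
  shows "A (z + of_real (2 * k * pi)) = A z"
proof -
  have nat: "P w \<Longrightarrow> P (w + of_real (2 * real m * pi)) \<and> A (w + of_real (2 * real m * pi)) = A w" for w m
  proof (induction m)
    case (Suc m)
    have "w + of_real (2 * real (Suc m) * pi) = (w + of_real (2 * real m * pi)) + 2 * of_real pi"
      by (simp add: algebra_simps)
    then show ?case using Suc per P by metis
  qed simp
  have nat': "P (w - of_real (2 * real m * pi)) = P w" for w m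
  proof (induction m)
    case (Suc m)
    have "w - of_real (2 * real m * pi) = (w - of_real (2 * real (Suc m) * pi)) + 2 * of_real pi"
      by (simp add: algebra_simps)
    then show ?case using Suc P by metis
  qed simp
  from \<open>k \<in> \<int>\<close> obtain j :: int where j: "k = of_int j" by (auto elim: Ints_cases)
  show ?thesis
  proof (cases "j \<ge> 0")
    case True
    then show ?thesis using nat[OF \<open>P z\<close>, of "nat j"] j by simp
  next
    case False
    define w where "w = z - of_real (2 * real (nat (-j)) * pi)"
    have "P w" using nat' \<open>P z\<close> by (simp add: w_def)
    moreover have "w + of_real (2 * real (nat (-j)) * pi) = z" by (simp add: w_def)
    moreover have "w = z + of_real (2 * k * pi)" using False by (simp add: w_def j)
    ultimately show ?thesis using nat[of w "nat (-j)"] by metis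
  qed
qed

lemma cos_holomorphic: "cos holomorphic_on (S :: complex set)"
  by (intro holomorphic_intros)

text \<open>The factor is continuous because \<open>cos\<close> is an open map, and holomorphic away from the critical
  values \<open>\<plusminus>1\<close> because \<open>cos\<close> is locally invertible there; the critical values are removable.\<close>

lemma even_periodic_factors_through_cos:
  fixes A :: "complex \<Rightarrow> complex"
  assumes E: "open E" and holo: "A holomorphic_on {z. cos z \<in> E}"
    and even: "\<And>z. cos z \<in> E \<Longrightarrow> A (- z) = A z"
    and per: "\<And>z. cos z \<in> E \<Longrightarrow> A (z + 2 * of_real pi) = A z"
  shows "\<exists>u. u holomorphic_on E \<and> (\<forall>z. cos z \<in> E \<longrightarrow> u (cos z) = A z)"
proof -
  define D where "D = {z :: complex. cos z \<in> E}"
  have D: "open D"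
  proof -
    have "D = cos -` E" by (auto simp: D_def)
    thus ?thesis using open_vimage[OF E, of cos] by (simp add: continuous_intros)
  qed
  \<comment> \<open>\<open>Arccos\<close> only selects a preimage; by evenness and periodicity every
    preimage gives the same value, so the branch cuts of \<open>Arccos\<close> leave no
    trace.\<close>
  define u where "u y = A (Arccos y)" for y
  have cosper: "cos (z + 2 * of_real pi) = cos z" for z :: complex
  proof -
    have "cos (2 * of_real pi) = (1 :: complex)" "sin (2 * of_real pi) = (0 :: complex)"
      using cos_of_real[of "2 * pi", where 'a = complex] sin_of_real[of "2 * pi", where 'a = complex] by simp_all
    thus ?thesis by (simp add: cos_add)
  qed
  have key: "u (cos z) = A z" if z: "cos z \<in> E" for z
  proof -
    have "cos (Arccos (cos z)) = cos z" by simp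
    then obtain k where k: "k \<in> \<int>" "Arccos (cos z) = z + of_real (2*k*pi) \<or> Arccos (cos z) = -z + of_real (2*k*pi)"
      using complex_cos_eq by blast
    moreover have "A (z + of_real (2*k*pi)) = A z"
      using periodic_int_multiple[of "\<lambda>z. cos z \<in> E" A z k] per z k(1) by (simp add: cosper)
    moreover have "A (-z + of_real (2*k*pi)) = A (-z)"
      using periodic_int_multiple[of "\<lambda>z. cos z \<in> E" A "-z" k] per z k(1) by (simp add: cosper)
    ultimately show ?thesis using even[OF z] by (auto simp: u_def)
  qed
  have contA: "continuous_on D A" using holo holomorphic_on_imp_continuous_on D_def by blast
  have "continuous_on E u"
    unfolding continuous_on_open_vimage[OF E]
  proof (intro allI impI)
    fix U :: "complex set" assume U: "open U"
    have "open (A -` U \<inter> D)" using contA continuous_on_open_vimage[OF D] U by blast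
    moreover have "\<not> (cos :: complex \<Rightarrow> complex) constant_on UNIV"
    proof
      assume "(cos :: complex \<Rightarrow> complex) constant_on UNIV"
      then obtain y where "\<And>x :: complex. cos x = y" by (auto simp: constant_on_def)
      hence "(cos 0 :: complex) = cos (of_real pi)" by metis
      thus False by (simp add: cos_of_real)
    qed
    ultimately have "open (cos ` (A -` U \<inter> D))"
      by (intro open_mapping_thm[of cos UNIV]) (auto intro: holomorphic_intros)
    moreover have "cos ` (A -` U \<inter> D) = u -` U \<inter> E"
    proof (intro equalityI subsetI)
      fix y assume "y \<in> u -` U \<inter> E"
      hence "y = cos (Arccos y)" "Arccos y \<in> A -` U \<inter> D" by (auto simp: u_def D_def)
      thus "y \<in> cos ` (A -` U \<inter> D)" by blast
    qed (auto simp: D_def key)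
    ultimately show "open (u -` U \<inter> E)" by simp
  qed
  moreover have "u holomorphic_on (E - {1, -1})"
  proof -
    have "u field_differentiable at y" if y: "y \<in> E - {1, -1}" for y
    proof -
      define z where "z = Arccos y"
      have z: "cos z = y" "z \<in> D" using y by (auto simp: z_def D_def)
      have "sin z \<noteq> 0"
      proof
        assume "sin z = 0"
        hence "(cos z)\<^sup>2 = 1" using sin_cos_squared_add[of z] by simp
        thus False using y z by (auto simp: power2_eq_1_iff)
      qed
      hence "deriv cos z \<noteq> 0" using DERIV_imp_deriv[OF DERIV_cos[of z]] by simp
      then obtain r where r: "r > 0" "ball z r \<subseteq> D" "inj_on cos (ball z r)"
        using has_complex_derivative_locally_injective[OF cos_holomorphic z(2) D] by blast
      obtain g where g: "g holomorphic_on cos ` ball z r" "\<And>w. w \<in> ball z r \<Longrightarrow> g (cos w) = w"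
        using holomorphic_has_inverse[OF cos_holomorphic open_ball r(3)] by metis
      have op: "open (cos ` ball z r)"
        using open_mapping_thm3[OF cos_holomorphic open_ball r(3)] .
      have "(A \<circ> g) holomorphic_on (cos ` ball z r)"
        using g r holo by (intro holomorphic_on_compose_gen[of g _ A D]) (auto simp: D_def)
      moreover have "(A \<circ> g) w = u w" if "w \<in> cos ` ball z r" for w
        using that g r key by (auto simp: D_def)
      ultimately have "u holomorphic_on (cos ` ball z r)" by (metis holomorphic_transform)
      moreover have "y \<in> cos ` ball z r" using z r by force
      ultimately show ?thesis using op by (metis holomorphic_on_imp_differentiable_at)
    qed
    thus ?thesis by (simp add: holomorphic_on_def field_differentiable_at_within)
  qed
  ultimately have "u holomorphic_on E" using E no_isolated_singularity[of E u "{1, -1}"] by simp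
  thus ?thesis using key by blast
qed

text \<open>The zero is demanded only if \<open>a\<close> lies in \<open>S\<close>; elsewhere
  division is harmless. The ellipse may or may not contain the point -1 at which this is
  applied.\<close>

lemma holomorphic_factor_root:
  assumes f: "f holomorphic_on S" "open S" and a: "a \<in> S \<Longrightarrow> f a = 0"
  shows "\<exists>g. g holomorphic_on S \<and> (\<forall>z\<in>S. f z = (z - a) * g z)"
proof (cases "a \<in> S")
  case True
  then show ?thesis using pole_lemma_open[OF f, of a] a
    by (intro exI[of _ "\<lambda>z. if z = a then deriv f a else (f z - f a) / (z - a)"]) auto
next
  case False
  hence "(\<lambda>z. f z / (z - a)) holomorphic_on S" by (intro holomorphic_intros f) auto
  then show ?thesis using False by (intro exI[of _ "\<lambda>z. f z / (z - a)"]) auto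
qed

section \<open>Chebyshev polynomials and the Cauchy formula on confocal ellipses\<close>

fun cheb :: "nat \<Rightarrow> real poly" where
  "cheb 0 = 1"
| "cheb (Suc 0) = [:0, 1:]"
| "cheb (Suc (Suc n)) = [:0, 2:] * cheb (Suc n) - cheb n"

lemma poly_cheb_cos: "poly (cheb n) (cos s) = cos (real n * s)"
proof (induction n rule: cheb.induct)
  case (3 n)
  have "cos (real (Suc (Suc n)) * s) = cos (real (Suc n) * s + s)" by (simp add: algebra_simps)
  moreover have "cos (real n * s) = cos (real (Suc n) * s - s)" by (simp add: algebra_simps)
  ultimately show ?case using 3 by (simp add: cos_add cos_diff)
qed auto

lemma cheb_degree: "degree (cheb n) = n \<and> cheb n \<noteq> 0"
proof (induction n rule: cheb.induct)
  case (3 n)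
  have "degree ([:0, 2:] * cheb (Suc n)) = Suc (Suc n)"
    using 3 by (subst degree_mult_eq) auto
  hence "degree (cheb (Suc (Suc n))) = Suc (Suc n)"
    using 3 degree_add_eq_left[of "- cheb n" "[:0, 2:] * cheb (Suc n)"] by simp
  thus ?case by auto
qed auto

text \<open>The Joukowski map. The circle of radius \<open>r > 1\<close> goes to the ellipse with
  foci -1 and 1 and semiaxes \<open>(r + 1 / r) / 2\<close> and \<open>(r - 1 / r) / 2\<close>; the
  unit circle collapses to [-1,1].\<close>

definition jouk :: "complex \<Rightarrow> complex" where "jouk \<zeta> = (\<zeta> + 1 / \<zeta>) / 2"

abbreviation circ :: "real \<Rightarrow> real \<Rightarrow> complex" where "circ r t \<equiv> of_real r * exp (2 * of_real pi * \<i> * of_real t)"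

lemma norm_circ: "r > 0 \<Longrightarrow> norm (circ r t) = r"
  by (simp add: norm_mult)

lemma circ_deriv: "(circ r has_vector_derivative (2 * of_real pi * \<i> * circ r t)) (at t)"
  by (rule has_vector_derivative_eq_rhs, rule has_vector_derivative_real_field, auto intro!: derivative_eq_intros)

lemma has_integral_cancel_mult:
  fixes f :: "real \<Rightarrow> complex"
  assumes "c \<noteq> 0" "((\<lambda>t. c * f t) has_integral c * v) S"
  shows "(f has_integral v) S"
  using has_integral_mult_right[OF assms(2), of "inverse c"] assms(1) by (simp flip: mult.assoc)

lemma has_integral_circle_kernel:
  assumes "r > 0" "norm a < r"
  shows "((\<lambda>t. circ r t / (circ r t - a)) has_integral 1) {0..1}"
proof -
  have "((\<lambda>w. 1 / (w - a)) has_contour_integral (2 * of_real pi * \<i> * 1)) (circlepath 0 r)"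
    using Cauchy_integral_circlepath_simple[of "\<lambda>_. 1" 0 r a] assms by (simp add: dist_norm)
  hence "((\<lambda>t. 1 / (circlepath 0 r t - a) * vector_derivative (circlepath 0 r) (at t within {0..1})) has_integral 2 * of_real pi * \<i>) {0..1}"
    by (simp add: has_contour_integral_def)
  hence "((\<lambda>t. 2 * of_real pi * \<i> * (circ r t / (circ r t - a))) has_integral 2 * of_real pi * \<i>) {0..1}"
    by (rule has_integral_eq[rotated]) (simp add: vector_derivative_circlepath01, simp add: circlepath)
  thus ?thesis
    using has_integral_cancel_mult[of "2 * of_real pi * \<i>" "\<lambda>t. circ r t / (circ r t - a)" 1 "{0..1}"]
    by (simp only: mult_1_right) simp
qed

text \<open>The Cauchy kernel at the point \<open>Re a\<close>, pulled back by \<open>jouk\<close>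
  and split into partial fractions, for \<open>a\<close> on the unit circle. Its expansion in powers
  of \<open>1 / \<zeta>\<close> generates the Chebyshev polynomials.\<close>

definition ellipse_kernel :: "complex \<Rightarrow> complex \<Rightarrow> complex" where
  "ellipse_kernel a \<zeta> = \<zeta> / (\<zeta> - a) + \<zeta> / (\<zeta> - cnj a) - 1"

text \<open>Since \<open>a * cnj a = 1\<close>, the number
  \<open>2 * \<zeta> * (jouk \<zeta> - Re a)\<close> factors as
  \<open>(\<zeta> - a) * (\<zeta> - cnj a)\<close>.\<close>

lemma jouk_kernel:
  assumes a: "norm a = 1" and z: "norm \<zeta> > 1"
  shows "(\<zeta> - 1 / \<zeta>) / 2 / (jouk \<zeta> - of_real (Re a)) = ellipse_kernel a \<zeta>" "jouk \<zeta> \<noteq> of_real (Re a)"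
proof -
  have aa: "a * cnj a = 1" using a by (simp add: complex_norm_square[symmetric])
  have nz: "\<zeta> \<noteq> 0" "\<zeta> - a \<noteq> 0" "\<zeta> - cnj a \<noteq> 0" using a z by auto
  have s: "a + cnj a = 2 * of_real (Re a)" by (simp add: complex_add_cnj)
  have "2 * \<zeta> * (jouk \<zeta> - of_real (Re a)) = \<zeta> * \<zeta> + 1 - \<zeta> * (2 * of_real (Re a))"
    using nz by (simp add: jouk_def field_simps)
  also have "\<dots> = (\<zeta> - a) * (\<zeta> - cnj a)"
    unfolding s[symmetric] using aa by (simp add: algebra_simps)
  finally have 1: "2 * \<zeta> * (jouk \<zeta> - of_real (Re a)) = (\<zeta> - a) * (\<zeta> - cnj a)" .
  thus ne: "jouk \<zeta> \<noteq> of_real (Re a)" using nz by auto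
  have "ellipse_kernel a \<zeta> = (\<zeta> * (\<zeta> - cnj a) + \<zeta> * (\<zeta> - a) - (\<zeta> - a) * (\<zeta> - cnj a)) / ((\<zeta> - a) * (\<zeta> - cnj a))"
    using nz by (simp add: ellipse_kernel_def diff_divide_distrib add_divide_distrib)
  also have "\<zeta> * (\<zeta> - cnj a) + \<zeta> * (\<zeta> - a) - (\<zeta> - a) * (\<zeta> - cnj a) = \<zeta> * \<zeta> - 1"
    using aa by (simp add: algebra_simps)
  also have "(\<zeta> * \<zeta> - 1) / ((\<zeta> - a) * (\<zeta> - cnj a)) = (\<zeta> * \<zeta> - 1) / (2 * \<zeta> * (jouk \<zeta> - of_real (Re a)))"
    by (simp only: 1)
  also have "\<dots> = (\<zeta> - 1 / \<zeta>) / 2 / (jouk \<zeta> - of_real (Re a))"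
    using nz ne by (simp add: field_simps)
  finally show "(\<zeta> - 1 / \<zeta>) / 2 / (jouk \<zeta> - of_real (Re a)) = ellipse_kernel a \<zeta>" by simp
qed

text \<open>The winding number of the ellipse is found without geometry: the formula for the
  constant function 1 expresses it as the integral of the kernel, and that integral is evaluated on
  the circle as 1 + 1 - 1.\<close>

lemma Cauchy_formula_ellipse:
  assumes S: "open S" "convex S" and g: "g holomorphic_on S" and r: "r > 1"
    and ring: "\<And>t. jouk (circ r t) \<in> S" and a: "norm a = 1" "of_real (Re a) \<in> S"
  shows "((\<lambda>t. g (jouk (circ r t)) * ellipse_kernel a (circ r t)) has_integral g (of_real (Re a))) {0..1}"
proof -
  define \<gamma> where "\<gamma> = (\<lambda>t. jouk (circ r t))"
  define \<gamma>' where "\<gamma>' = (\<lambda>t. 2 * of_real pi * \<i> * ((circ r t - 1 / circ r t) / 2))"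
  have nz: "circ r t \<noteq> 0" for t using r by simp
  have nm: "norm (circ r t) > 1" for t using r norm_circ[of r t] by linarith
  have d: "(\<gamma> has_vector_derivative \<gamma>' t) (at t)" for t
  proof -
    have "(jouk has_field_derivative (1 - 1 / (circ r t * circ r t)) / 2) (at (circ r t))"
      unfolding jouk_def[abs_def] using nz[of t] by (auto intro!: derivative_eq_intros)
    from field_vector_diff_chain_at[OF circ_deriv[of r t] this]
    have "(jouk \<circ> circ r has_vector_derivative 2 * of_real pi * \<i> * circ r t * ((1 - 1 / (circ r t * circ r t)) / 2)) (at t)" .
    moreover have "2 * of_real pi * \<i> * circ r t * ((1 - 1 / (circ r t * circ r t)) / 2) = \<gamma>' t"
      unfolding \<gamma>'_def using nz[of t] by (simp add: field_simps)
    ultimately show ?thesis by (simp add: \<gamma>_def comp_def)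
  qed
  have "continuous_on {0..1} \<gamma>'" unfolding \<gamma>'_def using nz by (intro continuous_intros) auto
  hence vp: "valid_path \<gamma>"
    unfolding valid_path_def using d by (intro C1_differentiable_imp_piecewise) (auto simp: C1_differentiable_on_def)
  have pi: "path_image \<gamma> \<subseteq> S - {of_real (Re a)}"
    using ring jouk_kernel(2)[OF a(1) nm] by (auto simp: path_image_def \<gamma>_def)
  have loop: "pathfinish \<gamma> = pathstart \<gamma>"
    using exp_two_pi_i by (simp add: pathfinish_def pathstart_def \<gamma>_def mult.commute mult.left_commute)
  have vd: "vector_derivative \<gamma> (at t) = \<gamma>' t" for t using d by (rule vector_derivative_at)
  have main: "((\<lambda>t. k (\<gamma> t) * ellipse_kernel a (circ r t)) has_integral winding_number \<gamma> (of_real (Re a)) * k (of_real (Re a))) {0..1}"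
    if k: "k holomorphic_on S" for k
  proof -
    have "((\<lambda>w. k w / (w - of_real (Re a))) has_contour_integral (2 * pi * \<i> * winding_number \<gamma> (of_real (Re a)) * k (of_real (Re a)))) \<gamma>"
      using Cauchy_integral_formula_convex_simple[OF S(2) k _ vp pi loop] a S interior_open by auto
    hence "((\<lambda>t. k (\<gamma> t) / (\<gamma> t - of_real (Re a)) * \<gamma>' t) has_integral (2 * pi * \<i> * winding_number \<gamma> (of_real (Re a)) * k (of_real (Re a)))) {0..1}"
      by (simp add: has_contour_integral vd)
    moreover have "k (\<gamma> t) / (\<gamma> t - of_real (Re a)) * \<gamma>' t = 2 * of_real pi * \<i> * (k (\<gamma> t) * ellipse_kernel a (circ r t))" for t
    proof -
      have "x / y * (c * z) = c * (x * (z / y))" for x y z c :: complex by simp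
      thus ?thesis unfolding jouk_kernel(1)[OF a(1) nm[of t], symmetric] \<gamma>'_def \<gamma>_def by blast
    qed
    ultimately have "((\<lambda>t. 2 * of_real pi * \<i> * (k (\<gamma> t) * ellipse_kernel a (circ r t))) has_integral (2 * pi * \<i> * winding_number \<gamma> (of_real (Re a)) * k (of_real (Re a)))) {0..1}"
      by (simp only:)
    hence cI: "((\<lambda>t. (2 * of_real pi * \<i>) * (k (\<gamma> t) * ellipse_kernel a (circ r t))) has_integral
        (2 * of_real pi * \<i>) * (winding_number \<gamma> (of_real (Re a)) * k (of_real (Re a)))) {0..1}"
      by (simp only: mult.assoc of_real_mult of_real_numeral)
    show ?thesis by (rule has_integral_cancel_mult[OF _ cI]) simp
  qed
  have one: "((\<lambda>_ :: real. 1 :: complex) has_integral 1) {0..1}"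
    using has_integral_const_real[of "1::complex" 0 1] by simp
  have ca: "norm (cnj a) < r" "norm a < r" "0 < r" using a r by simp_all
  have "((\<lambda>t. ellipse_kernel a (circ r t)) has_integral (1 + 1 - 1)) {0..1}"
    unfolding ellipse_kernel_def
    by (intro has_integral_add has_integral_diff has_integral_circle_kernel one ca)
  moreover have "((\<lambda>t. ellipse_kernel a (circ r t)) has_integral winding_number \<gamma> (of_real (Re a))) {0..1}"
    using main[OF holomorphic_on_const[of 1]] by (simp only: mult_1 mult_1_right)
  ultimately have "winding_number \<gamma> (of_real (Re a)) = 1 + 1 - 1" by (rule has_integral_unique[rotated])
  thus ?thesis using main[OF g] by (simp add: \<gamma>_def)
qed

text \<open>The remainders of two geometric series whose ratios \<open>a / \<zeta>\<close> and
  \<open>cnj a / \<zeta>\<close> have modulus \<open>1 / r\<close>.\<close>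

lemma ellipse_kernel_truncation:
  assumes a: "norm a = 1" and z: "norm \<zeta> = r" "r > 1"
  shows "norm (ellipse_kernel a \<zeta> - ((\<Sum>k\<le>m. (a / \<zeta>) ^ k + (cnj a / \<zeta>) ^ k) - 1)) \<le> 2 / (r ^ m * (r - 1))"
proof -
  have *: "norm (\<zeta> / (\<zeta> - c) - (\<Sum>k\<le>m. (c / \<zeta>) ^ k)) \<le> 1 / (r ^ m * (r - 1))" if c: "norm c = 1" for c
  proof -
    have nz: "\<zeta> \<noteq> 0" "\<zeta> - c \<noteq> 0" using c z by auto
    define q where "q = c / \<zeta>"
    have q: "1 - q = (\<zeta> - c) / \<zeta>" "1 - q \<noteq> 0" using nz by (auto simp: q_def field_simps)
    have "(\<Sum>k\<le>m. q ^ k) = (1 - q ^ Suc m) / (1 - q)"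
      using sum_gp_basic[of q m] q(2) by (simp only: nonzero_eq_divide_eq mult.commute not_False_eq_True)
    hence "\<zeta> / (\<zeta> - c) - (\<Sum>k\<le>m. q ^ k) = 1 / (1 - q) - (1 - q ^ Suc m) / (1 - q)"
      unfolding q(1) by simp
    also have "\<dots> = q ^ Suc m / (1 - q)" by (simp add: diff_divide_distrib)
    also have "\<dots> = q ^ Suc m * \<zeta> / (\<zeta> - c)" by (simp add: q(1))
    finally have "norm (\<zeta> / (\<zeta> - c) - (\<Sum>k\<le>m. q ^ k)) = norm q ^ Suc m * norm \<zeta> / norm (\<zeta> - c)"
      by (simp only: norm_divide norm_mult norm_power)
    also have "norm q ^ Suc m * norm \<zeta> = 1 / r ^ m"
      using c z by (simp add: q_def norm_divide power_divide)
    also have "1 / r ^ m / norm (\<zeta> - c) \<le> 1 / r ^ m / (r - 1)"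
      using norm_triangle_ineq2[of \<zeta> c] c z by (intro divide_left_mono mult_pos_pos) auto
    finally show ?thesis using z by (simp add: q_def)
  qed
  have "ellipse_kernel a \<zeta> - ((\<Sum>k\<le>m. (a / \<zeta>) ^ k + (cnj a / \<zeta>) ^ k) - 1) =
     (\<zeta> / (\<zeta> - a) - (\<Sum>k\<le>m. (a / \<zeta>) ^ k)) + (\<zeta> / (\<zeta> - cnj a) - (\<Sum>k\<le>m. (cnj a / \<zeta>) ^ k))"
    by (simp add: ellipse_kernel_def sum.distrib)
  also have "norm \<dots> \<le> 1 / (r ^ m * (r - 1)) + 1 / (r ^ m * (r - 1))"
    by (intro norm_triangle_le add_mono *) (use a in auto)
  finally show ?thesis by (simp add: mult.commute)
qed

lemma exists_radius:
  assumes "\<rho> > (1::real)"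
  shows "\<exists>r. (1 + \<rho>) / 2 \<le> r \<and> r < \<rho> \<and> \<rho> ^ m \<le> 2 * r ^ m"
proof -
  \<comment> \<open>With \<open>r = \<rho> * (1 - \<delta>)\<close>, the first bound gives
    \<open>(1 - \<delta>) ^ m \<ge> 1/2\<close> by Bernoulli, and the second keeps \<open>r\<close>
    above \<open>(1 + \<rho>) / 2\<close>.\<close>
  define \<delta> where "\<delta> = min (1 / (2 * real m + 2)) ((\<rho> - 1) / (2 * \<rho>))"
  have d: "\<delta> > 0" "\<delta> \<le> 1 / (2 * real m + 2)" "\<delta> \<le> (\<rho> - 1) / (2 * \<rho>)" using assms by (auto simp: \<delta>_def)
  have "1 / (2 * real m + 2) \<le> 1" by simp
  hence d1: "\<delta> \<le> 1" using d(2) by linarith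
  have "real m * \<delta> \<le> real m * (1 / (2 * real m + 2))" using d(2) by (intro mult_left_mono) auto
  also have "\<dots> \<le> 1 / 2" by (simp add: divide_simps)
  finally have "1 / 2 \<le> 1 + real m * (- \<delta>)" by simp
  also have "\<dots> \<le> (1 + (- \<delta>)) ^ m" using d1 by (intro Bernoulli_inequality) auto
  finally have half: "1 \<le> 2 * (1 - \<delta>) ^ m" by simp
  have "\<rho> ^ m * 1 \<le> \<rho> ^ m * (2 * (1 - \<delta>) ^ m)" using half assms by (intro mult_left_mono) auto
  hence "\<rho> ^ m \<le> 2 * (\<rho> * (1 - \<delta>)) ^ m" by (simp add: power_mult_distrib)
  moreover have "(1 + \<rho>) / 2 \<le> \<rho> * (1 - \<delta>)"
  proof -
    have "\<rho> * \<delta> \<le> (\<rho> - 1) / 2" using mult_left_mono[OF d(3), of \<rho>] assms by simp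
    thus ?thesis by (simp only: right_diff_distrib mult_1_right) argo
  qed
  moreover have "\<rho> * (1 - \<delta>) < \<rho>" using d assms by simp
  ultimately show ?thesis by blast
qed

text \<open>Truncating the geometric series of the kernel in the Cauchy formula gives the approximating
  polynomials. The radius depends on \<open>m\<close>: it is so close to \<open>\<rho>\<close> that \<open>r\<^sup>m\<close> and
  \<open>\<rho>\<^sup>m\<close> are comparable.\<close>

lemma cheb_approximation:
  assumes S: "open S" "convex S" and g: "g holomorphic_on S" and \<rho>: "\<rho> > 1"
    and ring: "\<And>\<zeta>. 1 \<le> norm \<zeta> \<Longrightarrow> norm \<zeta> < \<rho> \<Longrightarrow> jouk \<zeta> \<in> S"
    and B: "B integrable_on {0..1::real}"
    and bd: "\<And>r t. (1 + \<rho>) / 2 \<le> r \<Longrightarrow> r < \<rho> \<Longrightarrow> t \<in> {0..1} - {0, 1/2, 1} \<Longrightarrow> norm (g (jouk (circ r t))) \<le> B t"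
  shows "\<exists>C. \<forall>m. \<exists>p. degree p \<le> m \<and> (\<forall>s. \<bar>Re (g (of_real (cos s))) - poly p (cos s)\<bar> \<le> C / \<rho> ^ m)"
proof -
  define I where "I = \<bar>integral {0..1} B\<bar>"
  have "\<exists>p. degree p \<le> m \<and> (\<forall>s. \<bar>Re (g (of_real (cos s))) - poly p (cos s)\<bar> \<le> (8 * I / (\<rho> - 1)) / \<rho> ^ m)" for m
  proof -
    obtain r where r: "(1 + \<rho>) / 2 \<le> r" "r < \<rho>" "\<rho> ^ m \<le> 2 * r ^ m" using exists_radius[OF \<rho>] by blast
    have r1: "r > 1" using r \<rho> by simp
    define G where "G t = g (jouk (circ r t))" for t
    define c where "c k = integral {0..1} (\<lambda>t. G t / circ r t ^ k)" for k
    \<comment> \<open>For \<open>a = cis s\<close>, the sum \<open>a ^ k + cnj a ^ k\<close> is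
      \<open>2 * cos (k * s)\<close>, so the truncated kernel integrates to this Chebyshev sum. The
      subtracted constant stems from the -1 in the kernel and halves the term
      \<open>k = 0\<close>.\<close>
    define p where "p = (\<Sum>k\<le>m. smult (2 * Re (c k)) (cheb k)) - [:Re (c 0):]"
    have nm: "norm (circ r t) = r" for t using norm_circ[of r t] r1 by simp
    have nz: "circ r t \<noteq> 0" for t using r1 by simp
    have inS: "jouk (circ r t) \<in> S" for t using ring[of "circ r t"] nm[of t] r r1 by simp
    have "continuous_on {0..1} (\<lambda>t. jouk (circ r t))" unfolding jouk_def using nz by (intro continuous_intros) auto
    hence contG: "continuous_on {0..1} G" unfolding G_def using inS
      by (intro continuous_on_compose2[OF holomorphic_on_imp_continuous_on[OF g]]) auto
    have ic: "((\<lambda>t. G t / circ r t ^ k) has_integral c k) {0..1}" for k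
      unfolding c_def using nz by (intro integrable_integral integrable_continuous_real continuous_intros contG) auto
    have "\<bar>Re (g (of_real (cos s))) - poly p (cos s)\<bar> \<le> (8 * I / (\<rho> - 1)) / \<rho> ^ m" for s
    proof -
      define a where "a = cis s"
      have a: "norm a = 1" "Re a = cos s" by (simp_all add: a_def)
      have jc: "jouk a = of_real (cos s)"
        by (simp add: a_def jouk_def complex_eq_iff flip: inverse_eq_divide)
      have F: "((\<lambda>t. G t * ellipse_kernel a (circ r t)) has_integral g (of_real (cos s))) {0..1}"
        using Cauchy_formula_ellipse[OF S g r1 inS a(1)] ring[of a] a jc \<rho> by (simp add: G_def)
      have T: "((\<lambda>t. G t * ((\<Sum>k\<le>m. (a / circ r t) ^ k + (cnj a / circ r t) ^ k) - 1)) has_integral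
         ((\<Sum>k\<le>m. 2 * of_real (cos (real k * s)) * c k) - c 0)) {0..1}"
      proof -
        have "((\<lambda>t. (\<Sum>k\<le>m. 2 * of_real (cos (real k * s)) * (G t / circ r t ^ k)) - G t / circ r t ^ 0) has_integral
          ((\<Sum>k\<le>m. 2 * of_real (cos (real k * s)) * c k) - c 0)) {0..1}"
          by (intro has_integral_diff has_integral_sum has_integral_mult_right ic) auto
        moreover have "(\<Sum>k\<le>m. 2 * of_real (cos (real k * s)) * (G t / circ r t ^ k)) - G t / circ r t ^ 0 =
            G t * ((\<Sum>k\<le>m. (a / circ r t) ^ k + (cnj a / circ r t) ^ k) - 1)" for t
        proof -
          have "a ^ k + cnj a ^ k = 2 * of_real (cos (real k * s))" for k
            by (simp add: a_def cis_cnj Complex.DeMoivre complex_eq_iff)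
          hence "(a / circ r t) ^ k + (cnj a / circ r t) ^ k = 2 * of_real (cos (real k * s)) / circ r t ^ k" for k
            by (simp only: power_divide add_divide_distrib[symmetric])
          thus ?thesis by (simp add: right_diff_distrib sum_distrib_left mult.commute)
        qed
        ultimately show ?thesis by (simp only:)
      qed
      define V where "V t = G t * ellipse_kernel a (circ r t) - G t * ((\<Sum>k\<le>m. (a / circ r t) ^ k + (cnj a / circ r t) ^ k) - 1)" for t
      have V: "(V has_integral (g (of_real (cos s)) - ((\<Sum>k\<le>m. 2 * of_real (cos (real k * s)) * c k) - c 0))) {0..1}"
        unfolding V_def by (rule has_integral_diff[OF F T])
      \<comment> \<open>The majorant says nothing at the three exceptional points. There it is
        replaced by the integrand itself, which does not change the integral.\<close>
      define U where "U t = (if t \<in> {0, 1/2, 1} then norm (V t) else B t * (2 / (r ^ m * (r - 1))))" for t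
      have U: "(U has_integral (integral {0..1} B * (2 / (r ^ m * (r - 1))))) {0..1}"
        by (rule has_integral_spike_finite[of "{0, 1/2, 1}" _ _ "\<lambda>t. B t * (2 / (r ^ m * (r - 1)))"])
           (auto simp: U_def simp del: times_divide_eq_right intro!: has_integral_mult_left integrable_integral B)
      have "norm (V t) \<le> U t" if t: "t \<in> {0..1}" for t
      proof (cases "t \<in> {0, 1/2, 1}")
        case False
        have "norm (V t) = norm (G t) * norm (ellipse_kernel a (circ r t) - ((\<Sum>k\<le>m. (a / circ r t) ^ k + (cnj a / circ r t) ^ k) - 1))"
          unfolding V_def by (simp only: right_diff_distrib[symmetric] norm_mult)
        also have "\<dots> \<le> B t * (2 / (r ^ m * (r - 1)))"
          using bd[OF r(1,2), of t] False t r1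
          by (intro mult_mono ellipse_kernel_truncation[OF a(1) nm]) (auto simp: G_def intro: order_trans[OF norm_ge_zero])
        finally show ?thesis using False by (simp add: U_def)
      qed (simp add: U_def)
      hence "norm (integral {0..1} V) \<le> integral {0..1} U"
        using V U by (intro integral_norm_bound_integral) (auto simp: integrable_on_def)
      hence le: "norm (g (of_real (cos s)) - ((\<Sum>k\<le>m. 2 * of_real (cos (real k * s)) * c k) - c 0)) \<le> integral {0..1} B * (2 / (r ^ m * (r - 1)))"
        using V U by (simp only: integral_unique)
      have "Re (g (of_real (cos s)) - ((\<Sum>k\<le>m. 2 * of_real (cos (real k * s)) * c k) - c 0)) = Re (g (of_real (cos s))) - poly p (cos s)"
        by (simp add: p_def poly_sum poly_cheb_cos mult_ac)
      hence "\<bar>Re (g (of_real (cos s))) - poly p (cos s)\<bar> \<le> integral {0..1} B * (2 / (r ^ m * (r - 1)))"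
        using order_trans[OF abs_Re_le_cmod le] by simp
      also have "\<dots> \<le> I * (8 / (\<rho> ^ m * (\<rho> - 1)))"
      proof (intro mult_mono)
        \<comment> \<open>Both factors of the denominator lose at most 2 when \<open>\<rho>\<close>
          replaces \<open>r\<close>, which turns 2 into 8.\<close>
        have "\<rho> ^ m * (\<rho> - 1) \<le> (2 * r ^ m) * (2 * (r - 1))" using r \<rho> by (intro mult_mono) auto
        thus "2 / (r ^ m * (r - 1)) \<le> 8 / (\<rho> ^ m * (\<rho> - 1))" using r1 \<rho> by (simp add: divide_simps) (simp add: algebra_simps)
      qed (use r1 in \<open>auto simp: I_def\<close>)
      finally show ?thesis by (simp add: mult_ac)
    qed
    moreover have "degree p \<le> m"
      unfolding p_def using cheb_degree
      by (intro degree_diff_le degree_sum_le) (auto intro: order_trans[OF degree_smult_le])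
    ultimately show ?thesis by blast
  qed
  thus ?thesis by blast
qed

section \<open>The elliptic region and its confocal contours\<close>

definition ell :: "real \<Rightarrow> complex \<Rightarrow> complex" where
  "ell h \<zeta> = of_real ((1 + h) / 2) + of_real ((1 - h) / 2) * \<zeta>"

text \<open>The sum of the semiaxes and the difference of their squares determine their difference,
  \<open>(1 - h) / (2 * \<rho>)\<close>, so the quantified pair is unique and explicit.\<close>

lemma ellipse_region_eq:
  assumes h: "h < 1" and \<rho>: "\<rho> > 1"
  defines "A \<equiv> (1 - h) / 2 * ((\<rho> + 1 / \<rho>) / 2)" and "B \<equiv> (1 - h) / 2 * ((\<rho> - 1 / \<rho>) / 2)"
  shows "ellipse_region h \<rho> = {z. ((Re z - (1 + h) / 2) / A)\<^sup>2 + (Im z / B)\<^sup>2 < 1}" "0 < A" "0 < B"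
proof -
  define d where "d = (1 - h) / 2"
  have d: "d > 0" using h by (simp add: d_def)
  have AB: "A + B = \<rho> * d" "A - B = d / \<rho>" using \<rho> by (simp_all add: A_def B_def d_def field_simps)
  have "1 / \<rho> < \<rho>" using \<rho> by (simp add: divide_less_eq less_1_mult)
  thus B0: "0 < B" using d by (simp add: B_def d_def)
  have "d / \<rho> > 0" using d \<rho> by simp
  hence BA: "B < A" using AB(2) by linarith
  thus "0 < A" using B0 by simp
  have sq: "A\<^sup>2 - B\<^sup>2 = d\<^sup>2"
  proof -
    have "A\<^sup>2 - B\<^sup>2 = (A + B) * (A - B)" by (simp add: power2_eq_square algebra_simps)
    thus ?thesis using AB \<rho> by (simp add: power2_eq_square)
  qed
  have uniq: "A' = A \<and> B' = B" if "A'\<^sup>2 - B'\<^sup>2 = d\<^sup>2" "A' + B' = \<rho> * d" for A' B'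
  proof -
    have "(A' + B') * (A' - B') = (A + B) * (A - B)"
      using that(1) sq by (simp add: power2_eq_square algebra_simps)
    hence "(\<rho> * d) * (A' - B') = (\<rho> * d) * (A - B)" unfolding that(2) AB(1) .
    hence "A' - B' = A - B" using d \<rho> by (metis mult_left_cancel mult_pos_pos less_irrefl less_trans zero_less_one)
    thus ?thesis using that(2) AB by simp
  qed
  show "ellipse_region h \<rho> = {z. ((Re z - (1 + h) / 2) / A)\<^sup>2 + (Im z / B)\<^sup>2 < 1}"
  proof (intro equalityI subsetI)
    fix z assume "z \<in> ellipse_region h \<rho>"
    then obtain A' B' where *: "A'\<^sup>2 - B'\<^sup>2 = d\<^sup>2" "A' + B' = \<rho> * d" "((Re z - (1 + h) / 2) / A')\<^sup>2 + (Im z / B')\<^sup>2 < 1"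
      unfolding ellipse_region_def d_def by auto
    thus "z \<in> {z. ((Re z - (1 + h) / 2) / A)\<^sup>2 + (Im z / B)\<^sup>2 < 1}" using uniq[OF *(1,2)] by simp
  next
    fix z assume "z \<in> {z. ((Re z - (1 + h) / 2) / A)\<^sup>2 + (Im z / B)\<^sup>2 < 1}"
    thus "z \<in> ellipse_region h \<rho>"
      unfolding ellipse_region_def mem_Collect_eq using B0 BA sq AB(1)
      by (intro exI[of _ A] exI[of _ B]) (simp add: d_def)
  qed
qed

text \<open>The region is the preimage of a disc under a real-linear scaling. Convexity is what the
  Cauchy formula asks for.\<close>

lemma ellipse_region_open_convex:
  assumes h: "h < 1" and \<rho>: "\<rho> > 1"
  shows "open (ellipse_region h \<rho>)" "convex (ellipse_region h \<rho>)"
proof -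
  define A B where "A = (1 - h) / 2 * ((\<rho> + 1 / \<rho>) / 2)" and "B = (1 - h) / 2 * ((\<rho> - 1 / \<rho>) / 2)"
  define f where "f z = Complex (inverse A * Re z) (inverse B * Im z)" for z
  have lin: "linear f" by (rule linearI) (auto simp: f_def complex_eq_iff algebra_simps)
  have eq: "ellipse_region h \<rho> = f -` ball (f (of_real ((1 + h) / 2))) 1"
  proof -
    have "norm (f z - f (of_real ((1 + h) / 2))) < 1 \<longleftrightarrow> ((Re z - (1 + h) / 2) / A)\<^sup>2 + (Im z / B)\<^sup>2 < 1" for z
    proof -
      have "f z - f (of_real ((1 + h) / 2)) = Complex ((Re z - (1 + h) / 2) / A) (Im z / B)"
      proof -
        have "(x - c) / A = inverse A * x - inverse A * c" for x c
          by (simp only: divide_inverse right_diff_distrib mult.commute[of _ "inverse A"])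
        moreover have "x / B = inverse B * x - inverse B * 0" for x
          by (simp add: divide_inverse mult.commute)
        ultimately show ?thesis
          by (intro complex_eqI) (simp_all only: f_def minus_complex.simps complex.sel Re_complex_of_real Im_complex_of_real)
      qed
      thus ?thesis by (simp add: cmod_def)
    qed
    thus ?thesis unfolding ellipse_region_eq(1)[OF h \<rho>, folded A_def B_def]
      unfolding vimage_def mem_ball dist_norm norm_minus_commute[of "f (of_real ((1 + h) / 2))"] by (simp only:)
  qed
  show "convex (ellipse_region h \<rho>)" unfolding eq by (intro convex_linear_vimage lin convex_ball)
  have "continuous_on UNIV f" using lin linear_continuous_on linear_conv_bounded_linear by blast
  thus "open (ellipse_region h \<rho>)" unfolding eq by (intro open_vimage) auto
qed

lemma polar_circ: "r > 0 \<Longrightarrow> Re (jouk (circ r t)) = (r + 1 / r) / 2 * cos (2 * pi * t)"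
  "r > 0 \<Longrightarrow> Im (jouk (circ r t)) = (r - 1 / r) / 2 * sin (2 * pi * t)"
proof -
  assume r: "r > 0"
  have e: "exp (2 * of_real pi * \<i> * of_real t) = cis (2 * pi * t)"
    by (simp add: cis_conv_exp mult_ac)
  have "1 / circ r t = of_real (1 / r) * cis (- (2 * pi * t))"
    unfolding e by (simp add: divide_inverse)
  thus "Re (jouk (circ r t)) = (r + 1 / r) / 2 * cos (2 * pi * t)"
    "Im (jouk (circ r t)) = (r - 1 / r) / 2 * sin (2 * pi * t)"
    unfolding jouk_def e by (simp_all add: algebra_simps)
qed

text \<open>Both semiaxes grow with the radius. \<open>X\<close> and \<open>Y\<close> are their
  ratios for \<open>r\<close> against \<open>\<rho>\<close>, and the left side of the ellipse
  inequality is at most the larger of their squares.\<close>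

lemma ell_jouk_in_region:
  assumes h: "h < 1" and \<rho>: "\<rho> > 1" and z: "1 \<le> norm \<zeta>" "norm \<zeta> < \<rho>"
  shows "ell h (jouk \<zeta>) \<in> ellipse_region h \<rho>"
proof -
  define r where "r = norm \<zeta>"
  define t where "t = Arg \<zeta> / (2 * pi)"
  have r: "1 \<le> r" "r < \<rho>" using z by (auto simp: r_def)
  have "\<zeta> = of_real r * cis (Arg \<zeta>)" using z rcis_cmod_Arg[of \<zeta>] by (simp add: r_def rcis_def)
  hence zc: "\<zeta> = circ r t" by (simp add: t_def cis_conv_exp mult_ac)
  have d: "(1 - h) / 2 > 0" using h by simp
  define X where "X = (r + 1 / r) / (\<rho> + 1 / \<rho>)"
  define Y where "Y = (r - 1 / r) / (\<rho> - 1 / \<rho>)"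
  have inv: "1 / \<rho> < 1 / r" using r by (intro divide_strict_left_mono) auto
  have "1 * 1 \<le> r * r" using r by (intro mult_mono) auto
  hence "1 / r \<le> r" using r by (simp add: divide_le_eq)
  moreover have "r + 1 / r < \<rho> + 1 / \<rho>"
  proof -
    have "1 * 1 < r * \<rho>" using r \<rho> by (metis mult_le_less_imp_less mult_1 zero_le_one zero_less_one)
    hence "1 / (r * \<rho>) < 1" using r \<rho> by simp
    hence "0 < (\<rho> - r) * (1 - 1 / (r * \<rho>))" using r by simp
    also have "\<dots> = \<rho> + 1 / \<rho> - (r + 1 / r)" using r \<rho> by (simp add: field_simps)
    finally show ?thesis by simp
  qed
  moreover have "0 < r + 1 / r" using r by (intro add_pos_pos) auto
  moreover have "r - 1 / r < \<rho> - 1 / \<rho>" using inv r by linarith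
  ultimately have XY: "0 \<le> X" "X < 1" "0 \<le> Y" "Y < 1"
    unfolding X_def Y_def by (simp_all add: divide_less_eq_1_pos[THEN iffD2] divide_nonneg_pos)
  define M where "M = max (X\<^sup>2) (Y\<^sup>2)"
  have M: "M < 1" using XY by (auto simp: M_def power_less_one_iff abs_square_less_1)
  have "((Re (ell h (jouk \<zeta>)) - (1 + h) / 2) / ((1 - h) / 2 * ((\<rho> + 1 / \<rho>) / 2))) = X * cos (2 * pi * t)"
    using d h unfolding ell_def zc X_def by (simp add: polar_circ r less_le_trans[OF zero_less_one])
  moreover have "Im (ell h (jouk \<zeta>)) / ((1 - h) / 2 * ((\<rho> - 1 / \<rho>) / 2)) = Y * sin (2 * pi * t)"
    using d h unfolding ell_def zc Y_def by (simp add: polar_circ r less_le_trans[OF zero_less_one])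
  moreover have "(X * cos (2 * pi * t))\<^sup>2 + (Y * sin (2 * pi * t))\<^sup>2 \<le> M * (cos (2 * pi * t))\<^sup>2 + M * (sin (2 * pi * t))\<^sup>2"
    unfolding power_mult_distrib M_def by (intro add_mono mult_right_mono) auto
  moreover have "M * (cos (2 * pi * t))\<^sup>2 + M * (sin (2 * pi * t))\<^sup>2 = M"
    by (simp flip: distrib_left)
  ultimately show ?thesis using M unfolding ellipse_region_eq(1)[OF h \<rho>] by simp
qed

text \<open>The odd factor \<open>v\<close> need not be bounded when \<open>-1\<close> lies on the boundary of the ellipse;
  \<open>sing_wt\<close> is an integrable majorant along the contours. It is only meaningful for
  \<open>t \<notin> {0, 1/2, 1}\<close>, since \<open>1 / 0 = 0\<close>.\<close>

definition sing_wt :: "real \<Rightarrow> real" where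
  "sing_wt t = 1 + (1 / sqrt \<bar>t\<bar> + 1 / sqrt \<bar>t - 1/2\<bar> + 1 / sqrt \<bar>t - 1\<bar>)"

text \<open>On either side of \<open>z\<close> there is a primitive, a multiple of the square root
  of the distance, that extends continuously to the singularity.\<close>

lemma inverse_sqrt_integrable:
  fixes z :: real assumes z: "z \<in> {0..1}"
  shows "(\<lambda>t. 1 / sqrt \<bar>t - z\<bar>) integrable_on {0..1}"
proof -
  have D1: "((\<lambda>t. - 2 * sqrt (z - t)) has_real_derivative 1 / sqrt \<bar>t - z\<bar>) (at t)" if "t < z" for t
  proof -
    have "((\<lambda>t. sqrt (z - t)) has_real_derivative (inverse (sqrt (z - t)) / 2 * (0 - 1))) (at t)"
      using that by (intro DERIV_chain2[OF DERIV_real_sqrt] DERIV_diff DERIV_const DERIV_ident) auto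
    from DERIV_cmult[OF this, of "-2"] show ?thesis using that by (simp add: inverse_eq_divide)
  qed
  have D2: "((\<lambda>t. 2 * sqrt (t - z)) has_real_derivative 1 / sqrt \<bar>t - z\<bar>) (at t)" if "z < t" for t
  proof -
    have "((\<lambda>t. sqrt (t - z)) has_real_derivative (inverse (sqrt (t - z)) / 2 * (1 - 0))) (at t)"
      using that by (intro DERIV_chain2[OF DERIV_real_sqrt] DERIV_diff DERIV_const DERIV_ident) auto
    from DERIV_cmult[OF this, of 2] show ?thesis using that by (simp add: inverse_eq_divide)
  qed
  have "((\<lambda>t. 1 / sqrt \<bar>t - z\<bar>) has_integral (- 2 * sqrt (z - z) - (- 2 * sqrt (z - 0)))) {0..z}"
    using z D1 by (intro fundamental_theorem_of_calculus_interior[where f = "\<lambda>t. - 2 * sqrt (z - t)"] continuous_intros)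
      (auto simp: has_real_derivative_iff_has_vector_derivative)
  moreover have "((\<lambda>t. 1 / sqrt \<bar>t - z\<bar>) has_integral (2 * sqrt (1 - z) - 2 * sqrt (z - z))) {z..1}"
    using z D2 by (intro fundamental_theorem_of_calculus_interior[where f = "\<lambda>t. 2 * sqrt (t - z)"] continuous_intros)
      (auto simp: has_real_derivative_iff_has_vector_derivative)
  ultimately show ?thesis
    using z by (intro Henstock_Kurzweil_Integration.integrable_combine[where a = 0 and b = 1 and c = z]) (auto simp: integrable_on_def)
qed

lemma sing_wt_integrable: "sing_wt integrable_on {0..1}"
proof -
  have "sing_wt = (\<lambda>t. 1 + (1 / sqrt \<bar>t - 0\<bar> + 1 / sqrt \<bar>t - 1/2\<bar> + 1 / sqrt \<bar>t - 1\<bar>))"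
    by (rule ext) (simp add: sing_wt_def)
  moreover have "(\<lambda>t. 1 + (1 / sqrt \<bar>t - 0\<bar> + 1 / sqrt \<bar>t - 1/2\<bar> + 1 / sqrt \<bar>t - 1\<bar>)) integrable_on {0..1}"
    by (intro integrable_add inverse_sqrt_integrable integrable_const_ivl) auto
  ultimately show ?thesis by (simp only:)
qed

text \<open>A weak Jordan inequality by halving the angle: with \<open>y = x / 2\<close>,
  \<open>sin x\<close> is at least \<open>2 * y * (cos y)\<^sup>2 = y * (1 + cos x)\<close>.\<close>

lemma sin_ge_half:
  assumes "0 \<le> x" "x \<le> pi / 2" shows "x / 2 \<le> sin (x::real)"
proof (cases "x = 0")
  case False
  define y where "y = x / 2"
  have y: "0 < y" "y \<le> pi / 4" using assms False by (auto simp: y_def)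
  obtain \<xi> where \<xi>: "0 < \<xi>" "\<xi> < y" "sin y - sin 0 = (y - 0) * cos \<xi>"
    using MVT2[of 0 y sin cos] y by auto
  have "cos y \<le> cos \<xi>" using \<xi> y pi_gt_zero by (intro cos_monotone_0_pi_le) auto
  hence "y * cos y \<le> sin y" using \<xi> y by simp
  moreover have c: "cos y > 0" using y pi_gt_zero by (intro cos_gt_zero) auto
  ultimately have "y * cos y * cos y \<le> sin y * cos y" by (intro mult_right_mono) auto
  hence "2 * (y * (cos y)\<^sup>2) \<le> sin x" using sin_double[of y] by (simp add: y_def power2_eq_square)
  moreover have "(cos y)\<^sup>2 = (1 + cos x) / 2" using cos_double_cos[of y] by (simp add: y_def)
  moreover have "cos x \<ge> 0" using assms by (intro cos_ge_zero) auto
  hence "y * 1 \<le> y * (1 + cos x)" using y by (intro mult_left_mono) auto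
  hence "x / 2 \<le> 2 * (y * ((1 + cos x) / 2))" by (simp add: y_def)
  ultimately show ?thesis by (metis order_trans)
qed simp

text \<open>The zeros of the sine on [0,1] are 0, 1/2 and 1. The distance \<open>m\<close> to the
  nearest one is at most 1/4, and
  \<open>\<bar>sin (2 * pi * t)\<bar> \<ge> pi * m \<ge> m\<close>.\<close>

lemma sing_wt_ge:
  assumes t: "t \<in> {0..1} - {0, 1/2, 1}"
  shows "1 / sqrt \<bar>sin (2 * pi * t)\<bar> \<le> sing_wt t" "sin (2 * pi * t) \<noteq> 0"
proof -
  have *: "1 / sqrt \<bar>sin (2 * pi * t)\<bar> \<le> 1 / sqrt m \<and> sin (2 * pi * t) \<noteq> 0"
    if "0 < m" "m \<le> 1/4" "\<bar>sin (2 * pi * t)\<bar> = \<bar>sin (2 * pi * m)\<bar>" for m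
  proof -
    have "2 * pi * m / 2 \<le> sin (2 * pi * m)" using that mult_left_mono[of m "1/4" "2 * pi"] by (intro sin_ge_half) auto
    moreover have "1 * m \<le> pi * m" using pi_gt3 that by (intro mult_right_mono) auto
    ultimately have "m \<le> sin (2 * pi * m)" by simp
    hence "m \<le> \<bar>sin (2 * pi * t)\<bar>" using that(3) by linarith
    thus ?thesis using that by (auto intro!: divide_left_mono)
  qed
  have nn: "0 \<le> 1 / sqrt \<bar>x\<bar>" for x :: real by simp
  consider "t \<le> 1/4" | "1/4 \<le> t" "t \<le> 3/4" | "3/4 \<le> t" by linarith
  hence "1 / sqrt \<bar>sin (2 * pi * t)\<bar> \<le> sing_wt t \<and> sin (2 * pi * t) \<noteq> 0"
  proof cases
    case 1
    have "1 / sqrt \<bar>sin (2 * pi * t)\<bar> \<le> 1 / sqrt \<bar>t\<bar> \<and> sin (2 * pi * t) \<noteq> 0" using *[of t] 1 t by auto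
    thus ?thesis using nn[of "t - 1/2"] nn[of "t - 1"] unfolding sing_wt_def by linarith
  next
    case 2
    have "\<bar>sin (2 * pi * t)\<bar> = \<bar>sin (2 * pi * \<bar>t - 1/2\<bar>)\<bar>"
    proof -
      have "2 * pi * t = 2 * pi * (t - 1/2) + pi" by (simp add: algebra_simps)
      hence "\<bar>sin (2 * pi * t)\<bar> = \<bar>sin (2 * pi * (t - 1/2))\<bar>" by (metis sin_periodic_pi abs_minus_cancel)
      moreover have "2 * pi * \<bar>t - 1/2\<bar> = \<bar>2 * pi * (t - 1/2)\<bar>" by (simp add: abs_mult)
      ultimately show ?thesis by (simp add: abs_if)
    qed
    hence "1 / sqrt \<bar>sin (2 * pi * t)\<bar> \<le> 1 / sqrt \<bar>t - 1/2\<bar> \<and> sin (2 * pi * t) \<noteq> 0"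
      using 2 t by (intro *) (auto simp: abs_if)
    thus ?thesis using nn[of t] nn[of "t - 1"] unfolding sing_wt_def by linarith
  next
    case 3
    have "2 * pi * t = 2 * pi * (t - 1) + 2 * pi" by (simp add: algebra_simps)
    hence "sin (2 * pi * t) = sin (2 * pi * (t - 1))" by (metis sin_periodic)
    moreover have "2 * pi * (t - 1) = - (2 * pi * \<bar>t - 1\<bar>)" using t by (simp add: abs_if algebra_simps)
    ultimately have "\<bar>sin (2 * pi * t)\<bar> = \<bar>sin (2 * pi * \<bar>t - 1\<bar>)\<bar>" by (metis sin_minus abs_minus_cancel)
    hence "1 / sqrt \<bar>sin (2 * pi * t)\<bar> \<le> 1 / sqrt \<bar>t - 1\<bar> \<and> sin (2 * pi * t) \<noteq> 0"
      using 3 t by (intro *) (auto simp: abs_if)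
    thus ?thesis using nn[of "t - 1/2"] nn[of t] unfolding sing_wt_def by linarith
  qed
  thus "1 / sqrt \<bar>sin (2 * pi * t)\<bar> \<le> sing_wt t" "sin (2 * pi * t) \<noteq> 0" by auto
qed

text \<open>Uniformity in \<open>r\<close> is what lets the contours approach the boundary. The
  lower bound \<open>(1 + \<rho>) / 2\<close> keeps them away from the focal segment, so that
  division by the distance to a focus preserves such bounds.\<close>

definition arc_ctrl :: "real \<Rightarrow> real \<Rightarrow> (complex \<Rightarrow> complex) \<Rightarrow> bool" where
  "arc_ctrl h \<rho> u \<longleftrightarrow> u holomorphic_on ellipse_region h \<rho> \<and>
     (\<exists>K. \<forall>r t. (1 + \<rho>) / 2 \<le> r \<longrightarrow> r < \<rho> \<longrightarrow> t \<in> {0..1} - {0, 1/2, 1} \<longrightarrow>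
        norm (u (ell h (jouk (circ r t)))) \<le> K * sing_wt t)"

lemma arc_ctrl_rapprox:
  assumes h: "h < 1" and \<rho>: "\<rho> > 1" and u: "arc_ctrl h \<rho> u"
  shows "rapprox \<rho> (\<lambda>y. Re (u (of_real (1 - (1 - h) * y))))"
proof -
  let ?E = "ellipse_region h \<rho>"
  obtain K where hol: "u holomorphic_on ?E"
    and K: "\<And>r t. (1 + \<rho>) / 2 \<le> r \<Longrightarrow> r < \<rho> \<Longrightarrow> t \<in> {0..1} - {0, 1/2, 1} \<Longrightarrow> norm (u (ell h (jouk (circ r t)))) \<le> K * sing_wt t"
    using u unfolding arc_ctrl_def by blast
  define S where "S = ell h -` ?E"
  have opS: "open S" unfolding S_def ell_def[abs_def]
    by (intro open_vimage ellipse_region_open_convex h \<rho> continuous_intros)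
  have cvS: "convex S"
  proof (rule convexI)
    fix x y and a b :: real assume "x \<in> S" "y \<in> S" and ab: "0 \<le> a" "0 \<le> b" "a + b = 1"
    have "of_real a + of_real b = (1 :: complex)" using ab(3) by (metis of_real_add of_real_1)
    hence "c + d * (of_real a * x + of_real b * y) = of_real a * (c + d * x) + of_real b * (c + d * y)" for c d
      by algebra
    hence "ell h (a *\<^sub>R x + b *\<^sub>R y) = a *\<^sub>R ell h x + b *\<^sub>R ell h y"
      unfolding ell_def scaleR_conv_of_real .
    thus "a *\<^sub>R x + b *\<^sub>R y \<in> S"
      using convexD[OF ellipse_region_open_convex(2)[OF h \<rho>]] \<open>x \<in> S\<close> \<open>y \<in> S\<close> ab by (simp add: S_def)
  qed
  have hS: "(\<lambda>w. u (ell h w)) holomorphic_on S"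
  proof -
    have "ell h holomorphic_on S" unfolding ell_def[abs_def] by (intro holomorphic_intros)
    moreover have "ell h ` S \<subseteq> ?E" by (auto simp: S_def)
    ultimately have "(u \<circ> ell h) holomorphic_on S" using holomorphic_on_compose_gen hol by blast
    thus ?thesis by (simp add: comp_def)
  qed
  have iS: "(\<lambda>t. K * sing_wt t) integrable_on {0..1}"
    using has_integral_mult_right[OF integrable_integral[OF sing_wt_integrable], of K] unfolding integrable_on_def by blast
  have rS: "jouk \<zeta> \<in> S" if "1 \<le> norm \<zeta>" "norm \<zeta> < \<rho>" for \<zeta>
    using ell_jouk_in_region[OF h \<rho> that] by (simp add: S_def)
  have "\<exists>C. \<forall>m. \<exists>p. degree p \<le> m \<and>
      (\<forall>s. \<bar>Re (u (ell h (of_real (cos s)))) - poly p (cos s)\<bar> \<le> C / \<rho> ^ m)"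
  proof (rule cheb_approximation[where S = S and g = "\<lambda>w. u (ell h w)" and B = "\<lambda>t. K * sing_wt t"])
    show "norm (u (ell h (jouk (circ r t)))) \<le> K * sing_wt t"
      if "(1 + \<rho>) / 2 \<le> r" "r < \<rho>" "t \<in> {0..1} - {0, 1/2, 1}" for r t using K[OF that] .
  qed (fact opS cvS hS \<rho> iS | rule rS, assumption+)+
  then obtain C where C: "\<And>m. \<exists>p. degree p \<le> m \<and>
      (\<forall>s. \<bar>Re (u (ell h (of_real (cos s)))) - poly p (cos s)\<bar> \<le> C / \<rho> ^ m)" by blast
  have "\<exists>q. degree q \<le> m \<and> (\<forall>y\<in>{0..1}. \<bar>Re (u (of_real (1 - (1 - h) * y))) - poly q y\<bar> \<le> C / \<rho> ^ m)" for m
  proof -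
    obtain p where p: "degree p \<le> m" "\<And>s. \<bar>Re (u (ell h (of_real (cos s)))) - poly p (cos s)\<bar> \<le> C / \<rho> ^ m"
      using C by blast
    \<comment> \<open>Three coordinates of one point: \<open>y\<close> is \<sigma>,
      \<open>1 - 2 * y\<close> lies in [-1,1], and \<open>ell h\<close> maps the latter to
      \<open>1 - (1 - h) * y\<close>, the cosine of the local angle.\<close>
    have "\<bar>Re (u (of_real (1 - (1 - h) * y))) - poly (pcompose p [:1, -2:]) y\<bar> \<le> C / \<rho> ^ m" if y: "y \<in> {0..1}" for y
    proof -
      have "cos (arccos (1 - 2 * y)) = 1 - 2 * y" using y by simp
      moreover have "ell h (of_real (1 - 2 * y)) = of_real (1 - (1 - h) * y)"
        by (simp add: ell_def complex_eq_iff field_simps)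
      ultimately show ?thesis using p(2)[of "arccos (1 - 2 * y)"] by (simp add: poly_pcompose mult.commute)
    qed
    moreover have "degree (pcompose p [:1, -2:]) \<le> m" using p(1) by (simp add: degree_pcompose)
    ultimately show ?thesis by blast
  qed
  thus ?thesis unfolding rapprox_def by blast
qed

lemma rapprox_cmult:
  assumes "rapprox \<rho> f" "\<rho> > 1" shows "rapprox \<rho> (\<lambda>y. c * f y)"
proof -
  obtain C p where p: "\<And>m. degree (p m) \<le> m" "\<And>m y. y \<in> {0..1} \<Longrightarrow> \<bar>f y - poly (p m) y\<bar> \<le> C / \<rho> ^ m"
    using assms(1) unfolding rapprox_def by metis
  have "\<bar>c * f y - poly (smult c (p m)) y\<bar> \<le> (\<bar>c\<bar> * C) / \<rho> ^ m" if "y \<in> {0..1}" for m y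
    using mult_left_mono[OF p(2)[OF that, of m], of "\<bar>c\<bar>"] by (simp add: abs_mult[symmetric] right_diff_distrib)
  thus ?thesis unfolding rapprox_def using p(1) degree_smult_le order_trans by metis
qed

text \<open>Up to sign, \<open>1 + jouk \<zeta>\<close> and \<open>1 - jouk \<zeta>\<close> are
  squares \<open>(\<zeta> - e)\<^sup>2\<close> over \<open>2 * \<zeta>\<close> with \<open>e\<close>
  equal to -1 or 1, and \<open>\<bar>\<zeta>\<bar> - 1 \<ge> (\<rho> - 1) / 2\<close>. These are the
  distances to the foci before rescaling.\<close>

lemma jouk_pm_one_bound:
  assumes \<rho>: "\<rho> > 1" and r: "(1 + \<rho>) / 2 \<le> r" "r < \<rho>" and z: "norm \<zeta> = r"
  shows "(\<rho> - 1)\<^sup>2 / (8 * \<rho>) \<le> norm (1 + jouk \<zeta>)" "(\<rho> - 1)\<^sup>2 / (8 * \<rho>) \<le> norm (1 - jouk \<zeta>)"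
proof -
  have nz: "\<zeta> \<noteq> 0" using z r \<rho> by auto
  have *: "(\<rho> - 1)\<^sup>2 / (8 * \<rho>) \<le> norm ((\<zeta> - e)\<^sup>2 / (2 * \<zeta>))" if "norm e = 1" for e
  proof -
    have "(\<rho> - 1) / 2 \<le> norm (\<zeta> - e)" using norm_triangle_ineq2[of \<zeta> e] that z r by simp
    hence "((\<rho> - 1) / 2)\<^sup>2 \<le> (norm (\<zeta> - e))\<^sup>2" using \<rho> by (intro power_mono) auto
    hence "((\<rho> - 1) / 2)\<^sup>2 / (2 * \<rho>) \<le> (norm (\<zeta> - e))\<^sup>2 / (2 * r)" using r \<rho> by (intro frac_le) auto
    thus ?thesis using z by (simp add: norm_divide norm_mult norm_power power_divide)
  qed
  have "1 + jouk \<zeta> = (\<zeta> - (-1))\<^sup>2 / (2 * \<zeta>)" "1 - jouk \<zeta> = - ((\<zeta> - 1)\<^sup>2 / (2 * \<zeta>))"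
    using nz by (simp_all add: jouk_def field_simps power2_eq_square)
  thus "(\<rho> - 1)\<^sup>2 / (8 * \<rho>) \<le> norm (1 + jouk \<zeta>)" "(\<rho> - 1)\<^sup>2 / (8 * \<rho>) \<le> norm (1 - jouk \<zeta>)"
    using *[of "-1"] *[of 1] by (simp_all only: norm_minus_cancel norm_one)
qed

lemma sing_wt_ge_1: "1 \<le> sing_wt t"
  by (simp add: sing_wt_def)

lemma real_in_ellipse_region:
  assumes h: "h < 1" and \<rho>: "\<rho> > 1" and y: "y \<in> {h..1}"
  shows "of_real y \<in> ellipse_region h \<rho>"
proof -
  define s where "s = arccos ((y - (1 + h) / 2) / ((1 - h) / 2))"
  have "-1 \<le> (y - (1 + h) / 2) / ((1 - h) / 2)" "(y - (1 + h) / 2) / ((1 - h) / 2) \<le> 1"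
    using h y by (simp_all add: divide_simps)
  hence c: "cos s = (y - (1 + h) / 2) / ((1 - h) / 2)" by (simp add: s_def)
  have "jouk (cis s) = of_real (cos s)"
    by (simp add: jouk_def complex_eq_iff flip: inverse_eq_divide)
  moreover have "(1 - h) / 2 * cos s = y - (1 + h) / 2"
  proof -
    have "(1 - h) / 2 \<noteq> 0" using h by simp
    thus ?thesis unfolding c by (metis nonzero_mult_div_cancel_left times_divide_eq_right)
  qed
  hence "(1 + h) / 2 + (1 - h) / 2 * cos s = y" by linarith
  ultimately have "ell h (jouk (cis s)) = of_real y" unfolding ell_def by (metis of_real_add of_real_mult)
  thus ?thesis using ell_jouk_in_region[OF h \<rho>, of "cis s"] \<rho> by simp
qed

text \<open>The point \<open>h\<close> is a focus, hence at distance at least \<delta> from all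
  contours, and dividing by \<open>y - h\<close> there costs a constant factor. No bound near
  \<open>h\<close> itself is required.\<close>

lemma arc_ctrl_quotient:
  assumes h: "h < 1" and \<rho>: "\<rho> > 1" and u: "arc_ctrl h \<rho> u"
  shows "\<exists>u1. arc_ctrl h \<rho> u1 \<and> (\<forall>y\<in>ellipse_region h \<rho>. u y - u (of_real h) = (y - of_real h) * u1 y)"
proof -
  let ?E = "ellipse_region h \<rho>"
  obtain K where hol: "u holomorphic_on ?E"
    and K: "\<And>r t. (1 + \<rho>) / 2 \<le> r \<Longrightarrow> r < \<rho> \<Longrightarrow> t \<in> {0..1} - {0, 1/2, 1} \<Longrightarrow> norm (u (ell h (jouk (circ r t)))) \<le> K * sing_wt t"
    using u unfolding arc_ctrl_def by blast
  obtain u1 where u1: "u1 holomorphic_on ?E" "\<And>y. y \<in> ?E \<Longrightarrow> u y - u (of_real h) = (y - of_real h) * u1 y"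
  proof -
    have "(\<lambda>y. u y - u (of_real h)) holomorphic_on ?E" by (intro holomorphic_intros hol)
    from holomorphic_factor_root[OF this ellipse_region_open_convex(1)[OF h \<rho>], of "of_real h"] that
    show ?thesis by auto
  qed
  define \<delta> where "\<delta> = (1 - h) / 2 * ((\<rho> - 1)\<^sup>2 / (8 * \<rho>))"
  have \<delta>: "\<delta> > 0" using h \<rho> by (simp add: \<delta>_def)
  have "norm (u1 (ell h (jouk (circ r t)))) \<le> (\<bar>K\<bar> + norm (u (of_real h))) / \<delta> * sing_wt t"
    if r: "(1 + \<rho>) / 2 \<le> r" "r < \<rho>" and t: "t \<in> {0..1} - {0, 1/2, 1}" for r t
  proof -
    define y where "y = ell h (jouk (circ r t))"
    have nr: "norm (circ r t) = r" using norm_circ[of r t] r \<rho> by simp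
    have yE: "y \<in> ?E" unfolding y_def using nr r \<rho> by (intro ell_jouk_in_region h) auto
    have "y - of_real h = of_real ((1 - h) / 2) * (1 + jouk (circ r t))"
      by (simp add: y_def ell_def field_simps)
    hence "norm (y - of_real h) = (1 - h) / 2 * norm (1 + jouk (circ r t))"
      using h by (simp only: norm_mult norm_of_real) simp
    also have "\<dots> \<ge> \<delta>" unfolding \<delta>_def using jouk_pm_one_bound(1)[OF \<rho> r nr] h by (intro mult_left_mono) auto
    finally have dist: "\<delta> \<le> norm (y - of_real h)" .
    have "\<delta> * norm (u1 y) \<le> norm (y - of_real h) * norm (u1 y)" using dist by (intro mult_right_mono) auto
    also have "\<dots> = norm (u y - u (of_real h))" using u1(2)[OF yE] by (simp add: norm_mult)
    also have "\<dots> \<le> norm (u y) + norm (u (of_real h))" by (rule norm_triangle_ineq4)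
    also have "\<dots> \<le> \<bar>K\<bar> * sing_wt t + norm (u (of_real h)) * sing_wt t"
    proof (rule add_mono)
      show "norm (u y) \<le> \<bar>K\<bar> * sing_wt t"
        using K[OF r t] sing_wt_ge_1[of t] unfolding y_def
        by (intro order_trans[OF K[OF r t]] mult_right_mono) auto
      show "norm (u (of_real h)) \<le> norm (u (of_real h)) * sing_wt t"
        using sing_wt_ge_1[of t] mult_left_mono[of 1 "sing_wt t" "norm (u (of_real h))"] by simp
    qed
    finally have "norm (u1 y) * \<delta> \<le> (\<bar>K\<bar> + norm (u (of_real h))) * sing_wt t" by (simp add: algebra_simps)
    thus ?thesis using \<delta> by (simp add: y_def pos_le_divide_eq)
  qed
  thus ?thesis using u1 unfolding arc_ctrl_def by blast
qed

text \<open>Multiplied by the sine, the odd part becomes even and factors through the cosine as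
  \<open>W\<close>. The sine vanishes over 1 and -1, so \<open>W\<close> is divisible by
  \<open>1 - y\<^sup>2\<close>, and the quotient is \<open>v\<close>.\<close>

lemma even_odd_factors:
  assumes h: "-1 < h" "h < 1" and \<rho>: "\<rho> > 1"
    and H: "H holomorphic_on D_region h \<rho>" and M: "\<And>z. z \<in> D_region h \<rho> \<Longrightarrow> norm (H z) \<le> M"
    and per: "\<And>z. z \<in> D_region h \<rho> \<Longrightarrow> H (z + 2 * of_real pi) = H z"
  shows "\<exists>u v. arc_ctrl h \<rho> u \<and> arc_ctrl h \<rho> v \<and>
    (\<forall>z\<in>D_region h \<rho>. (H z + H (- z)) / 2 = u (cos z) \<and> sin z * (H z - H (- z)) / 2 = (sin z)\<^sup>2 * v (cos z))"
proof -
  let ?E = "ellipse_region h \<rho>"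
  define D where "D = D_region h \<rho>"
  have Dc: "D = {z. cos z \<in> ?E}" by (simp add: D_def D_region_def)
  have E: "open ?E" by (rule ellipse_region_open_convex[OF h(2) \<rho>])
  have cosper: "cos (z + 2 * of_real pi) = cos z" "sin (z + 2 * of_real pi) = sin z" for z :: complex
    using cos_of_real[of "2 * pi", where 'a = complex] sin_of_real[of "2 * pi", where 'a = complex]
    by (simp_all add: cos_add sin_add)
  have Hm: "(\<lambda>z. H (- z)) holomorphic_on D"
  proof -
    have "(\<lambda>z. - z) holomorphic_on D" by (intro holomorphic_intros)
    moreover have "(\<lambda>z. - z) ` D \<subseteq> D" unfolding Dc by auto
    ultimately have "(H \<circ> (\<lambda>z. - z)) holomorphic_on D"
      using holomorphic_on_compose_gen H D_def by blast
    thus ?thesis by (simp add: comp_def)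
  qed
  have Hh: "H holomorphic_on D" using H by (simp add: D_def)
  have perm: "H (- z - 2 * of_real pi) = H (- z)" if "cos z \<in> ?E" for z
  proof -
    have "cos (- z - 2 * of_real pi) = cos z" using cosper(1)[of "- z - 2 * of_real pi"] by simp
    hence "H ((- z - 2 * of_real pi) + 2 * of_real pi) = H (- z - 2 * of_real pi)"
      using per[of "- z - 2 * of_real pi"] that by (simp add: D_region_def)
    thus ?thesis by simp
  qed
  have perp: "H (z + 2 * of_real pi) = H z" if "cos z \<in> ?E" for z using per that by (simp add: D_region_def)
  have "\<exists>u. u holomorphic_on ?E \<and> (\<forall>z. cos z \<in> ?E \<longrightarrow> u (cos z) = (H z + H (- z)) / 2)"
    using Hh Hm by (intro even_periodic_factors_through_cos E)
      (auto simp: perm perp simp flip: Dc intro!: holomorphic_intros)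
  then obtain u where u: "u holomorphic_on ?E" "\<And>z. cos z \<in> ?E \<Longrightarrow> u (cos z) = (H z + H (- z)) / 2" by blast
  have "\<exists>W. W holomorphic_on ?E \<and> (\<forall>z. cos z \<in> ?E \<longrightarrow> W (cos z) = sin z * (H z - H (- z)) / 2)"
    using Hh Hm by (intro even_periodic_factors_through_cos E)
      (auto simp: perm perp cosper right_diff_distrib diff_divide_distrib simp flip: Dc intro!: holomorphic_intros)
  then obtain W where W: "W holomorphic_on ?E" "\<And>z. cos z \<in> ?E \<Longrightarrow> W (cos z) = sin z * (H z - H (- z)) / 2" by blast
  have "W 1 = 0" if "1 \<in> ?E" using W(2)[of 0] that by simp
  then obtain W1 where W1: "W1 holomorphic_on ?E" "\<And>y. y \<in> ?E \<Longrightarrow> W y = (y - 1) * W1 y"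
    using holomorphic_factor_root[OF W(1) E, of 1] by blast
  have "W1 (-1) = 0" if "-1 \<in> ?E"
  proof -
    have "cos (of_real pi) = (-1 :: complex)" "sin (of_real pi) = (0 :: complex)" by (simp_all add: cos_of_real sin_of_real)
    hence "W (-1) = 0" using W(2)[of "of_real pi"] that by simp
    thus ?thesis using W1(2)[OF that] by simp
  qed
  then obtain V where V: "V holomorphic_on ?E" "\<And>y. y \<in> ?E \<Longrightarrow> W1 y = (y - (-1)) * V y"
    using holomorphic_factor_root[OF W1(1) E, of "-1"] by blast
  define v where "v y = - V y" for y
  have v: "v holomorphic_on ?E" unfolding v_def by (intro holomorphic_intros V)
  have Wv: "W (cos z) = (sin z)\<^sup>2 * v (cos z)" if "cos z \<in> ?E" for z
  proof -
    have "W (cos z) = (cos z - 1) * ((cos z + 1) * V (cos z))" using W1(2)[OF that] V(2)[OF that] by simp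
    also have "\<dots> = (1 - (cos z)\<^sup>2) * v (cos z)" by (simp add: v_def power2_eq_square algebra_simps)
    finally show ?thesis by (simp add: sin_squared_eq)
  qed
  have Arc: "Arccos y \<in> D" "- Arccos y \<in> D" if "y \<in> ?E" for y using that by (auto simp: Dc)
  have M0: "0 \<le> M"
    using real_in_ellipse_region[OF h(2) \<rho>, of 1] h
    by (intro order_trans[OF norm_ge_zero M[of 0]]) (simp add: D_region_def)
  have "arc_ctrl h \<rho> u"
  proof -
    have "norm (u (ell h (jouk (circ r t)))) \<le> M * sing_wt t"
      if r: "(1 + \<rho>) / 2 \<le> r" "r < \<rho>" and t: "t \<in> {0..1} - {0, 1/2, 1}" for r t
    proof -
      define y where "y = ell h (jouk (circ r t))"
      have yE: "y \<in> ?E" unfolding y_def using norm_circ[of r t] r \<rho> by (intro ell_jouk_in_region h) auto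
      have "norm (u y) = norm (H (Arccos y) + H (- Arccos y)) / 2"
        using u(2)[of "Arccos y", unfolded cos_Arccos, OF yE] by (simp only: norm_divide norm_numeral)
      also have "\<dots> \<le> (M + M) / 2"
        using M Arc[OF yE] by (intro divide_right_mono norm_triangle_le add_mono) (auto simp: D_def)
      also have "\<dots> \<le> M * sing_wt t" using mult_left_mono[OF sing_wt_ge_1 M0, of t] by simp
      finally show ?thesis by (simp add: y_def)
    qed
    thus ?thesis using u(1) unfolding arc_ctrl_def by blast
  qed
  moreover have "arc_ctrl h \<rho> v"
  proof -
    define d where "d = (1 - h) / 2"
    define \<delta> where "\<delta> = (\<rho> - 1)\<^sup>2 / (8 * \<rho>)"
    \<comment> \<open>The constant in \<open>\<kappa> * \<bar>sin (2 * pi * t)\<bar> \<le> \<bar>sin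
      z\<bar>\<^sup>2 = \<bar>1 - y\<bar> * \<bar>1 + y\<bar>\<close>: \<open>d * \<delta>\<close>
      bounds the distance to the focus 1, and the remaining factor comes from the imaginary
      part.\<close>
    define \<kappa> where "\<kappa> = d * \<delta> * (d * ((\<rho> - 1) / 4))"
    have pos: "d > 0" "\<delta> > 0" using h \<rho> by (simp_all add: d_def \<delta>_def)
    hence \<kappa>: "\<kappa> > 0" using \<rho> by (simp add: \<kappa>_def)
    have "norm (v (ell h (jouk (circ r t)))) \<le> M / sqrt \<kappa> * sing_wt t"
      if r: "(1 + \<rho>) / 2 \<le> r" "r < \<rho>" and t: "t \<in> {0..1} - {0, 1/2, 1}" for r t
    proof -
      define y where "y = ell h (jouk (circ r t))"
      define s where "s = \<bar>sin (2 * pi * t)\<bar>"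
      have s: "s > 0" using sing_wt_ge(2)[OF t] by (simp add: s_def)
      have nr: "norm (circ r t) = r" using norm_circ[of r t] r \<rho> by simp
      have yE: "y \<in> ?E" unfolding y_def using nr r \<rho> by (intro ell_jouk_in_region h) auto
      define z where "z = Arccos y"
      have z: "cos z = y" "z \<in> D" "-z \<in> D" using Arc[OF yE] by (simp_all add: z_def)
      have "1 - y = of_real d * (1 - jouk (circ r t))"
        by (simp add: y_def ell_def d_def field_simps)
      hence "norm (1 - y) = d * norm (1 - jouk (circ r t))"
        using pos by (simp only: norm_mult norm_of_real abs_of_pos)
      also have "\<dots> \<ge> d * \<delta>" unfolding \<delta>_def using jouk_pm_one_bound(2)[OF \<rho> r nr] pos by (intro mult_left_mono) auto
      finally have n1: "d * \<delta> \<le> norm (1 - y)" .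
      have "1 / r \<le> 1" using r \<rho> by simp
      hence r2: "(\<rho> - 1) / 4 \<le> (r - 1 / r) / 2" using r by argo
      \<comment> \<open>Wherever -1 lies on the real axis relative to the contour, the imaginary
        part bounds the distance to it from below, degenerating only at the zeros of the
        sine.\<close>
      have "Im (1 + y) = d * ((r - 1 / r) / 2 * sin (2 * pi * t))"
        using r \<rho> by (simp add: y_def ell_def d_def polar_circ)
      hence "\<bar>Im (1 + y)\<bar> = d * ((r - 1 / r) / 2 * s)"
      proof -
        have "0 \<le> (\<rho> - 1) / 4" using \<rho> by simp
        hence "0 \<le> (r - 1 / r) / 2" using r2 by (rule order_trans)
        hence "\<bar>d * ((r - 1 / r) / 2 * sin (2 * pi * t))\<bar> = d * ((r - 1 / r) / 2 * s)"
          using pos by (simp only: abs_mult s_def abs_of_pos abs_of_nonneg)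
        thus ?thesis by (simp only: \<open>Im (1 + y) = _\<close>)
      qed
      also have "\<dots> \<ge> d * ((\<rho> - 1) / 4 * s)" using pos r2 s by (intro mult_left_mono mult_right_mono) auto
      finally have n2: "d * ((\<rho> - 1) / 4 * s) \<le> norm (1 + y)" using abs_Im_le_cmod[of "1 + y"] by simp
      have "d * \<delta> * (d * ((\<rho> - 1) / 4 * s)) \<le> norm (1 - y) * norm (1 + y)"
        using n1 n2 pos \<rho> s by (intro mult_mono) auto
      also have "norm (1 - y) * norm (1 + y) = norm ((sin z)\<^sup>2)"
        unfolding sin_squared_eq z(1) by (simp add: power2_eq_square algebra_simps flip: norm_mult)
      finally have "\<kappa> * s \<le> (norm (sin z))\<^sup>2" by (simp add: \<kappa>_def norm_power mult_ac)
      hence "sqrt (\<kappa> * s) \<le> norm (sin z)" by (simp add: real_le_lsqrt)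
      hence sq: "sqrt \<kappa> * sqrt s \<le> norm (sin z)" by (simp add: real_sqrt_mult)
      have "norm (sin z) * (norm (sin z) * norm (v y)) = norm (sin z) * norm ((H z - H (- z)) / 2)"
      proof -
        have "sin z * (sin z * v y) = W y" using Wv[of z] z(1) yE by (simp add: power2_eq_square)
        also have "W y = sin z * ((H z - H (- z)) / 2)" using W(2)[of z, unfolded z(1), OF yE] by (simp only: times_divide_eq_right)
        finally show ?thesis by (metis norm_mult)
      qed
      moreover have "norm (sin z) > 0" using sq \<kappa> s by (smt (verit) mult_pos_pos real_sqrt_gt_0_iff)
      ultimately have "norm (sin z) * norm (v y) = norm (H z - H (- z)) / 2" by (simp add: norm_divide)
      also have "\<dots> \<le> (M + M) / 2"
        using M z by (intro divide_right_mono order_trans[OF norm_triangle_ineq4] add_mono) (auto simp: D_def)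
      finally have "norm (sin z) * norm (v y) \<le> M" by simp
      hence "sqrt \<kappa> * sqrt s * norm (v y) \<le> M" using mult_right_mono[OF sq, of "norm (v y)"] by simp
      hence "norm (v y) \<le> M / sqrt \<kappa> * (1 / sqrt s)" using \<kappa> s by (simp add: field_simps)
      also have "\<dots> \<le> M / sqrt \<kappa> * sing_wt t"
        using sing_wt_ge(1)[OF t] M0 \<kappa> unfolding s_def by (intro mult_left_mono) auto
      finally show ?thesis by (simp add: y_def)
    qed
    thus ?thesis using v unfolding arc_ctrl_def by blast
  qed
  moreover have "\<forall>z\<in>D_region h \<rho>. (H z + H (- z)) / 2 = u (cos z) \<and> sin z * (H z - H (- z)) / 2 = (sin z)\<^sup>2 * v (cos z)"
    using u(2) W(2) Wv by (simp add: D_region_def)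
  ultimately show ?thesis by blast
qed

text \<open>In this coordinate \<open>y = 1\<close> is \<open>cos x = h\<close>, the two ends of the
  element. Thus \<open>g 1\<close> carries the boundary data, which the hat functions reproduce, and
  \<open>k\<close> is expanded for the weight with \<open>b = 1\<close>.\<close>

lemma arc_ctrl_pair:
  assumes h: "h < 1" and \<rho>: "\<rho> > 1" and u: "arc_ctrl h \<rho> u"
  defines "g \<equiv> \<lambda>y. Re (u (of_real (1 - (1 - h) * y)))"
  shows "rapprox \<rho> g" "\<exists>k. rapprox \<rho> k \<and> (\<forall>y\<in>{0..1}. g y = g 1 + (1 - y) * k y)"
proof -
  show "rapprox \<rho> g" unfolding g_def by (rule arc_ctrl_rapprox[OF h \<rho> u])
  obtain u1 where u1: "arc_ctrl h \<rho> u1"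
    "\<And>y. y \<in> ellipse_region h \<rho> \<Longrightarrow> u y - u (of_real h) = (y - of_real h) * u1 y"
    using arc_ctrl_quotient[OF h \<rho> u] by blast
  define k where "k = (\<lambda>y. (1 - h) * Re (u1 (of_real (1 - (1 - h) * y))))"
  have "rapprox \<rho> k" unfolding k_def by (intro rapprox_cmult arc_ctrl_rapprox h \<rho> u1)
  moreover have "g y = g 1 + (1 - y) * k y" if y: "y \<in> {0..1}" for y
  proof -
    define z where "z = 1 - (1 - h) * y"
    have "(1 - h) * y \<le> (1 - h) * 1" using y h by (intro mult_left_mono) auto
    moreover have "0 \<le> (1 - h) * y" using y h by simp
    ultimately have "h \<le> z" "z \<le> 1" unfolding z_def by (simp_all add: left_diff_distrib)
    hence "z \<in> {h..1}" by simp
    hence "u (of_real z) - u (of_real h) = of_real (z - h) * u1 (of_real z)"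
      using u1(2)[OF real_in_ellipse_region[OF h \<rho>]] by simp
    hence "Re (u (of_real z) - u (of_real h)) = Re (of_real (z - h) * u1 (of_real z))" by (simp only:)
    hence "Re (u (of_real z)) - Re (u (of_real h)) = (z - h) * Re (u1 (of_real z))"
      by (simp del: of_real_diff)
    moreover have "z - h = (1 - h) * (1 - y)" by (simp add: z_def algebra_simps)
    ultimately show ?thesis by (simp add: g_def k_def z_def algebra_simps)
  qed
  ultimately show "\<exists>k. rapprox \<rho> k \<and> (\<forall>y\<in>{0..1}. g y = g 1 + (1 - y) * k y)" by blast
qed

text \<open>The passage from complex to real analysis: the continuation is real on the element, so
  the real parts of \<open>u\<close> and \<open>v\<close> represent it there. Index 0 stands for the
  even part, 1 for the odd part.\<close>

lemma arc_decomposition: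
  fixes f :: "real \<Rightarrow> real"
  assumes \<phi>: "0 < \<phi>" "\<phi> < pi" and \<rho>: "\<rho> > 1"
    and H: "H holomorphic_on D_region (cos \<phi>) \<rho>" and M: "\<And>z. z \<in> D_region (cos \<phi>) \<rho> \<Longrightarrow> norm (H z) \<le> M"
    and per: "\<And>z. z \<in> D_region (cos \<phi>) \<rho> \<Longrightarrow> H (z + 2 * of_real pi) = H z"
    and f: "\<And>x. \<bar>x\<bar> \<le> \<phi> \<Longrightarrow> H (of_real x) = of_real (f x)"
  shows "\<exists>g k :: nat \<Rightarrow> real \<Rightarrow> real. (\<forall>e. rapprox \<rho> (g e) \<and> rapprox \<rho> (k e)) \<and>
     (\<forall>e. \<forall>y\<in>{0..1}. g e y = g e 1 + (1 - y) * k e y) \<and>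
     (\<forall>x. \<bar>x\<bar> \<le> \<phi> \<longrightarrow> f x = g 0 (sig (cos \<phi>) x) + sin x * g 1 (sig (cos \<phi>) x))"
proof -
  define h where "h = cos \<phi>"
  have h: "-1 < h" "h < 1"
    using cos_monotone_0_pi[of \<phi> pi] cos_less_one[of \<phi>] \<phi> by (auto simp: h_def)
  obtain u v where uv: "arc_ctrl h \<rho> u" "arc_ctrl h \<rho> v"
    and dec: "\<And>z. z \<in> D_region h \<rho> \<Longrightarrow> (H z + H (- z)) / 2 = u (cos z)"
      "\<And>z. z \<in> D_region h \<rho> \<Longrightarrow> sin z * (H z - H (- z)) / 2 = (sin z)\<^sup>2 * v (cos z)"
    using even_odd_factors[OF h \<rho> H[folded h_def] M[folded h_def] per[folded h_def]] by blast
  define g where "g e y = Re ((if e = 0 then u else v) (of_real (1 - (1 - h) * y)))" for e :: nat and y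
  have ctrl: "arc_ctrl h \<rho> (if e = 0 then u else v)" for e :: nat using uv by simp
  have g: "rapprox \<rho> (g e)" "\<exists>k. rapprox \<rho> k \<and> (\<forall>y\<in>{0..1}. g e y = g e 1 + (1 - y) * k y)" for e
    using arc_ctrl_pair[OF h(2) \<rho> ctrl[of e]] unfolding g_def by auto
  then obtain k where k: "\<And>e. rapprox \<rho> (k e)" "\<And>e y. y \<in> {0..1} \<Longrightarrow> g e y = g e 1 + (1 - y) * k e y" by metis
  have "f x = g 0 (sig h x) + sin x * g 1 (sig h x)" if x: "\<bar>x\<bar> \<le> \<phi>" for x
  proof -
    have "cos \<phi> \<le> cos \<bar>x\<bar>" using x \<phi> by (intro cos_monotone_0_pi_le) auto
    hence "of_real (cos x) \<in> ellipse_region h \<rho>"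
      by (intro real_in_ellipse_region h \<rho>) (simp add: h_def)
    hence D: "of_real x \<in> D_region h \<rho>" by (simp add: D_region_def cos_of_real)
    have sg: "1 - (1 - h) * sig h x = cos x" using h by (simp add: sig_def field_simps)
    have Hx: "H (of_real x) = of_real (f x)" "H (- of_real x) = of_real (f (- x))"
      using f[of x] f[of "- x"] x by simp_all
    have "of_real ((f x + f (- x)) / 2) = u (of_real (cos x))"
      using dec(1)[OF D] by (simp add: Hx cos_of_real)
    hence e: "(f x + f (- x)) / 2 = g 0 (sig h x)" unfolding g_def sg by (metis Re_complex_of_real)
    have "of_real (sin x * (f x - f (- x)) / 2) = of_real ((sin x)\<^sup>2) * v (of_real (cos x))"
      using dec(2)[OF D] by (simp add: Hx cos_of_real sin_of_real)
    hence "Re (of_real (sin x * (f x - f (- x)) / 2)) = Re (of_real ((sin x)\<^sup>2) * v (of_real (cos x)))"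
      by (simp only:)
    hence o: "sin x * (f x - f (- x)) / 2 = (sin x)\<^sup>2 * g 1 (sig h x)" unfolding g_def sg by simp
    \<comment> \<open>The sine multiplied into the odd part is divided out again; at
      \<open>x = 0\<close> both sides vanish.\<close>
    have "(f x - f (- x)) / 2 = sin x * g 1 (sig h x)"
    proof (cases "x = 0")
      case False
      hence "sin x \<noteq> 0" using x \<phi> sin_zero_pi_iff[of x] by auto
      moreover have "sin x * ((f x - f (- x)) / 2) = sin x * (sin x * g 1 (sig h x))"
        using o by (simp add: power2_eq_square)
      ultimately show ?thesis by (metis mult_left_cancel)
    qed simp
    moreover have "f x = (f x + f (- x)) / 2 + (f x - f (- x)) / 2" by (simp add: field_simps)
    ultimately show ?thesis using e by simp
  qed
  thus ?thesis using g(1) k unfolding h_def by blast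
qed

subsection \<open>A Nikolskii inequality\<close>

lemma has_integral_cos_mult:
  assumes "m \<in> \<int>"
  shows "((\<lambda>s. cos (m * s)) has_integral (if m = 0 then pi else 0)) {0..pi}"
proof (cases "m = 0")
  case True
  then show ?thesis using has_integral_const_real[of "1::real" 0 pi] by simp
next
  case False
  have "((\<lambda>s. cos (m * s)) has_integral (sin (m * pi) / m - sin (m * 0) / m)) {0..pi}"
    using False by (intro fundamental_theorem_of_calculus)
      (auto intro!: derivative_eq_intros simp flip: has_real_derivative_iff_has_vector_derivative)
  moreover have "sin (m * pi) = 0" using assms sin_integer_2pi[of "m / 2"] by (auto simp: mult.commute elim!: Ints_cases)
  ultimately show ?thesis using False by simp
qed

lemma has_integral_cos_cos:
  "((\<lambda>s. cos (real j * s) * cos (real k * s)) has_integral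
     ((if j = k then pi else 0) + (if j + k = 0 then pi else 0)) / 2) {0..pi}"
proof -
  have "((\<lambda>s. (cos ((real j - real k) * s) + cos ((real j + real k) * s)) / 2) has_integral
     ((if real j - real k = 0 then pi else 0) + (if real j + real k = 0 then pi else 0)) / 2) {0..pi}"
    by (intro has_integral_divide has_integral_add has_integral_cos_mult) auto
  moreover have "cos (real j * s) * cos (real k * s) = (cos ((real j - real k) * s) + cos ((real j + real k) * s)) / 2" for s
    by (simp add: cos_times_cos left_diff_distrib distrib_right)
  moreover have "real j - real k = 0 \<longleftrightarrow> j = k" "real j + real k = 0 \<longleftrightarrow> j + k = 0" by auto
  ultimately show ?thesis by (simp only:)
qed

text \<open>Orthogonality of the cosines bounds each of the \<open>N + 1\<close> Chebyshev
  coefficients by \<open>2 / pi\<close> times the integral, and every cosine is at most 1.\<close>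

lemma poly_cos_sup_le_integral:
  assumes q: "degree q \<le> N"
  shows "\<bar>poly q (cos s0)\<bar> \<le> real (N + 1) * (2 / pi * integral {0..pi} (\<lambda>s. \<bar>poly q (cos s)\<bar>))"
proof -
  define I where "I = integral {0..pi} (\<lambda>s. \<bar>poly q (cos s)\<bar>)"
  obtain a where a: "q = (\<Sum>k<Suc N. smult (a k) (cheb k))"
    using poly_expand_degree_family[of "Suc N" cheb q] cheb_degree q by auto
  have qc: "poly q (cos s) = (\<Sum>k<Suc N. a k * cos (real k * s))" for s
    by (simp add: a poly_sum poly_cheb_cos del: sum.lessThan_Suc)
  have ak: "\<bar>a k\<bar> \<le> 2 / pi * I" if k: "k < Suc N" for k
  proof -
    \<comment> \<open>The value is pi for \<open>k = 0\<close> and pi/2 otherwise.\<close>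
    define c where "c = ((if k = k then pi else 0) + (if k + k = 0 then pi else 0)) / 2"
    have c: "c \<ge> pi / 2" by (simp add: c_def)
    have "((\<lambda>s. \<Sum>j<Suc N. a j * (cos (real j * s) * cos (real k * s))) has_integral
       (\<Sum>j<Suc N. a j * (((if j = k then pi else 0) + (if j + k = 0 then pi else 0)) / 2))) {0..pi}"
      by (intro has_integral_sum has_integral_mult_right has_integral_cos_cos) auto
    also have "(\<Sum>j<Suc N. a j * (((if j = k then pi else 0) + (if j + k = 0 then pi else 0)) / 2)) =
       (\<Sum>j<Suc N. if j = k then a k * c else 0)"
      by (intro sum.cong) (auto simp: c_def)
    also have "\<dots> = a k * c" using k by (simp del: sum.lessThan_Suc)
    also have "(\<lambda>s. \<Sum>j<Suc N. a j * (cos (real j * s) * cos (real k * s))) = (\<lambda>s. poly q (cos s) * cos (real k * s))"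
      by (simp add: qc sum_distrib_right mult.assoc del: sum.lessThan_Suc)
    finally have I1: "((\<lambda>s. poly q (cos s) * cos (real k * s)) has_integral a k * c) {0..pi}" .
    have int: "(\<lambda>s. \<bar>poly q (cos s)\<bar>) integrable_on {0..pi}"
      by (intro integrable_continuous_real continuous_intros)
    have le: "norm (poly q (cos s) * cos (real k * s)) \<le> \<bar>poly q (cos s)\<bar>" for s
      by (simp add: abs_mult mult_left_le)
    have "norm (a k * c) \<le> I"
      unfolding I_def integral_unique[OF I1, symmetric]
      by (rule integral_norm_bound_integral[OF has_integral_integrable[OF I1] int le])
    moreover have "\<bar>a k\<bar> * (pi / 2) \<le> \<bar>a k\<bar> * \<bar>c\<bar>" using c by (intro mult_left_mono) auto
    ultimately have "\<bar>a k\<bar> * (pi / 2) \<le> I" by (simp add: abs_mult)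
    thus ?thesis by (simp add: field_simps)
  qed
  have "\<bar>poly q (cos s0)\<bar> \<le> (\<Sum>k<Suc N. \<bar>a k * cos (real k * s0)\<bar>)" unfolding qc by (rule sum_abs)
  also have "\<dots> \<le> (\<Sum>k<Suc N. 2 / pi * I)"
    using ak abs_cos_le_one by (intro sum_mono) (auto simp: abs_mult intro: order_trans[OF mult_left_le])
  finally show ?thesis by (simp add: I_def)
qed

text \<open>Both sides are one integral over (0,1) in \<sigma>, taken under the substitutions for
  the angles pi and \<phi>. The first suits Chebyshev polynomials, the second the weight of the
  element.\<close>

lemma sig_change_to_half_circle:
  fixes G :: "real \<Rightarrow> real"
  assumes \<phi>: "0 < \<phi>" "\<phi> < pi" and G: "continuous_on {0..1} G"
  defines "h \<equiv> cos \<phi>"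
  shows "integral {0..pi} (\<lambda>s. G (sig (-1) s) * (1 - sig (-1) s)) =
    integral {0..\<phi>} (\<lambda>x. G (sig h x) * (sqrt (2 / (1 - h) - sig h x) * sqrt (1 - sig h x)))" (is "integral _ ?gs = integral _ ?gx")
proof -
  define f where "f y = G y * (1 - y) * (y powr (-1/2) * (1 - y) powr (-1/2))" for y
  have \<phi>': "\<phi> \<le> pi" using \<phi> by simp
  have h: "h < 1" using cos_less_one \<phi> by (auto simp: h_def)
  have eqs: "sin s / (1 - cos pi) * f (sig (cos pi) s) = ?gs s" if s: "s \<in> {0<..<pi}" for s
  proof -
    define y where "y = sig (-1) s"
    have y: "0 < y" "y < 1" using sig_pos[of s pi] sig_less_one[of s pi] s by (auto simp: y_def)
    have "sin s / (1 - cos pi) * (y powr (real 0 - 1/2) * (1 - y) powr real 0 * (2 / (1 - cos pi) - y) powr (real 0 - 1/2)) = 1"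
      using sj_weight_sig[of pi s 0 0] s by (simp add: y_def wt_def)
    thus ?thesis using y by (simp add: f_def y_def mult_ac)
  qed
  have eqx: "sin x / (1 - cos \<phi>) * f (sig (cos \<phi>) x) = ?gx x" if x: "x \<in> {0<..<\<phi>}" for x
  proof -
    define y where "y = sig h x"
    have y: "0 < y" "y < 1" using sig_pos[of x \<phi>] sig_less_one[of x \<phi>] x \<phi> by (auto simp: y_def h_def)
    have "2 / (1 - h) \<ge> 1" using h cos_ge_minus_one[of \<phi>] by (simp add: h_def)
    hence t: "2 / (1 - h) - y > 0" using y by simp
    have w: "sin x / (1 - h) * (y powr (-1/2) * (2 / (1 - h) - y) powr (-1/2)) = 1"
      using sj_weight_sig[OF \<phi>(1) \<phi>' x, of 0 0] y by (simp add: y_def wt_def h_def)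
    have sq: "z powr (-1/2) * sqrt z = 1" "z * z powr (-1/2) = sqrt z" if "z > 0" for z
    proof -
      have "z powr (-1/2) = 1 / sqrt z"
        using that powr_minus_divide[of z "1/2"] powr_half_sqrt[of z] by simp
      thus "z powr (-1/2) * sqrt z = 1" "z * z powr (-1/2) = sqrt z" using that by (simp_all add: real_div_sqrt)
    qed
    have "sin x / (1 - h) * f y = G y * ((1 - y) * (1 - y) powr (-1/2)) * (sin x / (1 - h) * y powr (-1/2))"
      by (simp add: f_def mult_ac)
    also have "\<dots> = G y * sqrt (1 - y) * (sin x / (1 - h) * y powr (-1/2) * ((2 / (1 - h) - y) powr (-1/2) * sqrt (2 / (1 - h) - y)))"
      using sq[OF t] sq[of "1 - y"] y by simp
    also have "\<dots> = G y * sqrt (1 - y) * sqrt (2 / (1 - h) - y) * (sin x / (1 - h) * (y powr (-1/2) * (2 / (1 - h) - y) powr (-1/2)))"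
      by (simp only: mult_ac)
    finally show ?thesis unfolding w by (simp add: y_def h_def mult_ac)
  qed
  have "continuous_on {-pi..pi} (\<lambda>s. G (sig (cos pi) s))" by (rule continuous_comp_sig[OF G]) auto
  hence cs: "continuous_on {0..pi} ?gs"
    by (intro continuous_intros continuous_sig) (auto intro: continuous_on_subset)
  have "continuous_on {-\<phi>..\<phi>} (\<lambda>x. G (sig h x))" unfolding h_def by (rule continuous_comp_sig[OF G \<phi>(1) \<phi>'])
  hence cx: "continuous_on {0..\<phi>} ?gx"
    by (intro continuous_intros continuous_sig) (auto intro: continuous_on_subset)
  have "(\<lambda>x. sin x / (1 - cos \<phi>) * f (sig (cos \<phi>) x)) absolutely_integrable_on {0<..<\<phi>} \<longleftrightarrow> ?gx absolutely_integrable_on {0<..<\<phi>}"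
    using eqx by (intro absolutely_integrable_spike_eq[of "{}"]) (simp_all del: times_divide_eq_left)
  moreover have "integral {0<..<\<phi>} (\<lambda>x. sin x / (1 - cos \<phi>) * f (sig (cos \<phi>) x)) = integral {0<..<\<phi>} ?gx"
    by (intro integral_cong) (simp only: eqx)
  ultimately have 1: "f absolutely_integrable_on {0<..<1} \<and> integral {0<..<1} f = integral {0..\<phi>} ?gx"
    using sig_change_of_variables[OF \<phi>(1) \<phi>', of f "integral {0..\<phi>} ?gx"]
      continuous_imp_abs_integrable_open[OF cx] by auto
  have "integral {0<..<pi} (\<lambda>s. sin s / (1 - cos pi) * f (sig (cos pi) s)) = integral {0<..<pi} ?gs"
    by (intro integral_cong) (simp only: eqs)
  thus ?thesis
    using sig_change_of_variables[of pi f "integral {0..\<phi>} ?gx"] 1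
      continuous_imp_abs_integrable_open[OF cs] by auto
qed

section \<open>From convergence in norm to pointwise convergence\<close>

context arc_weight
begin

text \<open>The factors \<open>y ^ e * (1 - y)\<close> compensate the degeneration of the weight.
  The supremum is bounded by an integral over the half circle, which moves to the element and is
  squared by Cauchy-Schwarz; the factor \<open>sqrt (1 - \<sigma>)\<close> then becomes the
  \<open>1 - \<sigma>\<close> of the weight with \<open>b = 1\<close>.\<close>

lemma Nikolskii:
  assumes b: "b = 1" and e: "e \<le> 1"
  shows "\<exists>C\<ge>0. \<forall>p m. degree p \<le> m \<longrightarrow> (\<forall>y\<in>{0..1}. \<bar>y ^ e * ((1 - y) * poly p y)\<bar> \<le> C * real (m + 3) * sqrt (ip (poly p) (poly p)))"
proof -
  define h where "h = cos \<phi>"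
  define \<tau> where "\<tau> = 2 / (1 - h)"
  \<comment> \<open>For \<open>x\<close> in the half element
    \<open>(1 - cos x) / sin x = tan (x / 2)\<close> is at most \<open>1 / cos (\<phi> / 2)\<close>,
    which compares \<sigma> with the sine in the weight.\<close>
  define K where "K = (1 / cos (\<phi> / 2)) ^ (2 * e)"
  have h: "h < 1" using cos_less_one \<phi> by (auto simp: h_def)
  have cp: "cos (\<phi> / 2) > 0" using \<phi> by (intro cos_gt_zero) auto
  have \<tau>: "\<tau> > 0" using h by (simp add: \<tau>_def)
  have sK: "(sig h x) ^ (2 * e) \<le> K * (sin x / (1 - h)) ^ (2 * e)" if x: "x \<in> {0..\<phi>}" for x
  proof -
    have s: "sin (x / 2) \<ge> 0" using x \<phi> by (intro sin_ge_zero) auto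
    have "1 - cos x = 2 * (sin (x / 2))\<^sup>2" using cos_double_sin[of "x / 2"] by simp
    moreover have "sin x = 2 * sin (x / 2) * cos (x / 2)" using sin_double[of "x / 2"] by simp
    moreover have "sin (x / 2) * cos (\<phi> / 2) \<le> 1 * cos (x / 2)"
      using x \<phi> by (intro mult_mono cos_monotone_0_pi_le) (auto intro: cos_ge_zero s)
    hence "sin (x / 2) * (sin (x / 2) * cos (\<phi> / 2)) \<le> sin (x / 2) * cos (x / 2)"
      using s by (intro mult_left_mono) auto
    ultimately have "(1 - cos x) * cos (\<phi> / 2) \<le> sin x" by (simp add: power2_eq_square)
    hence "1 - cos x \<le> 1 / cos (\<phi> / 2) * sin x" using cp by (simp add: pos_le_divide_eq)
    hence "(1 - cos x) / (1 - h) \<le> 1 / cos (\<phi> / 2) * sin x / (1 - h)" using h by (intro divide_right_mono) auto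
    moreover have "sig h x = (1 - cos x) / (1 - h)" unfolding sig_def by (metis minus_diff_eq minus_divide_divide)
    ultimately have "sig h x \<le> 1 / cos (\<phi> / 2) * (sin x / (1 - h))" by simp
    moreover have "0 \<le> sig h x" using sig_bounds[of x \<phi>] x \<phi> by (simp add: h_def)
    ultimately have "(sig h x) ^ (2 * e) \<le> (1 / cos (\<phi> / 2) * (sin x / (1 - h))) ^ (2 * e)" by (intro power_mono)
    thus ?thesis by (simp only: K_def power_mult_distrib)
  qed
  define C where "C = 2 / pi * sqrt (\<phi> * (\<tau> * K))"
  have K0: "K \<ge> 0" using cp by (simp add: K_def)
  have "\<bar>y ^ e * ((1 - y) * poly p y)\<bar> \<le> C * real (m + 3) * sqrt (ip (poly p) (poly p))"
    if p: "degree p \<le> m" and y: "y \<in> {0..1}" for p m y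
  proof -
    \<comment> \<open>The substitution \<open>y = (1 - cos s) / 2\<close> makes this a cosine
      polynomial. The extra factors raise its degree to at most \<open>m + 2\<close>, so it has
      \<open>m + 3\<close> coefficients.\<close>
    define q where "q = pcompose ([:0, 1:] ^ e * ([:1, -1:] * p)) [:1/2, -1/2:]"
    define G where "G y = \<bar>y ^ e * poly p y\<bar>" for y
    have G: "continuous_on {0..1} G" unfolding G_def by (intro continuous_intros)
    have "degree ([:0, 1:] ^ e * ([:1, -1:] * p)) \<le> e + (1 + m)"
    proof -
      have "degree ([:0, 1 :: real:] ^ e) \<le> e" by (metis degree_linear_power dual_order.refl)
      moreover have "degree ([:1, -1:] * p) \<le> 1 + m"
        using p degree_mult_le[of "[:1, -1:]" p] by simp
      ultimately show ?thesis by (meson add_mono degree_mult_le order_trans)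
    qed
    hence "degree q \<le> m + 2" unfolding q_def using e by (simp add: degree_pcompose)
    note sup = poly_cos_sup_le_integral[OF this, of "arccos (1 - 2 * y)"]
    have pq: "poly q \<xi> = ((1 - \<xi>) / 2) ^ e * ((1 - (1 - \<xi>) / 2) * poly p ((1 - \<xi>) / 2))" for \<xi>
    proof -
      have "1 / 2 + \<xi> * (- 1 / 2) = (1 - \<xi>) / 2" by (simp add: field_simps)
      hence "poly [:1/2, -1/2:] \<xi> = (1 - \<xi>) / 2" by simp
      moreover have "poly ([:0, 1:] ^ e * ([:1, -1:] * p)) z = z ^ e * ((1 - z) * poly p z)" for z
        by (simp add: poly_power left_diff_distrib)
      ultimately show ?thesis unfolding q_def poly_pcompose by (simp only:)
    qed
    have qy: "poly q (cos (arccos (1 - 2 * y))) = y ^ e * ((1 - y) * poly p y)" using y by (simp add: pq)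
    have "integral {0..pi} (\<lambda>s. \<bar>poly q (cos s)\<bar>) = integral {0..pi} (\<lambda>s. G (sig (-1) s) * (1 - sig (-1) s))"
    proof (intro integral_cong)
      fix s assume "s \<in> {0..pi}"
      hence "sig (-1) s \<le> 1" using sig_bounds[of s pi] by simp
      moreover have "(1 - cos s) / 2 = sig (-1) s" by (simp add: sig_def field_simps)
      ultimately show "\<bar>poly q (cos s)\<bar> = G (sig (-1) s) * (1 - sig (-1) s)"
        by (simp add: pq G_def abs_mult)
    qed
    also have "\<dots> = integral {0..\<phi>} (\<lambda>x. 1 * (G (sig h x) * (sqrt (\<tau> - sig h x) * sqrt (1 - sig h x))))"
      using sig_change_to_half_circle[OF \<phi> G] by (simp add: h_def \<tau>_def)
    also have "\<dots> \<le> sqrt (\<phi> * (\<tau> * (K * ip (poly p) (poly p))))"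
    proof (rule real_le_rsqrt)
      let ?g = "\<lambda>x. G (sig h x) * (sqrt (\<tau> - sig h x) * sqrt (1 - sig h x))"
      have cg: "continuous_on {0..\<phi>} ?g"
        using cont_sig[OF G] by (intro continuous_intros continuous_sig) (simp_all add: h_def)
      have "(integral {0..\<phi>} (\<lambda>x. 1 * ?g x))\<^sup>2 \<le> integral {0..\<phi>} (\<lambda>x. 1\<^sup>2) * integral {0..\<phi>} (\<lambda>x. (?g x)\<^sup>2)"
        by (intro integral_Cauchy_Schwarz cg continuous_intros)
      also have "integral {0..\<phi>} (\<lambda>x. 1\<^sup>2 :: real) = \<phi>" using \<phi> by simp
      also have "integral {0..\<phi>} (\<lambda>x. (?g x)\<^sup>2) \<le> \<tau> * (K * ip (poly p) (poly p))"
      proof (rule has_integral_le)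
        show "((\<lambda>x. (?g x)\<^sup>2) has_integral integral {0..\<phi>} (\<lambda>x. (?g x)\<^sup>2)) {0..\<phi>}"
          by (intro integrable_integral integrable_continuous_real continuous_intros cg)
        show "((\<lambda>x. \<tau> * (K * (poly p (sig (cos \<phi>) x) * poly p (sig (cos \<phi>) x) * wt (cos \<phi>) e b x))) has_integral
            \<tau> * (K * ip (poly p) (poly p))) {0..\<phi>}"
          by (intro has_integral_mult_right has_integral_ip) auto
        fix x assume x: "x \<in> {0..\<phi>}"
        define z where "z = sig h x"
        have z: "0 \<le> z" "z \<le> 1" using sig_bounds[of x \<phi>] x \<phi> by (auto simp: z_def h_def)
        have "1 \<le> \<tau>" using h cos_ge_minus_one[of \<phi>] by (simp add: \<tau>_def h_def)
        hence tz: "0 \<le> \<tau> - z" using z by simp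
        have "(?g x)\<^sup>2 = z ^ (2 * e) * (poly p z)\<^sup>2 * ((\<tau> - z) * (1 - z))"
          using tz z unfolding z_def[symmetric]
          by (simp add: G_def power_mult_distrib abs_mult flip: power_mult) (simp add: mult.commute)
        also have "\<dots> \<le> (K * (sin x / (1 - h)) ^ (2 * e)) * (poly p z)\<^sup>2 * (\<tau> * (1 - z))"
          using sK[OF x] z tz K0 h by (intro mult_mono) (auto simp: z_def)
        also have "\<dots> = \<tau> * (K * (poly p z * poly p z * ((1 - z) * (sin x / (1 - h)) ^ (2 * e))))"
          by (simp only: power2_eq_square mult_ac)
        finally show "(?g x)\<^sup>2 \<le> \<tau> * (K * (poly p (sig (cos \<phi>) x) * poly p (sig (cos \<phi>) x) * wt (cos \<phi>) e b x))"
          by (simp add: wt_def b z_def h_def)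
      qed
      finally show "(integral {0..\<phi>} (\<lambda>x. 1 * ?g x))\<^sup>2 \<le> \<phi> * (\<tau> * (K * ip (poly p) (poly p)))"
        using \<phi> by simp
    qed
    also have "\<dots> = sqrt (\<phi> * (\<tau> * K)) * sqrt (ip (poly p) (poly p))"
      by (simp add: mult.assoc flip: real_sqrt_mult)
    finally have int: "integral {0..pi} (\<lambda>s. \<bar>poly q (cos s)\<bar>) \<le> sqrt (\<phi> * (\<tau> * K)) * sqrt (ip (poly p) (poly p))" .
    have "\<bar>y ^ e * ((1 - y) * poly p y)\<bar> \<le> real (m + 2 + 1) * (2 / pi * (sqrt (\<phi> * (\<tau> * K)) * sqrt (ip (poly p) (poly p))))"
      using sup unfolding qy by (rule order_trans) (intro mult_left_mono int, auto)
    also have "\<dots> = C * real (m + 3) * sqrt (ip (poly p) (poly p))" by (simp add: C_def algebra_simps)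
    finally show ?thesis .
  qed
  moreover have "C \<ge> 0" using \<phi> \<tau> K0 by (simp add: C_def)
  ultimately show ?thesis by blast
qed

text \<open>The inequality needs a polynomial, so it is applied to the difference \<open>d\<close>
  between the partial sum and the uniform approximant of the same degree; the approximant itself
  converges uniformly. The bound is a multiple of \<open>m / \<rho> ^ m\<close> plus a multiple of
  \<open>1 / \<rho> ^ m\<close>.\<close>

lemma psum_tendsto:
  assumes b: "b = 1" and e: "e \<le> 1" and f: "rapprox \<rho> f" "\<rho> > 1" and y: "y \<in> {0..1}"
  shows "(\<lambda>N. y ^ e * ((1 - y) * poly (psum f N) y)) \<longlonglongrightarrow> y ^ e * ((1 - y) * f y)"
proof -
  have cont_f: "continuous_on {0..1} f" using rapprox_continuous f by blast
  obtain A p where p: "\<And>m. degree (p m) \<le> m" "\<And>m y. y \<in> {0..1} \<Longrightarrow> \<bar>f y - poly (p m) y\<bar> \<le> A / \<rho> ^ m"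
    using f(1) unfolding rapprox_def by metis
  have A: "A \<ge> 0" using p(2)[of 0 0] by simp
  obtain C where C: "C \<ge> 0" "\<And>p m y. degree p \<le> m \<Longrightarrow> y \<in> {0..1} \<Longrightarrow>
      \<bar>y ^ e * ((1 - y) * poly p y)\<bar> \<le> C * real (m + 3) * sqrt (ip (poly p) (poly p))"
    using Nikolskii[OF b e] by metis
  define L where "L = 2 * A * sqrt nrm"
  have bound: "\<bar>y ^ e * ((1 - y) * poly (psum f (Suc m)) y) - y ^ e * ((1 - y) * f y)\<bar> \<le>
      (C * L) * (real m * inverse \<rho> ^ m) + (3 * C * L + A) * inverse \<rho> ^ m" for m
  proof -
    define u where "u = (\<lambda>y. f y - poly (psum f (Suc m)) y)"
    define v where "v = (\<lambda>y. f y - poly (p m) y)"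
    define d where "d = psum f (Suc m) - p m"
    have cu: "continuous_on {0..1} u" "continuous_on {0..1} v" unfolding u_def v_def by (intro continuous_intros cont_f)+
    have dd: "degree d \<le> m" unfolding d_def using degree_psum[of "Suc m" f] p(1)[of m] by (intro degree_diff_le) auto
    have uv: "ip u u \<le> ip v v" unfolding u_def v_def using p(1)[of m] by (intro psum_best cont_f) auto
    have "ip v v \<le> ip (\<lambda>_. A / \<rho> ^ m) (\<lambda>_. A / \<rho> ^ m)"
    proof (intro ip_mono cu continuous_intros)
      show "\<bar>v y\<bar> \<le> \<bar>A / \<rho> ^ m\<bar>" if "y \<in> {0..1}" for y
        using p(2)[OF that, of m] unfolding v_def by linarith
    qed
    also have "\<dots> = (A / \<rho> ^ m)\<^sup>2 * nrm"
      using ip_cmult[of "A / \<rho> ^ m" "\<lambda>_. 1" "\<lambda>_. A / \<rho> ^ m"] ip_cmult[of "A / \<rho> ^ m" "\<lambda>_. 1" "\<lambda>_. 1"]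
        ip_commute[of "\<lambda>_. 1" "\<lambda>_. A / \<rho> ^ m"] by (simp add: nrm_def power2_eq_square)
    finally have vv: "ip v v \<le> (A / \<rho> ^ m)\<^sup>2 * nrm" .
    have "poly d = (\<lambda>y. v y - u y)" by (auto simp: d_def u_def v_def)
    \<comment> \<open>The parallelogram law, with the norm of \<open>v + u\<close> dropped.\<close>
    hence "ip (poly d) (poly d) \<le> 2 * ip v v + 2 * ip u u"
    proof -
      have c: "continuous_on {0..1} (\<lambda>y. v y - u y)" "continuous_on {0..1} (\<lambda>y. v y + u y)"
        using cu by (auto intro: continuous_on_diff continuous_on_add)
      have "ip (\<lambda>y. v y - u y) (\<lambda>y. v y - u y) = ip v v - ip u v - (ip v u - ip u u)"
        using ip_diff[OF cu(2,1) c(1)] ip_diff[OF cu(2,1) cu(2)] ip_diff[OF cu(2,1) cu(1)]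
          ip_commute[of v "\<lambda>y. v y - u y"] ip_commute[of u "\<lambda>y. v y - u y"] by simp
      moreover have "0 \<le> ip (\<lambda>y. v y + u y) (\<lambda>y. v y + u y)" by (rule ip_nonneg[OF c(2)])
      moreover have "ip (\<lambda>y. v y + u y) (\<lambda>y. v y + u y) = ip v v + ip u v + (ip v u + ip u u)"
        using ip_add[OF cu(2,1) c(2)] ip_add[OF cu(2,1) cu(2)] ip_add[OF cu(2,1) cu(1)]
          ip_commute[of v "\<lambda>y. v y + u y"] ip_commute[of u "\<lambda>y. v y + u y"] by simp
      ultimately show ?thesis unfolding \<open>poly d = _\<close> by linarith
    qed
    also have "\<dots> \<le> (L / \<rho> ^ m)\<^sup>2"
    proof -
      have "(L / \<rho> ^ m)\<^sup>2 = 4 * ((A / \<rho> ^ m)\<^sup>2 * nrm)"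
        using nrm_pos by (simp add: L_def power_mult_distrib power_divide)
      thus ?thesis using uv vv by linarith
    qed
    finally have "sqrt (ip (poly d) (poly d)) \<le> L / \<rho> ^ m"
      using A nrm_pos f(2) by (intro real_le_lsqrt) (auto simp: L_def intro: ip_nonneg)
    hence "C * real (m + 3) * sqrt (ip (poly d) (poly d)) \<le> C * real (m + 3) * (L / \<rho> ^ m)"
      using C(1) by (intro mult_left_mono) auto
    hence 1: "\<bar>y ^ e * ((1 - y) * poly d y)\<bar> \<le> C * real (m + 3) * (L / \<rho> ^ m)"
      using C(2)[OF dd y] by linarith
    have ye: "0 \<le> y ^ e * (1 - y)" "y ^ e * (1 - y) \<le> 1" using y by (auto intro: mult_le_one power_le_one)
    have "\<bar>y ^ e * (1 - y) * v y\<bar> \<le> 1 * (A / \<rho> ^ m)"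
      unfolding abs_mult using ye p(2)[OF y, of m] by (intro mult_mono) (auto simp: v_def abs_mult)
    hence 2: "\<bar>y ^ e * ((1 - y) * v y)\<bar> \<le> A / \<rho> ^ m" by (simp only: mult.assoc mult_1)
    have "y ^ e * ((1 - y) * poly (psum f (Suc m)) y) - y ^ e * ((1 - y) * f y) =
        y ^ e * ((1 - y) * poly d y) - y ^ e * ((1 - y) * v y)"
      by (simp add: d_def v_def algebra_simps)
    hence "\<bar>y ^ e * ((1 - y) * poly (psum f (Suc m)) y) - y ^ e * ((1 - y) * f y)\<bar> \<le> C * real (m + 3) * (L / \<rho> ^ m) + A / \<rho> ^ m"
      using 1 2 by linarith
    also have "\<dots> = (C * L) * (real m * inverse \<rho> ^ m) + (3 * C * L + A) * inverse \<rho> ^ m"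
      by (simp add: divide_inverse power_inverse algebra_simps)
    finally show ?thesis .
  qed
  have "norm (inverse \<rho>) < 1" using f(2) by (simp add: inverse_less_1_iff)
  hence "(\<lambda>m. (C * L) * (real m * inverse \<rho> ^ m) + (3 * C * L + A) * inverse \<rho> ^ m) \<longlonglongrightarrow> (C * L) * 0 + (3 * C * L + A) * 0"
    by (intro tendsto_intros powser_times_n_limit_0 LIMSEQ_power_zero)
  hence "(\<lambda>m. (C * L) * (real m * inverse \<rho> ^ m) + (3 * C * L + A) * inverse \<rho> ^ m) \<longlonglongrightarrow> 0" by simp
  hence "(\<lambda>m. y ^ e * ((1 - y) * poly (psum f (Suc m)) y) - y ^ e * ((1 - y) * f y)) \<longlonglongrightarrow> 0"
    by (rule Lim_null_comparison[rotated]) (auto intro!: always_eventually simp only: real_norm_def bound)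
  hence "(\<lambda>m. y ^ e * ((1 - y) * poly (psum f (Suc m)) y)) \<longlonglongrightarrow> y ^ e * ((1 - y) * f y)"
    by (simp add: LIM_zero_iff)
  thus ?thesis using LIMSEQ_imp_Suc[of "\<lambda>N. y ^ e * ((1 - y) * poly (psum f N) y)"] by blast
qed

text \<open>For fixed \<open>x\<close>, exchanging \<open>\<sigma> ^ e\<close> for
  \<open>sin x ^ e\<close> multiplies the sequence by a constant. Only \<open>x = 0\<close> with
  \<open>e = 1\<close> has no such constant, and there everything is zero.\<close>

lemma arc_psum_tendsto:
  assumes b: "b = 1" and e: "e \<le> 1" and f: "rapprox \<rho> f" "\<rho> > 1" and x: "\<bar>x\<bar> \<le> \<phi>"
  shows "(\<lambda>N. sin x ^ e * ((1 - sig (cos \<phi>) x) * poly (psum f N) (sig (cos \<phi>) x)))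
    \<longlonglongrightarrow> sin x ^ e * ((1 - sig (cos \<phi>) x) * f (sig (cos \<phi>) x))"
proof (cases "e = 1 \<and> x = 0")
  case False
  define y where "y = sig (cos \<phi>) x"
  have y: "y \<in> {0..1}" using sig_bounds[OF x] \<phi> by (simp add: y_def)
  have ye: "y ^ e \<noteq> 0" using False e sig_pos[of x \<phi>] x \<phi> by (cases "e = 0") (auto simp: y_def)
  have "sin x ^ e / y ^ e * (y ^ e * c) = sin x ^ e * c" for c using ye by (simp del: power_eq_0_iff)
  with tendsto_mult_left[OF psum_tendsto[OF b e f y], of "sin x ^ e / y ^ e"]
  show ?thesis unfolding y_def by (simp only:)
qed simp

end

subsection \<open>Expansions on a grid, \<open>b = 0\<close>\<close>

context arc_weight begin

lemma ip_zero_left [simp]: "ip (\<lambda>_. 0) g = 0"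
  using ip_cmult[of 0 "\<lambda>_. 0" g] by simp

lemma coeff_of_cong: "(\<And>y. y \<in> {0..1} \<Longrightarrow> f y = f' y) \<Longrightarrow> coeff_of f k = coeff_of f' k"
  unfolding coeff_of_def using ip_cong[of f f' "poly (fam k)" "poly (fam k)"] by simp

lemma coeff_of_add: "continuous_on {0..1} f \<Longrightarrow> continuous_on {0..1} f' \<Longrightarrow> coeff_of (\<lambda>y. f y + f' y) k = coeff_of f k + coeff_of f' k"
  by (simp add: coeff_of_def ip_add add_divide_distrib)

lemma coeff_of_cmult: "coeff_of (\<lambda>y. c * f y) k = c * coeff_of f k"
  by (simp add: coeff_of_def ip_cmult)

lemma coeff_of_sum:
  "finite A \<Longrightarrow> (\<And>j. j \<in> A \<Longrightarrow> continuous_on {0..1} (f j)) \<Longrightarrow> coeff_of (\<lambda>y. \<Sum>j\<in>A. f j y) k = (\<Sum>j\<in>A. coeff_of (f j) k)"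
  by (simp add: coeff_of_def ip_sum sum_divide_distrib)

lemma coeff_of_fam: "coeff_of (poly (fam j)) k = (if j = k then 1 else 0)"
  using nrm_pos by (simp add: coeff_of_def ip_fam)

end

text \<open>The bridge between the two families: a factor \<open>1 - y\<close> may be counted with
  the function or with the weight.\<close>

lemma ip_shift_weight:
  assumes "arc_weight \<phi>"
  shows "arc_weight.ip \<phi> e (Suc 0) f g = arc_weight.ip \<phi> e 0 (\<lambda>y. (1 - y) * f y) g"
  by (simp add: arc_weight.ip_def[OF assms] wt_def mult_ac)

lemma has_integral_symmetric_interval:
  fixes k :: "real \<Rightarrow> real"
  assumes k: "continuous_on {-\<phi>..\<phi>} k" and \<phi>: "\<phi> > 0"
    and S: "((\<lambda>t. k t + k (- t)) has_integral S) {0..\<phi>}"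
  shows "(k has_integral S) {-\<phi>..\<phi>}"
proof -
  have ic: "k integrable_on {-\<phi>..0}" "k integrable_on {0..\<phi>}"
    using k \<phi> by (auto intro!: integrable_continuous_real elim: continuous_on_subset)
  then obtain a b where ab: "(k has_integral a) {-\<phi>..0}" "(k has_integral b) {0..\<phi>}"
    unfolding integrable_on_def by blast
  have "((\<lambda>t. k (- t)) has_integral a) {0..\<phi>}"
    using ab(1) has_integral_reflect_real[of k a 0 "-\<phi>"] by simp
  hence "((\<lambda>t. k t + k (- t)) has_integral b + a) {0..\<phi>}" by (intro has_integral_add ab)
  hence "S = b + a" using S has_integral_unique by blast
  moreover have "(k has_integral a + b) {-\<phi>..\<phi>}" using \<phi> ab by (intro has_integral_combine[of "-\<phi>" 0 \<phi>]) auto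
  ultimately show ?thesis by (simp add: add.commute)
qed

text \<open>Adding the values at \<open>x\<close> and \<open>-x\<close> cancels the products of an
  even and an odd part. The factor 2 counts the two halves, and
  \<open>(1 - cos \<phi>) ^ (2 * e)\<close> undoes the scaling of the sine in
  \<open>wt\<close>.\<close>

lemma (in arc_weight) has_integral_even_odd:
  assumes A: "\<And>e. continuous_on {0..1} (A e)" and B: "\<And>e. continuous_on {0..1} (B e)"
  defines "s \<equiv> sig (cos \<phi>)"
  shows "((\<lambda>x. (\<Sum>e<2. sin x ^ e * A e (s x)) * (\<Sum>e<2. sin x ^ e * B e (s x)) * (1 - s x) ^ b) has_integral
     (\<Sum>e<2. 2 * (1 - cos \<phi>) ^ (2 * e) * arc_weight.ip \<phi> e b (A e) (B e))) {-\<phi>..\<phi>}"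
proof (rule has_integral_symmetric_interval)
  have h: "1 - cos \<phi> \<noteq> 0" using cos_less_one[of \<phi>] \<phi> by simp
  have "continuous_on {-\<phi>..\<phi>} (\<lambda>x. A e (s x))" "continuous_on {-\<phi>..\<phi>} (\<lambda>x. B e (s x))" for e
    unfolding s_def using \<phi> by (auto intro!: continuous_comp_sig A B)
  thus "continuous_on {-\<phi>..\<phi>} (\<lambda>x. (\<Sum>e<2. sin x ^ e * A e (s x)) * (\<Sum>e<2. sin x ^ e * B e (s x)) * (1 - s x) ^ b)"
    unfolding s_def by (intro continuous_intros continuous_sig)
  show "\<phi> > 0" by (rule \<phi>)
  have "((\<lambda>x. \<Sum>e<2. 2 * (1 - cos \<phi>) ^ (2 * e) * (A e (s x) * B e (s x) * wt (cos \<phi>) e b x)) has_integral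
     (\<Sum>e<2. 2 * (1 - cos \<phi>) ^ (2 * e) * arc_weight.ip \<phi> e b (A e) (B e))) {0..\<phi>}"
    unfolding s_def using arc_weight.has_integral_ip[OF arc_weight_axioms]
    by (intro has_integral_sum has_integral_mult_right) (auto simp: A B)
  moreover have "(\<Sum>e<2. 2 * (1 - cos \<phi>) ^ (2 * e) * (A e (s x) * B e (s x) * wt (cos \<phi>) e b x)) =
      (\<Sum>e<2. sin x ^ e * A e (s x)) * (\<Sum>e<2. sin x ^ e * B e (s x)) * (1 - s x) ^ b +
      (\<Sum>e<2. sin (- x) ^ e * A e (s (- x))) * (\<Sum>e<2. sin (- x) ^ e * B e (s (- x))) * (1 - s (- x)) ^ b" for x
  proof -
    have "(1 - cos \<phi>)\<^sup>2 * (sin x / (1 - cos \<phi>))\<^sup>2 = (sin x)\<^sup>2" using h by (simp add: power_divide)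
    hence w: "(1 - cos \<phi>)\<^sup>2 * wt (cos \<phi>) (Suc 0) b x = (1 - s x) ^ b * (sin x)\<^sup>2"
      by (simp add: wt_def s_def mult.left_commute)
    have "(\<Sum>e<2. 2 * (1 - cos \<phi>) ^ (2 * e) * (A e (s x) * B e (s x) * wt (cos \<phi>) e b x)) =
      2 * (A 0 (s x) * B 0 (s x) * wt (cos \<phi>) 0 b x) + 2 * (A 1 (s x) * B 1 (s x)) * ((1 - cos \<phi>)\<^sup>2 * wt (cos \<phi>) (Suc 0) b x)"
      by (simp add: numeral_2_eq_2 mult_ac)
    also have "\<dots> = 2 * (A 0 (s x) * B 0 (s x) * (1 - s x) ^ b) + 2 * (A 1 (s x) * B 1 (s x)) * ((1 - s x) ^ b * (sin x)\<^sup>2)"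
      unfolding w by (simp add: wt_def s_def)
    finally show ?thesis by (simp add: s_def numeral_2_eq_2 algebra_simps)
  qed
  ultimately show "((\<lambda>x. (\<Sum>e<2. sin x ^ e * A e (s x)) * (\<Sum>e<2. sin x ^ e * B e (s x)) * (1 - s x) ^ b +
      (\<Sum>e<2. sin (- x) ^ e * A e (s (- x))) * (\<Sum>e<2. sin (- x) ^ e * B e (s (- x))) * (1 - s (- x)) ^ b) has_integral
     (\<Sum>e<2. 2 * (1 - cos \<phi>) ^ (2 * e) * arc_weight.ip \<phi> e b (A e) (B e))) {0..\<phi>}"
    by (simp only:)
qed

text \<open>\<open>lab e i k\<close> is the basis function of element \<open>i\<close> that carries \<open>sin\<^sup>e\<close> and the orthogonal
  polynomial of degree \<open>k\<close> for \<open>b = 0\<close>; hence the shift from \<open>q\<^sub>k\<close>.\<close>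

definition lab :: "nat \<Rightarrow> nat \<Rightarrow> nat \<Rightarrow> label" where
  "lab e i k = (if e = 0 then Ev i k else Od i (Suc k))"

lemma lab_inject: "e < 2 \<Longrightarrow> e' < 2 \<Longrightarrow> lab e i k = lab e' i' k' \<longleftrightarrow> e = e' \<and> i = i' \<and> k = k'"
  by (auto simp: lab_def less_2_cases_iff)

lemma labels0_eq: "labels0 n = {lab e i k | e i k. e < 2 \<and> i \<in> {1..n}}"
proof (intro equalityI subsetI)
  fix r assume "r \<in> labels0 n"
  then consider i k where "r = Ev i k" "i \<in> {1..n}" | i k where "r = Od i (Suc k)" "i \<in> {1..n}"
    by (auto simp: labels0_def Suc_le_eq gr0_conv_Suc)
  then show "r \<in> {lab e i k | e i k. e < 2 \<and> i \<in> {1..n}}"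
  proof cases
    case (1 i k)
    thus ?thesis by (intro CollectI exI[of _ 0] exI[of _ i] exI[of _ k]) (simp add: lab_def)
  next
    case (2 i k)
    thus ?thesis by (intro CollectI exI[of _ 1] exI[of _ i] exI[of _ k]) (simp add: lab_def)
  qed
next
  fix r assume "r \<in> {lab e i k | e i k. e < 2 \<and> i \<in> {1..n}}"
  then obtain e i k where "r = lab e i k" "i \<in> {1..n}" by blast
  thus "r \<in> labels0 n" by (cases "e = 0") (auto simp: labels0_def lab_def)
qed

text \<open>The hat functions take the place of the two degree-0 functions on each element. Beyond
  them, \<open>lab e i (Suc k)\<close> carries \<open>1 - \<sigma>\<close> times the
  degree-\<open>k\<close> polynomial for \<open>b = 1\<close>.\<close>

lemma labels1_eq: "labels1 n = Hat ` {1..n} \<union> {lab e i (Suc k) | e i k. e < 2 \<and> i \<in> {1..n}}"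
proof (intro equalityI subsetI)
  fix r assume "r \<in> labels1 n"
  then consider "r \<in> Hat ` {1..n}" | i k where "r = Ev i (Suc k)" "i \<in> {1..n}"
    | i k where "r = Od i (Suc (Suc k))" "i \<in> {1..n}"
  proof -
    have "1 \<le> k \<Longrightarrow> \<exists>j. k = Suc j" "2 \<le> k \<Longrightarrow> \<exists>j. k = Suc (Suc j)" for k :: nat by presburger+
    thus ?thesis using that \<open>r \<in> labels1 n\<close> unfolding labels1_def by blast
  qed
  then show "r \<in> Hat ` {1..n} \<union> {lab e i (Suc k) | e i k. e < 2 \<and> i \<in> {1..n}}"
  proof cases
    case (2 i k)
    thus ?thesis by (intro UnI2 CollectI exI[of _ 0] exI[of _ i] exI[of _ k]) (simp add: lab_def)
  next
    case (3 i k)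
    thus ?thesis by (intro UnI2 CollectI exI[of _ 1] exI[of _ i] exI[of _ k]) (simp add: lab_def)
  qed blast
next
  fix r assume "r \<in> Hat ` {1..n} \<union> {lab e i (Suc k) | e i k. e < 2 \<and> i \<in> {1..n}}"
  then consider j where "r = Hat j" "j \<in> {1..n}" | e i k where "r = lab e i (Suc k)" "i \<in> {1..n}" by blast
  thus "r \<in> labels1 n" by cases (auto simp: labels1_def lab_def)
qed

section \<open>Geometry of the grid and restriction to elements\<close>

locale arc_grid =
  fixes n :: nat and \<theta> :: "nat \<Rightarrow> real"
  assumes grid: "is_grid n \<theta>"
begin

lemma n2: "n \<ge> 2" and \<theta>1: "\<theta> 1 = - pi" and \<theta>n: "\<theta> (n + 1) = pi"
  using grid by (auto simp: is_grid_def)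

lemma \<theta>_less: "i \<in> {1..n+1} \<Longrightarrow> j \<in> {1..n+1} \<Longrightarrow> i < j \<Longrightarrow> \<theta> i < \<theta> j"
  using grid unfolding is_grid_def strict_mono_on_def by blast

lemma \<theta>_le: "i \<in> {1..n+1} \<Longrightarrow> j \<in> {1..n+1} \<Longrightarrow> i \<le> j \<Longrightarrow> \<theta> i \<le> \<theta> j"
  using \<theta>_less[of i j] by (cases "i = j") auto

lemma \<theta>_Suc: "i \<in> {1..n} \<Longrightarrow> \<theta> i < \<theta> (Suc i)"
  using \<theta>_less[of i "Suc i"] by auto

text \<open>With at least two elements none covers the whole circle, so \<open>h > -1\<close> on
  each.\<close>

lemma half_len_bounds:
  assumes i: "i \<in> {1..n}" shows "0 < half_len \<theta> i" "half_len \<theta> i < pi"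
proof -
  show "0 < half_len \<theta> i" using \<theta>_Suc[OF i] by (simp add: half_len_def)
  have "\<theta> 1 \<le> \<theta> i" "\<theta> (Suc i) \<le> \<theta> (n + 1)" using i by (auto intro!: \<theta>_le)
  moreover have "\<theta> 1 < \<theta> i \<or> \<theta> (Suc i) < \<theta> (n + 1)"
  proof (cases "i = 1")
    case True
    thus ?thesis using n2 \<theta>_less[of "Suc i" "n + 1"] by auto
  next
    case False
    thus ?thesis using i \<theta>_less[of 1 i] by auto
  qed
  ultimately show "half_len \<theta> i < pi" using \<theta>1 \<theta>n by (auto simp: half_len_def)
qed

lemma elem_arc_weight: "i \<in> {1..n} \<Longrightarrow> arc_weight (half_len \<theta> i)"
  using half_len_bounds by (intro arc_weight.intro)

definition sg :: "nat \<Rightarrow> real \<Rightarrow> real" where "sg i x = sig (elem_h \<theta> i) (loc \<theta> i x)"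
definition sn :: "nat \<Rightarrow> real \<Rightarrow> real" where "sn i x = sin (loc \<theta> i x)"
text \<open>The normal form on an element: even and odd part in the local angle, each a function of
  \<sigma>. Expansions, errors and basis functions are all compared in it.\<close>

definition parity_sum :: "(nat \<Rightarrow> real \<Rightarrow> real) \<Rightarrow> nat \<Rightarrow> real \<Rightarrow> real" where
  "parity_sum A i x = (\<Sum>e<2. sn i x ^ e * A e (sg i x))"

abbreviation elem_fam :: "nat \<Rightarrow> nat \<Rightarrow> nat \<Rightarrow> nat \<Rightarrow> real poly" where
  "elem_fam i e b \<equiv> arc_weight.fam (half_len \<theta> i) e b"

abbreviation elem_ip :: "nat \<Rightarrow> nat \<Rightarrow> nat \<Rightarrow> (real \<Rightarrow> real) \<Rightarrow> (real \<Rightarrow> real) \<Rightarrow> real" where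
  "elem_ip i e b \<equiv> arc_weight.ip (half_len \<theta> i) e b"

abbreviation elem_psum :: "nat \<Rightarrow> nat \<Rightarrow> nat \<Rightarrow> (real \<Rightarrow> real) \<Rightarrow> nat \<Rightarrow> real poly" where
  "elem_psum i e b \<equiv> arc_weight.psum (half_len \<theta> i) e b"

abbreviation elem_coeff :: "nat \<Rightarrow> nat \<Rightarrow> nat \<Rightarrow> (real \<Rightarrow> real) \<Rightarrow> nat \<Rightarrow> real" where
  "elem_coeff i e b \<equiv> arc_weight.coeff_of (half_len \<theta> i) e b"

abbreviation elem_sq_error :: "nat \<Rightarrow> nat \<Rightarrow> nat \<Rightarrow> (real \<Rightarrow> real) \<Rightarrow> nat \<Rightarrow> real" where
  "elem_sq_error i e b \<equiv> arc_weight.sq_error (half_len \<theta> i) e b"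

text \<open>At a grid point the basis functions of both adjacent elements may be nonzero, so
  pointwise identities are proved on open elements; integrals ignore the difference.\<close>

definition inner_elem :: "nat \<Rightarrow> real set" where "inner_elem i = {\<theta> i<..<\<theta> (Suc i)}"

lemma inner_elem_subset: "inner_elem i \<subseteq> elem \<theta> i"
  by (auto simp: inner_elem_def elem_def)

lemma loc_bounds: "x \<in> elem \<theta> i \<Longrightarrow> \<bar>loc \<theta> i x\<bar> \<le> half_len \<theta> i"
  by (auto simp: elem_def loc_def midpt_def half_len_def abs_le_iff field_simps)

lemma sg_bounds: "i \<in> {1..n} \<Longrightarrow> x \<in> elem \<theta> i \<Longrightarrow> sg i x \<in> {0..1}"
  unfolding sg_def elem_h_def using half_len_bounds[of i] by (intro sig_bounds loc_bounds) auto

lemma inner_elem_unique: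
  assumes i: "i \<in> {1..n}" and j: "j \<in> {1..n}" and x: "x \<in> inner_elem i"
  shows "x \<in> elem \<theta> j \<longleftrightarrow> j = i"
proof
  assume xj: "x \<in> elem \<theta> j"
  show "j = i"
  proof (rule ccontr)
    assume "j \<noteq> i"
    then consider "j < i" | "i < j" by linarith
    thus False
    proof cases
      case 1
      hence "\<theta> (Suc j) \<le> \<theta> i" using i j by (intro \<theta>_le) auto
      thus False using x xj by (auto simp: elem_def inner_elem_def)
    next
      case 2
      hence "\<theta> (Suc i) \<le> \<theta> j" using i j by (intro \<theta>_le) auto
      thus False using x xj by (auto simp: elem_def inner_elem_def)
    qed
  qed
qed (use x inner_elem_subset in auto)

lemma elem_cover:
  assumes "x \<in> {-pi..pi}" shows "\<exists>i\<in>{1..n}. x \<in> elem \<theta> i"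
proof -
  have "x \<in> {\<theta> 1..\<theta> (Suc j)} \<Longrightarrow> j \<in> {1..n} \<Longrightarrow> \<exists>i\<in>{1..j}. x \<in> elem \<theta> i" for j
  proof (induction j)
    case (Suc j)
    show ?case
    proof (cases "j \<ge> 1 \<and> x \<le> \<theta> (Suc j)")
      case True
      thus ?thesis using Suc by force
    next
      case False
      hence "x \<in> elem \<theta> (Suc j)" using Suc.prems by (cases "j = 0") (auto simp: elem_def)
      thus ?thesis by auto
    qed
  qed simp
  from this[of n] show ?thesis using assms n2 \<theta>1 \<theta>n by auto
qed

lemma basis0_lab:
  assumes i: "i \<in> {1..n}" and "x \<in> elem \<theta> i" "e < 2"
  shows "basis 0 n \<theta> (lab e i k) x = sn i x ^ e * poly (elem_fam i e 0 k) (sg i x)"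
proof -
  have "e = 0 \<or> e = 1" using assms by auto
  thus ?thesis using assms(2)
    by (auto simp: lab_def arc_p_def arc_q_def semiclassical_jacobi_def sn_def sg_def sig_def elem_h_def
        arc_weight.fam_def[OF elem_arc_weight[OF i]])
qed

lemma basis1_lab:
  assumes i: "i \<in> {1..n}" and "x \<in> elem \<theta> i" "e < 2"
  shows "basis (-1) n \<theta> (lab e i (Suc k)) x = sn i x ^ e * ((1 - sg i x) * poly (elem_fam i e 1 k) (sg i x))"
proof -
  have "e = 0 \<or> e = 1" using assms by auto
  thus ?thesis using assms(2)
    by (auto simp: lab_def arc_p_def arc_q_def semiclassical_jacobi_def sn_def sg_def sig_def elem_h_def
        arc_weight.fam_def[OF elem_arc_weight[OF i]] left_diff_distrib)
qed

lemma basis_lab_outside: "x \<notin> elem \<theta> i \<Longrightarrow> basis b n \<theta> (lab e i k) x = 0"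
  by (simp add: lab_def)

lemma has_integral_elem:
  assumes i: "i \<in> {1..n}" and A: "\<And>e. continuous_on {0..1} (A e)" and B: "\<And>e. continuous_on {0..1} (B e)"
    and f: "\<And>x. x \<in> inner_elem i \<Longrightarrow> f x = parity_sum A i x * parity_sum B i x * (1 - sg i x) ^ b"
  shows "(f has_integral (\<Sum>e<2. 2 * (1 - elem_h \<theta> i) ^ (2 * e) * elem_ip i e b (A e) (B e))) (elem \<theta> i)"
proof -
  let ?S = "(\<Sum>e<2. 2 * (1 - elem_h \<theta> i) ^ (2 * e) * elem_ip i e b (A e) (B e))"
  define g where "g x = parity_sum A i x * parity_sum B i x * (1 - sg i x) ^ b" for x
  have "((\<lambda>x. g (midpt \<theta> i + x)) has_integral ?S) {- half_len \<theta> i..half_len \<theta> i}"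
    using arc_weight.has_integral_even_odd[OF elem_arc_weight[OF i] A B, where b = b] by (simp add: g_def parity_sum_def sn_def sg_def loc_def elem_h_def)
  hence "(g has_integral ?S) {- half_len \<theta> i + midpt \<theta> i..half_len \<theta> i + midpt \<theta> i}"
    using has_integral_shift_Icc_real[of g "midpt \<theta> i" ?S "- half_len \<theta> i" "half_len \<theta> i"] by (simp add: comp_def)
  moreover have "{- half_len \<theta> i + midpt \<theta> i..half_len \<theta> i + midpt \<theta> i} = elem \<theta> i"
    by (simp add: elem_def half_len_def midpt_def field_simps)
  ultimately have "(g has_integral ?S) (elem \<theta> i)" by simp
  thus ?thesis
    by (rule has_integral_spike_finite[of "{\<theta> i, \<theta> (Suc i)}", rotated 2])
       (auto simp: g_def elem_def f inner_elem_def)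
qed

text \<open>The part of opposite parity is orthogonal to the basis function, and numerator and
  denominator share the factor \<open>2 * (1 - h) ^ (2 * e)\<close>, which cancels.\<close>

lemma coeffs0_parity_sum:
  assumes i: "i \<in> {1..n}" and A: "\<And>e. continuous_on {0..1} (A e)" and e: "e < 2"
    and f: "\<And>x. x \<in> inner_elem i \<Longrightarrow> f x = parity_sum A i x"
  shows "coeffs0 n \<theta> f (lab e i k) = elem_coeff i e 0 (A e) k"
proof -
  interpret arc_weight "half_len \<theta> i" e 0 by (rule elem_arc_weight[OF i])
  define h where "h = elem_h \<theta> i"
  have h: "h \<noteq> 1" using cos_less_one[of "half_len \<theta> i"] half_len_bounds[OF i] by (simp add: h_def elem_h_def)
  define B where "B e' y = (if e' = e then poly (fam k) y else 0)" for e' :: nat and y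
  have B: "continuous_on {0..1} (B e')" for e' unfolding B_def by (cases "e' = e") (auto intro: continuous_intros)
  have bas: "basis 0 n \<theta> (lab e i k) x = parity_sum B i x" if "x \<in> inner_elem i" for x
  proof -
    have x: "x \<in> elem \<theta> i" using that inner_elem_subset by auto
    have "parity_sum B i x = (\<Sum>e'<2. if e' = e then sn i x ^ e * poly (fam k) (sg i x) else 0)"
      unfolding parity_sum_def by (intro sum.cong) (auto simp: B_def)
    thus ?thesis using e basis0_lab[OF i x e] by (simp add: sum.delta)
  qed
  have sumB: "(\<Sum>e'<2. 2 * (1 - h) ^ (2 * e') * elem_ip i e' 0 (C e') (B e')) =
      2 * (1 - h) ^ (2 * e) * ip (C e) (poly (fam k))" if C: "\<And>e. continuous_on {0..1} (C e)" for C
  proof -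
    have "elem_ip i e' 0 (C e') (B e') = (if e' = e then ip (C e) (poly (fam k)) else 0)" for e'
      using arc_weight.ip_zero_left[OF elem_arc_weight[OF i], of e' 0 "C e'"] arc_weight.ip_commute[OF elem_arc_weight[OF i], of e' 0]
      by (auto simp: B_def[abs_def])
    hence "(\<Sum>e'<2. 2 * (1 - h) ^ (2 * e') * elem_ip i e' 0 (C e') (B e')) =
       (\<Sum>e'<2. if e' = e then 2 * (1 - h) ^ (2 * e) * ip (C e) (poly (fam k)) else 0)"
      by (intro sum.cong) auto
    thus ?thesis using e by simp
  qed
  have "((\<lambda>x. f x * basis 0 n \<theta> (lab e i k) x) has_integral
      (\<Sum>e'<2. 2 * (1 - elem_h \<theta> i) ^ (2 * e') * elem_ip i e' 0 (A e') (B e'))) (elem \<theta> i)"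
    by (rule has_integral_elem[OF i A B]) (simp add: f bas)
  hence 1: "integral (elem \<theta> i) (\<lambda>x. f x * basis 0 n \<theta> (lab e i k) x) = 2 * (1 - h) ^ (2 * e) * ip (A e) (poly (fam k))"
    unfolding h_def[symmetric] sumB[OF A] by (rule integral_unique)
  have "((\<lambda>x. (basis 0 n \<theta> (lab e i k) x)\<^sup>2) has_integral
      (\<Sum>e'<2. 2 * (1 - elem_h \<theta> i) ^ (2 * e') * elem_ip i e' 0 (B e') (B e'))) (elem \<theta> i)"
    by (rule has_integral_elem[OF i B B]) (simp add: bas power2_eq_square)
  hence 2: "integral (elem \<theta> i) (\<lambda>x. (basis 0 n \<theta> (lab e i k) x)\<^sup>2) = 2 * (1 - h) ^ (2 * e) * nrm"
    unfolding h_def[symmetric] sumB[OF B] by (simp add: integral_unique B_def[abs_def] ip_fam)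
  have "coeffs0 n \<theta> f (lab e i k) = integral (elem \<theta> i) (\<lambda>x. f x * basis 0 n \<theta> (lab e i k) x) /
      integral (elem \<theta> i) (\<lambda>x. (basis 0 n \<theta> (lab e i k) x)\<^sup>2)"
    by (simp add: lab_def)
  thus ?thesis using h by (simp add: 1 2 coeff_of_def)
qed

lemma has_integral_grid:
  fixes f :: "real \<Rightarrow> real" and I :: "nat \<Rightarrow> real"
  assumes "\<And>i. i \<in> {1..n} \<Longrightarrow> (f has_integral I i) (elem \<theta> i)"
  shows "(f has_integral (\<Sum>i=1..n. I i)) {-pi..pi}"
proof -
  have "j \<in> {1..n} \<Longrightarrow> (f has_integral (\<Sum>i=1..j. I i)) {\<theta> 1..\<theta> (Suc j)}" for j
  proof (induction j)
    case (Suc j)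
    show ?case
    proof (cases "j = 0")
      case True
      thus ?thesis using assms[of 1] Suc.prems by (simp add: elem_def)
    next
      case False
      have "\<theta> 1 \<le> \<theta> (Suc j)" "\<theta> (Suc j) \<le> \<theta> (Suc (Suc j))" using Suc.prems False by (auto intro!: \<theta>_le)
      moreover have "(f has_integral (\<Sum>i=1..j. I i)) {\<theta> 1..\<theta> (Suc j)}" using Suc False by auto
      moreover have "(f has_integral I (Suc j)) {\<theta> (Suc j)..\<theta> (Suc (Suc j))}"
        using assms[of "Suc j"] Suc.prems by (simp add: elem_def)
      ultimately have "(f has_integral ((\<Sum>i=1..j. I i) + I (Suc j))) {\<theta> 1..\<theta> (Suc (Suc j))}"
        by (rule has_integral_combine)
      thus ?thesis by simp
    qed
  qed simp
  from this[of n] show ?thesis using n2 \<theta>1 \<theta>n by simp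
qed

lemma sum_inner_elem:
  fixes G :: "nat \<Rightarrow> real"
  assumes i: "i \<in> {1..n}" and x: "x \<in> inner_elem i" and G: "\<And>j. j \<in> {1..n} \<Longrightarrow> x \<notin> elem \<theta> j \<Longrightarrow> G j = 0"
  shows "(\<Sum>j=1..n. G j) = G i"
proof -
  have "(\<Sum>j=1..n. G j) = (\<Sum>j=1..n. if j = i then G i else 0)"
    using G inner_elem_unique[OF i _ x] by (intro sum.cong) auto
  thus ?thesis using i by (simp add: sum.delta)
qed

lemma sum_shift_bounds: "(\<Sum>j=Suc 0..m. t j) = (\<Sum>k<m. t (Suc k))" for t :: "nat \<Rightarrow> real"
  by (metis One_nat_def atLeastLessThanSuc_atLeastAtMost lessThan_atLeast0 sum.shift_bounds_Suc_ivl)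

text \<open>The count \<open>Suc m - e\<close> reflects that \<open>p\<^sub>0\<close> to
  \<open>p\<^sub>m\<close> occur but only \<open>q\<^sub>1\<close> to
  \<open>q\<^sub>m\<close>.\<close>

lemma partial_sum0_inner:
  assumes i: "i \<in> {1..n}" and x: "x \<in> inner_elem i"
  shows "partial_sum 0 n \<theta> c m x =
    parity_sum (\<lambda>e y. \<Sum>k<Suc m - e. c (lab e i k) * poly (elem_fam i e 0 k) y) i x"
proof -
  have xe: "x \<in> elem \<theta> i" using x inner_elem_subset by auto
  let ?T = "\<lambda>i. c (Ev i 0) * basis 0 n \<theta> (Ev i 0) x +
           (\<Sum>j=1..m. c (Od i j) * basis 0 n \<theta> (Od i j) x + c (Ev i j) * basis 0 n \<theta> (Ev i j) x)"
  have "partial_sum 0 n \<theta> c m x = (\<Sum>i=1..n. ?T i)" by (simp add: partial_sum_def)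
  also have "\<dots> = ?T i" by (rule sum_inner_elem[OF i x]) simp
  also have "\<dots> = (\<Sum>k<Suc m. c (Ev i k) * basis 0 n \<theta> (Ev i k) x) + (\<Sum>k<m. c (Od i (Suc k)) * basis 0 n \<theta> (Od i (Suc k)) x)"
    by (simp only: sum.distrib One_nat_def sum_shift_bounds sum.lessThan_Suc_shift)
  also have "\<dots> = (\<Sum>e<2. \<Sum>k<Suc m - e. c (lab e i k) * basis 0 n \<theta> (lab e i k) x)"
    by (simp add: numeral_2_eq_2 lab_def)
  also have "\<dots> = parity_sum (\<lambda>e y. \<Sum>k<Suc m - e. c (lab e i k) * poly (elem_fam i e 0 k) y) i x"
    unfolding parity_sum_def by (intro sum.cong refl) (simp add: basis0_lab[OF i xe] sum_distrib_left mult_ac)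
  finally show ?thesis .
qed

lemma parity_sum_diff: "parity_sum A i x - parity_sum B i x = parity_sum (\<lambda>e y. A e y - B e y) i x"
  by (simp add: parity_sum_def right_diff_distrib sum_subtractf)

lemma parity_sum_cong: "(\<And>e. e < 2 \<Longrightarrow> A e (sg i x) = B e (sg i x)) \<Longrightarrow> parity_sum A i x = parity_sum B i x"
  by (simp add: parity_sum_def)

end

section \<open>Error and coefficients for \<open>b = 0\<close>\<close>

lemma bigo_inverse_power:
  fixes a :: "nat \<Rightarrow> real"
  assumes "\<rho> > 1" "\<And>m. m \<ge> m0 \<Longrightarrow> \<bar>a m\<bar> \<le> C / \<rho> ^ m"
  shows "a \<in> O(\<lambda>m. 1 / \<rho> ^ m)"
proof (rule bigoI[of _ C])
  show "\<forall>\<^sub>F m in sequentially. norm (a m) \<le> C * norm (1 / \<rho> ^ m)"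
    using eventually_ge_at_top[of m0] by eventually_elim (use assms in simp)
qed

text \<open>Everything retained from the analyticity of the restrictions. The periodicity
  \<open>F_per\<close> closes the circle at the hat function of the first node.\<close>

locale arc_expansion = arc_grid +
  fixes F :: "real \<Rightarrow> real" and g k :: "nat \<Rightarrow> nat \<Rightarrow> real \<Rightarrow> real" and \<rho> :: real
  assumes \<rho>: "\<rho> > 1"
    and rg: "\<And>i e. i \<in> {1..n} \<Longrightarrow> rapprox \<rho> (g i e)"
    and rk: "\<And>i e. i \<in> {1..n} \<Longrightarrow> rapprox \<rho> (k i e)"
    and gk: "\<And>i e y. i \<in> {1..n} \<Longrightarrow> y \<in> {0..1} \<Longrightarrow> g i e y = g i e 1 + (1 - y) * k i e y"
    and F_parity: "\<And>i x. i \<in> {1..n} \<Longrightarrow> x \<in> elem \<theta> i \<Longrightarrow> F x = parity_sum (g i) i x"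
    and F_per: "F pi = F (- pi)"
begin

lemma cg: "i \<in> {1..n} \<Longrightarrow> continuous_on {0..1} (g i e)" and ck: "i \<in> {1..n} \<Longrightarrow> continuous_on {0..1} (k i e)"
  using rapprox_continuous rg rk \<rho> by blast+

lemma coeffs0_F:
  assumes "i \<in> {1..n}" "e < 2"
  shows "coeffs0 n \<theta> F (lab e i j) = elem_coeff i e 0 (g i e) j"
  using assms F_parity inner_elem_subset by (intro coeffs0_parity_sum cg) auto

lemma psum_error_bound:
  assumes G: "\<And>i e. i \<in> {1..n} \<Longrightarrow> rapprox \<rho> (G i e)"
  shows "\<exists>C. \<forall>i\<in>{1..n}. \<forall>e<2. \<forall>N. elem_sq_error i e b (G i e) N \<le> (C / \<rho> ^ N)\<^sup>2"
proof -
  have "\<exists>C. \<forall>N. elem_sq_error i e b (G i e) N \<le> (C / \<rho> ^ N)\<^sup>2" if "i \<in> {1..n}" for i e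
    using arc_weight.rapprox_psum_error[OF elem_arc_weight[OF that] G[OF that] \<rho>] .
  then obtain C where C: "\<And>i e N. i \<in> {1..n} \<Longrightarrow> elem_sq_error i e b (G i e) N \<le> (C i e / \<rho> ^ N)\<^sup>2" by metis
  \<comment> \<open>One constant for the finitely many elements and the two parities.\<close>
  define K where "K = (\<Sum>i\<in>{1..n}. \<Sum>e<2. \<bar>C i e\<bar>)"
  have K: "\<bar>C i e\<bar> \<le> K" if "i \<in> {1..n}" "e < 2" for i e
  proof -
    have "\<bar>C i e\<bar> \<le> (\<Sum>e<2. \<bar>C i e\<bar>)" using that by (intro member_le_sum) auto
    also have "\<dots> \<le> K" unfolding K_def using that by (intro member_le_sum) (auto intro: sum_nonneg)
    finally show ?thesis .
  qed
  have "(C i e / \<rho> ^ N)\<^sup>2 \<le> (K / \<rho> ^ N)\<^sup>2" if "i \<in> {1..n}" "e < 2" for i e N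
  proof -
    have "\<bar>C i e / \<rho> ^ N\<bar> \<le> K / \<rho> ^ N" using K[OF that] \<rho> by (simp add: divide_right_mono)
    thus ?thesis by (metis abs_ge_zero power2_abs power_mono)
  qed
  thus ?thesis using C order_trans by meson
qed

lemma error0_inner:
  assumes i: "i \<in> {1..n}" and x: "x \<in> inner_elem i"
  shows "F x - partial_sum 0 n \<theta> (coeffs0 n \<theta> F) m x =
    parity_sum (\<lambda>e y. g i e y - poly (elem_psum i e 0 (g i e) (Suc m - e)) y) i x"
proof -
  have "F x = parity_sum (g i) i x" using F_parity i x inner_elem_subset by auto
  moreover have "partial_sum 0 n \<theta> (coeffs0 n \<theta> F) m x =
     parity_sum (\<lambda>e y. poly (elem_psum i e 0 (g i e) (Suc m - e)) y) i x"
    unfolding partial_sum0_inner[OF i x]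
    by (intro parity_sum_cong) (simp add: arc_weight.poly_psum[OF elem_arc_weight[OF i]] coeffs0_F[OF i])
  ultimately show ?thesis by (simp add: parity_sum_diff)
qed

text \<open>Shared by both norms, with \<open>Q\<close> equal to 1 for \<open>b = 0\<close> and to
  \<open>1 / (1 - h)\<close> for \<open>b = -1\<close>. The number of terms may fall one short of
  \<open>m\<close>, at the price of a factor \<open>\<rho>\<close>.\<close>

lemma error_sum_bound:
  assumes N: "\<And>m e. e < 2 \<Longrightarrow> m \<le> N e m + 1" and Q: "\<And>i. i \<in> {1..n} \<Longrightarrow> Q i \<ge> 0"
    and G: "\<And>i e. i \<in> {1..n} \<Longrightarrow> rapprox \<rho> (G i e)"
  shows "\<exists>C. \<forall>m. sqrt (\<Sum>i=1..n. Q i * (\<Sum>e<2. 2 * (1 - elem_h \<theta> i) ^ (2 * e) * elem_sq_error i e b (G i e) (N e m))) \<le> C / \<rho> ^ m"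
proof -
  have "\<exists>C. \<forall>i\<in>{1..n}. \<forall>e<2. \<forall>N. elem_sq_error i e b (G i e) N \<le> (C / \<rho> ^ N)\<^sup>2"
    by (rule psum_error_bound[OF G])
  then obtain C where C: "\<And>i e N. i \<in> {1..n} \<Longrightarrow> e < 2 \<Longrightarrow> elem_sq_error i e b (G i e) N \<le> (C / \<rho> ^ N)\<^sup>2" by blast
  define W where "W = (\<Sum>i=1..n. Q i * (\<Sum>e<2. 2 * (1 - elem_h \<theta> i) ^ (2 * e)))"
  have ev2: "(1 - elem_h \<theta> i) ^ (2 * e) \<ge> 0" for i and e :: nat by (simp add: power_mult)
  have W: "W \<ge> 0" unfolding W_def using Q ev2 by (intro sum_nonneg mult_nonneg_nonneg) auto
  have "sqrt (\<Sum>i=1..n. Q i * (\<Sum>e<2. 2 * (1 - elem_h \<theta> i) ^ (2 * e) * elem_sq_error i e b (G i e) (N e m))) \<le> (sqrt W * (\<bar>C\<bar> * \<rho>)) / \<rho> ^ m" (is "sqrt ?X \<le> _") for m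
  proof -
    define D where "D = (\<bar>C\<bar> * \<rho> / \<rho> ^ m)\<^sup>2"
    have "(C / \<rho> ^ N e m)\<^sup>2 \<le> D" if "e < 2" for e
    proof -
      have "\<rho> ^ m \<le> \<rho> ^ (N e m + 1)" using \<rho> N[OF that] by (intro power_increasing) auto
      hence "\<bar>C\<bar> * \<rho> / \<rho> ^ (N e m + 1) \<le> \<bar>C\<bar> * \<rho> / \<rho> ^ m" using \<rho> by (intro divide_left_mono) auto
      hence "\<bar>C / \<rho> ^ N e m\<bar> \<le> \<bar>C\<bar> * \<rho> / \<rho> ^ m" using \<rho> by simp
      thus ?thesis unfolding D_def by (metis abs_ge_zero power2_abs power_mono)
    qed
    hence "?X \<le> (\<Sum>i=1..n. Q i * (\<Sum>e<2. 2 * (1 - elem_h \<theta> i) ^ (2 * e) * D))"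
      using Q ev2 C by (intro sum_mono mult_left_mono order_trans[OF C]) auto
    also have "\<dots> = W * D" by (simp add: W_def sum_distrib_right mult.assoc)
    finally have "sqrt ?X \<le> sqrt (W * D)" by simp
    also have "\<dots> = sqrt W * (\<bar>C\<bar> * \<rho> / \<rho> ^ m)" using \<rho> by (simp add: D_def real_sqrt_mult)
    finally show ?thesis by simp
  qed
  thus ?thesis by blast
qed

lemma expansion0:
  shows "(\<forall>m. arc_norm_finite 0 n \<theta> (\<lambda>x. F x - S_sum 0 n \<theta> F m x)) \<and>
         (\<lambda>m. arc_norm 0 n \<theta> (\<lambda>x. F x - S_sum 0 n \<theta> F m x)) \<in> O(\<lambda>m. 1 / \<rho> ^ m) \<and>
         (\<forall>i\<in>{1..n}. (\<lambda>m. arc_coeffs 0 n \<theta> F (Ev i m)) \<in> O(\<lambda>m. 1 / \<rho> ^ m) \<and>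
                       (\<lambda>m. arc_coeffs 0 n \<theta> F (Od i m)) \<in> O(\<lambda>m. 1 / \<rho> ^ m))"
proof -
  define E where "E m i e y = g i e y - poly (elem_psum i e 0 (g i e) (Suc m - e)) y" for m i e y
  have cE: "i \<in> {1..n} \<Longrightarrow> continuous_on {0..1} (E m i e)" for m i e
    unfolding E_def by (intro continuous_intros cg)
  have I: "((\<lambda>x. (F x - S_sum 0 n \<theta> F m x)\<^sup>2) has_integral
     (\<Sum>i=1..n. \<Sum>e<2. 2 * (1 - elem_h \<theta> i) ^ (2 * e) * elem_ip i e 0 (E m i e) (E m i e))) {-pi..pi}" for m
  proof (rule has_integral_grid)
    fix i assume i: "i \<in> {1..n}"
    show "((\<lambda>x. (F x - S_sum 0 n \<theta> F m x)\<^sup>2) has_integral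
     (\<Sum>e<2. 2 * (1 - elem_h \<theta> i) ^ (2 * e) * elem_ip i e 0 (E m i e) (E m i e))) (elem \<theta> i)"
      by (rule has_integral_elem[OF i cE[OF i] cE[OF i]])
         (simp add: S_sum_def arc_coeffs_def error0_inner[OF i] power2_eq_square E_def[abs_def])
  qed
  have "arc_norm 0 n \<theta> (\<lambda>x. F x - S_sum 0 n \<theta> F m x) =
    sqrt (\<Sum>i=1..n. 1 * (\<Sum>e<2. 2 * (1 - elem_h \<theta> i) ^ (2 * e) * elem_ip i e 0 (E m i e) (E m i e)))" for m
    unfolding arc_norm_def using integral_unique[OF I[of m]] by simp
  moreover obtain C where C: "\<And>m. sqrt (\<Sum>i=1..n. 1 * (\<Sum>e<2. 2 * (1 - elem_h \<theta> i) ^ (2 * e) * elem_ip i e 0 (E m i e) (E m i e))) \<le> C / \<rho> ^ m"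
  proof -
    have "\<exists>C. \<forall>m. sqrt (\<Sum>i=1..n. 1 * (\<Sum>e<2. 2 * (1 - elem_h \<theta> i) ^ (2 * e) * elem_ip i e 0 (E m i e) (E m i e))) \<le> C / \<rho> ^ m"
      unfolding E_def[abs_def] by (rule error_sum_bound) (auto intro: rg)
    thus ?thesis using that by blast
  qed
  moreover have "0 \<le> arc_norm 0 n \<theta> (\<lambda>x. F x - S_sum 0 n \<theta> F m x)" for m
    unfolding arc_norm_def by (simp add: integral_nonneg has_integral_integrable[OF I])
  ultimately have "(\<lambda>m. arc_norm 0 n \<theta> (\<lambda>x. F x - S_sum 0 n \<theta> F m x)) \<in> O(\<lambda>m. 1 / \<rho> ^ m)"
    by (intro bigo_inverse_power[OF \<rho>, of 0 _ C]) simp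
  moreover have "arc_norm_finite 0 n \<theta> (\<lambda>x. F x - S_sum 0 n \<theta> F m x)" for m
    using has_integral_integrable[OF I[of m]] by (simp add: arc_norm_finite_def)
  moreover have "(\<lambda>m. arc_coeffs 0 n \<theta> F (Ev i m)) \<in> O(\<lambda>m. 1 / \<rho> ^ m)" if i: "i \<in> {1..n}" for i
  proof -
    obtain C where "\<And>j. \<bar>elem_coeff i 0 0 (g i 0) j\<bar> \<le> C / \<rho> ^ j"
      using arc_weight.rapprox_coeff_of[OF elem_arc_weight[OF i] rg[OF i] \<rho>] by blast
    thus ?thesis using coeffs0_F[OF i, of 0] by (intro bigo_inverse_power[OF \<rho>, of 0 _ C]) (simp add: arc_coeffs_def lab_def del: coeffs0.simps)
  qed
  moreover have "(\<lambda>m. arc_coeffs 0 n \<theta> F (Od i m)) \<in> O(\<lambda>m. 1 / \<rho> ^ m)" if i: "i \<in> {1..n}" for i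
  proof -
    obtain C where C: "\<And>j. \<bar>elem_coeff i 1 0 (g i 1) j\<bar> \<le> C / \<rho> ^ j"
      using arc_weight.rapprox_coeff_of[OF elem_arc_weight[OF i] rg[OF i] \<rho>] by blast
    \<comment> \<open>The function \<open>q\<^sub>m\<close> carries a polynomial of degree
      \<open>m - 1\<close>, whence the extra \<open>\<rho>\<close>.\<close>
    have "\<bar>arc_coeffs 0 n \<theta> F (Od i m)\<bar> \<le> (C * \<rho>) / \<rho> ^ m" if "m \<ge> 1" for m
      using C[of "m - 1"] coeffs0_F[OF i, of 1 "m - 1"] that \<rho> by (cases m) (simp_all add: arc_coeffs_def lab_def del: coeffs0.simps)
    thus ?thesis by (intro bigo_inverse_power[OF \<rho>, of 1]) auto
  qed
  ultimately show ?thesis by blast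
qed

end

subsection \<open>The connection matrix and expansions for \<open>b = -1\<close>\<close>

context arc_grid begin

text \<open>The node at the right end of element \<open>i\<close>, with node \<open>n + 1\<close>
  identified with node 1.\<close>

definition nxt :: "nat \<Rightarrow> nat" where "nxt i = (if i = n then 1 else Suc i)"

text \<open>Coefficient of \<open>sin\<^sup>e\<close> in the restriction of the hat function of node \<open>j\<close> to element \<open>i\<close>.\<close>

definition hat_coeff :: "nat \<Rightarrow> nat \<Rightarrow> nat \<Rightarrow> real" where
  "hat_coeff j i e = (if j = i then (if e = 0 then 1/2 else - 1 / (2 * sin (half_len \<theta> i)))
     else if j = nxt i then (if e = 0 then 1/2 else 1 / (2 * sin (half_len \<theta> i))) else 0)"

lemma nxt_range: "i \<in> {1..n} \<Longrightarrow> nxt i \<in> {1..n}" and nxt_neq: "i \<in> {1..n} \<Longrightarrow> nxt i \<noteq> i"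
  using n2 by (auto simp: nxt_def)

lemma pred_node:
  assumes "j \<in> {1..n}"
  shows "(if j = 1 then n else j - 1) \<in> {1..n}" "i \<in> {1..n} \<Longrightarrow> (if j = 1 then n else j - 1) = i \<longleftrightarrow> j = nxt i"
  using assms n2 by (auto simp: nxt_def)

lemma sin_half_len: "i \<in> {1..n} \<Longrightarrow> sin (half_len \<theta> i) > 0"
  using half_len_bounds by (simp add: sin_gt_zero)

lemma hat_inner:
  assumes i: "i \<in> {1..n}" and j: "j \<in> {1..n}" and x: "x \<in> inner_elem i"
  shows "hat n \<theta> j x = parity_sum (\<lambda>e _. hat_coeff j i e) i x"
proof -
  \<comment> \<open>The element to the left of node \<open>j\<close>, cyclically.\<close>
  define p where "p = (if j = 1 then n else j - 1)"
  have p: "p \<in> {1..n}" "p = i \<longleftrightarrow> j = nxt i" using pred_node[OF j] i unfolding p_def by blast+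
  have "hat n \<theta> j x = (if x \<in> elem \<theta> p then (1 + sin (loc \<theta> p x) / sin (half_len \<theta> p)) / 2
      else if x \<in> elem \<theta> j then (1 - sin (loc \<theta> j x) / sin (half_len \<theta> j)) / 2 else 0)"
    by (simp only: hat_def p_def Let_def)
  also have "\<dots> = (if j = nxt i then (1 + sin (loc \<theta> i x) / sin (half_len \<theta> i)) / 2
      else if j = i then (1 - sin (loc \<theta> i x) / sin (half_len \<theta> i)) / 2 else 0)"
    using p(2) inner_elem_unique[OF i p(1) x] inner_elem_unique[OF i j x] by auto
  also have "\<dots> = parity_sum (\<lambda>e _. hat_coeff j i e) i x"
    using nxt_neq[OF i] by (auto simp: parity_sum_def hat_coeff_def sn_def numeral_2_eq_2 field_simps)
  finally show ?thesis .
qed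

lemma node_in_elem:
  assumes i: "i \<in> {1..n+1}" and j: "j \<in> {1..n}"
  shows "\<theta> i \<in> elem \<theta> j \<longleftrightarrow> i = j \<or> i = Suc j"
proof
  assume "\<theta> i \<in> elem \<theta> j"
  hence "\<not> \<theta> i < \<theta> j" "\<not> \<theta> (Suc j) < \<theta> i" by (auto simp: elem_def)
  hence "\<not> i < j" "\<not> Suc j < i" using \<theta>_less[of i j] \<theta>_less[of "Suc j" i] i j by auto
  thus "i = j \<or> i = Suc j" by linarith
qed (use \<theta>_Suc[OF j] in \<open>auto simp: elem_def\<close>)

lemma loc_left: "loc \<theta> i (\<theta> i) = - half_len \<theta> i" and loc_right: "loc \<theta> i (\<theta> (Suc i)) = half_len \<theta> i"
  by (simp_all add: loc_def midpt_def half_len_def field_simps)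

lemma sg_ends: "i \<in> {1..n} \<Longrightarrow> sg i (\<theta> i) = 1" "i \<in> {1..n} \<Longrightarrow> sg i (\<theta> (Suc i)) = 1"
  using half_len_bounds[of i] by (simp_all add: sg_def elem_h_def loc_left loc_right)

lemma basis1_node:
  assumes i: "i \<in> {1..n+1}" and j: "j \<in> {1..n}" and e: "e < 2"
  shows "basis (-1) n \<theta> (lab e j (Suc k)) (\<theta> i) = 0"
proof (cases "\<theta> i \<in> elem \<theta> j")
  case True
  hence "sg j (\<theta> i) = 1" using node_in_elem[OF i j] sg_ends[OF j] by auto
  thus ?thesis using basis1_lab[OF j True e] by simp
qed (rule basis_lab_outside)

lemma hat_node:
  assumes i: "i \<in> {1..n+1}" and j: "j \<in> {1..n}"
  shows "hat n \<theta> j (\<theta> i) = (if j = (if i = Suc n then 1 else i) then 1 else 0)"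
proof -
  define p where "p = (if j = 1 then n else j - 1)"
  have p: "p \<in> {1..n}" using pred_node[OF j] unfolding p_def by blast
  have eq: "hat n \<theta> j (\<theta> i) = (if i = p \<or> i = Suc p then (1 + sin (loc \<theta> p (\<theta> i)) / sin (half_len \<theta> p)) / 2
      else if i = j \<or> i = Suc j then (1 - sin (loc \<theta> j (\<theta> i)) / sin (half_len \<theta> j)) / 2 else 0)"
    unfolding node_in_elem[OF i p, symmetric] node_in_elem[OF i j, symmetric] by (simp only: hat_def p_def Let_def)
  have s: "sin (half_len \<theta> p) \<noteq> 0" "sin (half_len \<theta> j) \<noteq> 0" using sin_half_len p j by force+
  consider "i = p" | "i = Suc p" | "i \<noteq> p" "i \<noteq> Suc p" "i = j" | "i \<noteq> p" "i \<noteq> Suc p" "i = Suc j" | "i \<noteq> p" "i \<noteq> Suc p" "i \<noteq> j" "i \<noteq> Suc j" by blast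
  thus ?thesis
  proof cases
    case 1
    thus ?thesis unfolding eq using s p j n2 by (auto simp: loc_left p_def split: if_splits)
  next
    case 2
    thus ?thesis unfolding eq using s p j n2 by (auto simp: loc_right p_def split: if_splits)
  next
    case 3
    thus ?thesis unfolding eq using s j by (auto simp: loc_left)
  next
    case 4
    thus ?thesis unfolding eq using s j by (auto simp: loc_right p_def split: if_splits)
  next
    case 5
    thus ?thesis unfolding eq using j i by (auto simp: p_def split: if_splits)
  qed
qed

text \<open>The partial sum for \<open>m = 0\<close> still contains \<open>p\<^sub>1\<close>.\<close>

definition num_terms :: "nat \<Rightarrow> nat \<Rightarrow> nat" where "num_terms e m = (if e = 0 then max 1 m else m - 1)"

lemma sum_from_2: "(\<Sum>j=2..m. t j) = (\<Sum>k<m - 1. t (Suc (Suc k)))" for t :: "nat \<Rightarrow> real"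
proof (cases m)
  case (Suc q)
  have "(\<Sum>j=Suc (Suc 0)..Suc q. t j) = (\<Sum>j=Suc 0..q. t (Suc j))" by (rule sum.shift_bounds_cl_Suc_ivl)
  thus ?thesis using Suc sum_shift_bounds[of "\<lambda>j. t (Suc j)" q] by (simp add: numeral_2_eq_2)
qed simp

lemma partial_sum1_eq:
  "partial_sum (-1) n \<theta> c m x = (\<Sum>i=1..n. c (Hat i) * hat n \<theta> i x) +
     (\<Sum>i=1..n. \<Sum>e<2. \<Sum>k<num_terms e m. c (lab e i (Suc k)) * basis (-1) n \<theta> (lab e i (Suc k)) x)"
proof -
  have "c (Ev i 1) * basis (-1) n \<theta> (Ev i 1) x +
           (\<Sum>j=2..m. c (Od i j) * basis (-1) n \<theta> (Od i j) x + c (Ev i j) * basis (-1) n \<theta> (Ev i j) x) =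
      (\<Sum>e<2. \<Sum>k<num_terms e m. c (lab e i (Suc k)) * basis (-1) n \<theta> (lab e i (Suc k)) x)" for i
  proof -
    let ?t = "\<lambda>j. c (Ev i j) * basis (-1) n \<theta> (Ev i j) x"
    have m: "max 1 m = Suc (m - 1)" by auto
    have "?t 1 + (\<Sum>k<m - 1. ?t (Suc (Suc k))) = (\<Sum>k<num_terms 0 m. ?t (Suc k))"
      unfolding num_terms_def m by (simp only: sum.lessThan_Suc_shift simp_thms if_True One_nat_def)
    thus ?thesis unfolding sum.distrib sum_from_2 by (simp only: numeral_2_eq_2 sum.lessThan_Suc lab_def num_terms_def) (simp add: sum_from_2)
  qed
  thus ?thesis unfolding partial_sum_def by (simp add: sum.distrib add.assoc del: basis.simps(2,3))
qed

lemma partial_sum1_inner: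
  assumes i: "i \<in> {1..n}" and x: "x \<in> inner_elem i"
  shows "partial_sum (-1) n \<theta> c m x =
    parity_sum (\<lambda>e y. (\<Sum>j=1..n. c (Hat j) * hat_coeff j i e) + (1 - y) * (\<Sum>k<num_terms e m. c (lab e i (Suc k)) * poly (elem_fam i e 1 k) y)) i x"
proof -
  have xe: "x \<in> elem \<theta> i" using x inner_elem_subset by auto
  have "(\<Sum>j=1..n. c (Hat j) * hat n \<theta> j x) = (\<Sum>j=1..n. \<Sum>e<2. c (Hat j) * (sn i x ^ e * hat_coeff j i e))"
    by (intro sum.cong refl) (simp add: hat_inner[OF i _ x] parity_sum_def sum_distrib_left)
  also have "\<dots> = (\<Sum>e<2. sn i x ^ e * (\<Sum>j=1..n. c (Hat j) * hat_coeff j i e))"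
    by (subst sum.swap) (simp add: sum_distrib_left mult_ac)
  finally have 1: "(\<Sum>j=1..n. c (Hat j) * hat n \<theta> j x) = \<dots>" .
  have "(\<Sum>i=1..n. \<Sum>e<2. \<Sum>k<num_terms e m. c (lab e i (Suc k)) * basis (-1) n \<theta> (lab e i (Suc k)) x) =
      (\<Sum>e<2. \<Sum>k<num_terms e m. c (lab e i (Suc k)) * basis (-1) n \<theta> (lab e i (Suc k)) x)"
    by (rule sum_inner_elem[OF i x]) (simp add: basis_lab_outside)
  also have "\<dots> = (\<Sum>e<2. sn i x ^ e * ((1 - sg i x) * (\<Sum>k<num_terms e m. c (lab e i (Suc k)) * poly (elem_fam i e 1 k) (sg i x))))"
    by (intro sum.cong refl) (simp add: basis1_lab[OF i xe] sum_distrib_left mult_ac)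
  finally show ?thesis unfolding partial_sum1_eq 1 parity_sum_def by (simp add: distrib_left sum.distrib)
qed

text \<open>At a node the factor \<open>1 - \<sigma>\<close> kills every other basis function and
  the hats are nodal. The partial sums are thus constant in \<open>m\<close>, and convergence at the
  nodes forces the hat coefficients.\<close>

lemma partial_sum1_node:
  assumes i: "i \<in> {1..n+1}"
  shows "partial_sum (-1) n \<theta> c m (\<theta> i) = c (Hat (if i = Suc n then 1 else i))"
proof -
  let ?i = "if i = Suc n then 1 else i"
  have "(\<Sum>j=1..n. c (Hat j) * hat n \<theta> j (\<theta> i)) = (\<Sum>j=1..n. if j = ?i then c (Hat ?i) else 0)"
    by (intro sum.cong refl) (simp add: hat_node[OF i])
  also have "\<dots> = c (Hat ?i)" using i n2 by (subst sum.delta) auto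
  finally show ?thesis unfolding partial_sum1_eq by (simp add: basis1_node[OF i])
qed

text \<open>The polynomial in \<sigma> that multiplies \<open>sin ^ e\<close> when the basis
  function \<open>s\<close> is restricted to element \<open>i\<close>. The shifts by 1 and 2 recover
  the degree of the underlying polynomial for \<open>b = 1\<close>.\<close>

definition restr_poly :: "label \<Rightarrow> nat \<Rightarrow> nat \<Rightarrow> real poly" where
  "restr_poly s i e = (case s of Hat j \<Rightarrow> [:hat_coeff j i e:]
     | Ev j q \<Rightarrow> if j = i \<and> e = 0 then [:1, -1:] * elem_fam i 0 1 (q - 1) else 0
     | Od j q \<Rightarrow> if j = i \<and> e = 1 then [:1, -1:] * elem_fam i 1 1 (q - 2) else 0)"

lemma restr_poly_Hat [simp]: "restr_poly (Hat j) i e = [:hat_coeff j i e:]"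
  by (simp add: restr_poly_def)

lemma restr_poly_lab: "e < 2 \<Longrightarrow> e' < 2 \<Longrightarrow> restr_poly (lab e' j (Suc q)) i e = (if j = i \<and> e' = e then [:1, -1:] * elem_fam i e 1 q else 0)"
  by (auto simp: restr_poly_def lab_def less_2_cases_iff)

lemma basis1_inner:
  assumes s: "s \<in> labels1 n" and i: "i \<in> {1..n}" and x: "x \<in> inner_elem i"
  shows "basis (-1) n \<theta> s x = parity_sum (\<lambda>e. poly (restr_poly s i e)) i x"
proof -
  from s consider j where "s = Hat j" "j \<in> {1..n}" | e' j q where "s = lab e' j (Suc q)" "e' < 2" "j \<in> {1..n}"
    unfolding labels1_eq by blast
  thus ?thesis
  proof cases
    case 1
    thus ?thesis using hat_inner[OF i 1(2) x] by (simp add: parity_sum_def)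
  next
    case (2 e' j q)
    have "parity_sum (\<lambda>e. poly (restr_poly s i e)) i x = (\<Sum>e<2. if e = e' then (if j = i then sn i x ^ e' * ((1 - sg i x) * poly (elem_fam i e' 1 q) (sg i x)) else 0) else 0)"
      unfolding parity_sum_def 2(1) by (intro sum.cong refl) (simp add: restr_poly_lab 2(2) left_diff_distrib)
    also have "\<dots> = (if j = i then sn i x ^ e' * ((1 - sg i x) * poly (elem_fam i e' 1 q) (sg i x)) else 0)"
      using 2(2) by simp
    also have "\<dots> = basis (-1) n \<theta> s x"
    proof (cases "j = i")
      case True
      have "x \<in> elem \<theta> i" using x inner_elem_subset by auto
      thus ?thesis using basis1_lab[OF i _ 2(2), of x q] True 2(1) by simp
    next
      case False
      thus ?thesis using inner_elem_unique[OF i 2(3) x] basis_lab_outside 2(1) by simp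
    qed
    finally show ?thesis by simp
  qed
qed

section \<open>The connection matrix\<close>

lemma Hat_neq_lab [simp]: "Hat j \<noteq> lab e i q"
  by (simp add: lab_def)

text \<open>Orthogonality leaves no other candidate: column \<open>s\<close> holds the expansion
  coefficients of the basis function \<open>s\<close> for \<open>b = 0\<close>.\<close>

definition conn :: "label \<Rightarrow> label \<Rightarrow> real" where
  "conn r s = (if r \<in> labels0 n \<and> s \<in> labels1 n then coeffs0 n \<theta> (basis (-1) n \<theta> s) r else 0)"

lemma lab_in_labels0: "e < 2 \<Longrightarrow> i \<in> {1..n} \<Longrightarrow> lab e i j \<in> labels0 n"
  unfolding labels0_eq by blast

lemma lab_in_labels1: "e < 2 \<Longrightarrow> i \<in> {1..n} \<Longrightarrow> lab e i (Suc j) \<in> labels1 n" "i \<in> {1..n} \<Longrightarrow> Hat i \<in> labels1 n"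
  unfolding labels1_eq by blast+

lemma conn_lab:
  assumes "s \<in> labels1 n" "i \<in> {1..n}" "e < 2"
  shows "conn (lab e i j) s = elem_coeff i e 0 (poly (restr_poly s i e)) j"
proof -
  have "coeffs0 n \<theta> (basis (-1) n \<theta> s) (lab e i j) = elem_coeff i e 0 (poly (restr_poly s i e)) j"
    by (rule coeffs0_parity_sum[OF assms(2) _ assms(3)]) (auto intro: continuous_intros basis1_inner[OF assms(1,2)])
  thus ?thesis using assms lab_in_labels0 by (simp add: conn_def)
qed

text \<open>Brings a finitely supported combination of labels into the normal form with one common
  degree bound, for use in both existence and uniqueness.\<close>

lemma label_support_sum:
  fixes f :: "label \<Rightarrow> real"
  assumes fin: "finite {r. f r \<noteq> 0}" and sub: "{r. f r \<noteq> 0} \<subseteq> labels0 n"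
  shows "\<exists>K. (\<forall>e<2. \<forall>i\<in>{1..n}. \<forall>j\<ge>K. f (lab e i j) = 0) \<and> (\<forall>i\<in>{1..n}. \<forall>x\<in>inner_elem i.
    (\<Sum>r | f r \<noteq> 0. basis 0 n \<theta> r x * f r) = parity_sum (\<lambda>e y. \<Sum>j<K. f (lab e i j) * poly (elem_fam i e 0 j) y) i x)"
proof -
  define ix where "ix r = (case r of Hat i \<Rightarrow> 0 | Ev i j \<Rightarrow> j | Od i j \<Rightarrow> j)" for r :: label
  have ixl: "j \<le> ix (lab e i j)" for e i j by (simp add: ix_def lab_def)
  define K where "K = Suc (\<Sum>r | f r \<noteq> 0. ix r)"
  have K: "j < K" if "f (lab e i j) \<noteq> 0" for e i j
  proof -
    have "ix (lab e i j) \<le> (\<Sum>r | f r \<noteq> 0. ix r)" using that fin by (intro member_le_sum) auto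
    thus ?thesis using ixl[of j e i] by (simp add: K_def)
  qed
  define L where "L = (\<lambda>(e, i, j). lab e i j) ` ({..<2} \<times> {1..n} \<times> {..<K})"
  have inj: "inj_on (\<lambda>(e, i, j). lab e i j) ({..<2} \<times> {1..n} \<times> {..<K})"
    by (auto simp: inj_on_def lab_inject)
  have subL: "{r. f r \<noteq> 0} \<subseteq> L"
  proof
    fix r assume r: "r \<in> {r. f r \<noteq> 0}"
    then obtain e i j where "r = lab e i j" "e < 2" "i \<in> {1..n}" using sub unfolding labels0_eq by blast
    thus "r \<in> L" using r K unfolding L_def by force
  qed
  have "(\<Sum>r | f r \<noteq> 0. basis 0 n \<theta> r x * f r) = parity_sum (\<lambda>e y. \<Sum>j<K. f (lab e i j) * poly (elem_fam i e 0 j) y) i x"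
    if i: "i \<in> {1..n}" and x: "x \<in> inner_elem i" for i x
  proof -
    have xe: "x \<in> elem \<theta> i" using x inner_elem_subset by auto
    have "(\<Sum>r | f r \<noteq> 0. basis 0 n \<theta> r x * f r) = (\<Sum>r\<in>L. basis 0 n \<theta> r x * f r)"
      using subL by (intro sum.mono_neutral_left) (auto simp: L_def)
    also have "\<dots> = (\<Sum>(e, i, j)\<in>{..<2} \<times> {1..n} \<times> {..<K}. basis 0 n \<theta> (lab e i j) x * f (lab e i j))"
      unfolding L_def by (subst sum.reindex[OF inj]) (simp add: case_prod_unfold comp_def)
    also have "\<dots> = (\<Sum>e<2. \<Sum>i=1..n. \<Sum>j<K. basis 0 n \<theta> (lab e i j) x * f (lab e i j))"
      by (simp add: sum.cartesian_product)
    also have "\<dots> = (\<Sum>e<2. \<Sum>j<K. basis 0 n \<theta> (lab e i j) x * f (lab e i j))"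
      by (intro sum.cong refl sum_inner_elem[OF i x]) (simp add: basis_lab_outside)
    also have "\<dots> = parity_sum (\<lambda>e y. \<Sum>j<K. f (lab e i j) * poly (elem_fam i e 0 j) y) i x"
      unfolding parity_sum_def by (intro sum.cong refl) (simp add: basis0_lab[OF i xe] sum_distrib_left mult_ac)
    finally show ?thesis .
  qed
  moreover have "f (lab e i j) = 0" if "j \<ge> K" for e i j using K[of e i j] that by linarith
  ultimately show ?thesis by blast
qed

lemma inner_elem_iff:
  assumes "x \<in> {-pi..pi} - \<theta> ` {1..n+1}" shows "\<exists>i\<in>{1..n}. x \<in> inner_elem i"
proof -
  obtain i where i: "i \<in> {1..n}" "x \<in> elem \<theta> i" using elem_cover assms by blast
  have "x \<noteq> \<theta> i" "x \<noteq> \<theta> (Suc i)" using assms i(1) by auto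
  thus ?thesis using i by (intro bexI[of _ i]) (auto simp: elem_def inner_elem_def)
qed

lemma inner_elem_not_node:
  assumes i: "i \<in> {1..n}" and x: "x \<in> inner_elem i"
  shows "x \<in> {-pi..pi} - \<theta> ` {1..n+1}"
proof
  have "\<theta> 1 \<le> \<theta> i" "\<theta> (Suc i) \<le> \<theta> (n + 1)" using i by (auto intro!: \<theta>_le)
  thus "x \<in> {-pi..pi}" using x \<theta>1 \<theta>n by (auto simp: inner_elem_def)
  show "x \<notin> \<theta> ` {1..n+1}"
  proof
    assume "x \<in> \<theta> ` {1..n+1}"
    then obtain j where j: "j \<in> {1..n+1}" "x = \<theta> j" by blast
    hence "j = i \<or> j = Suc i" using node_in_elem[OF j(1) i] x inner_elem_subset by blast
    thus False using x j by (auto simp: inner_elem_def)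
  qed
qed

text \<open>On each element the restriction is a polynomial in \<sigma> in either parity. Its
  coefficients vanish beyond its degree, which makes the columns finite, and its partial sums
  reproduce it.\<close>

lemma connection_matrix_exists: "is_connection_matrix n \<theta> conn"
proof -
  have fin: "finite {r. conn r s \<noteq> 0}" if s: "s \<in> labels1 n" for s
  proof -
    define K where "K = Suc (\<Sum>i=1..n. \<Sum>e<2. degree (restr_poly s i e))"
    have "{r. conn r s \<noteq> 0} \<subseteq> (\<lambda>(e, i, j). lab e i j) ` ({..<2} \<times> {1..n} \<times> {..<K})"
    proof
      fix r assume r: "r \<in> {r. conn r s \<noteq> 0}"
      hence "r \<in> labels0 n" by (auto simp: conn_def split: if_splits)
      then obtain e i j where eij: "r = lab e i j" "e < 2" "i \<in> {1..n}" unfolding labels0_eq by blast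
      have "elem_coeff i e 0 (poly (restr_poly s i e)) j \<noteq> 0"
        using r eij conn_lab[OF s eij(3,2)] by simp
      hence "\<not> degree (restr_poly s i e) < j"
        using arc_weight.ip_poly_fam_eq_0[OF elem_arc_weight[OF eij(3)]] by (auto simp: arc_weight.coeff_of_def[OF elem_arc_weight[OF eij(3)]])
      moreover have "degree (restr_poly s i e) \<le> (\<Sum>e<2. degree (restr_poly s i e))" using eij by (intro member_le_sum) auto
      moreover have "(\<Sum>e<2. degree (restr_poly s i e)) \<le> (\<Sum>i=1..n. \<Sum>e<2. degree (restr_poly s i e))"
        using eij by (intro member_le_sum) auto
      ultimately have "j < K" by (simp add: K_def)
      thus "r \<in> (\<lambda>(e, i, j). lab e i j) ` ({..<2} \<times> {1..n} \<times> {..<K})" using eij by force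
    qed
    thus ?thesis by (rule finite_subset) auto
  qed
  have "basis (-1) n \<theta> s x = (\<Sum>r | conn r s \<noteq> 0. basis 0 n \<theta> r x * conn r s)"
    if s: "s \<in> labels1 n" and x: "x \<in> {-pi..pi} - \<theta> ` {1..n+1}" for s x
  proof -
    obtain i where i: "i \<in> {1..n}" "x \<in> inner_elem i" using inner_elem_iff[OF x] by blast
    have sub: "{r. conn r s \<noteq> 0} \<subseteq> labels0 n" by (auto simp: conn_def split: if_splits)
    obtain K where K: "\<And>e i j. e < 2 \<Longrightarrow> i \<in> {1..n} \<Longrightarrow> j \<ge> K \<Longrightarrow> conn (lab e i j) s = 0"
      "(\<Sum>r | conn r s \<noteq> 0. basis 0 n \<theta> r x * conn r s) = parity_sum (\<lambda>e y. \<Sum>j<K. conn (lab e i j) s * poly (elem_fam i e 0 j) y) i x"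
      using label_support_sum[OF fin[OF s] sub] i by blast
    have "(\<Sum>j<K. conn (lab e i j) s * poly (elem_fam i e 0 j) y) = poly (restr_poly s i e) y" if e: "e < 2" for e y
    proof -
      define K' where "K' = max K (Suc (degree (restr_poly s i e)))"
      have "(\<Sum>j<K. conn (lab e i j) s * poly (elem_fam i e 0 j) y) = (\<Sum>j<K'. conn (lab e i j) s * poly (elem_fam i e 0 j) y)"
        using K(1)[OF e i(1)] by (intro sum.mono_neutral_left) (auto simp: K'_def)
      also have "\<dots> = poly (elem_psum i e 0 (poly (restr_poly s i e)) K') y"
        by (simp add: arc_weight.poly_psum[OF elem_arc_weight[OF i(1)]] conn_lab[OF s i(1) e])
      also have "elem_psum i e 0 (poly (restr_poly s i e)) K' = restr_poly s i e"
        by (rule arc_weight.psum_poly[OF elem_arc_weight[OF i(1)]]) (auto simp: K'_def)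
      finally show ?thesis .
    qed
    hence "parity_sum (\<lambda>e y. \<Sum>j<K. conn (lab e i j) s * poly (elem_fam i e 0 j) y) i x = parity_sum (\<lambda>e. poly (restr_poly s i e)) i x"
      by (intro parity_sum_cong) blast
    thus ?thesis using K(2) basis1_inner[OF s i] by simp
  qed
  thus ?thesis using fin unfolding is_connection_matrix_def by (auto simp: conn_def split: if_splits)
qed

text \<open>Taking orthogonal coefficients on one open element of the defining identity recovers
  each entry; the excluded grid points do not affect the integrals.\<close>

lemma connection_matrix_unique:
  assumes R: "is_connection_matrix n \<theta> R" shows "R = conn"
proof (intro ext)
  fix r s
  have nz: "\<And>r s. R r s \<noteq> 0 \<Longrightarrow> r \<in> labels0 n \<and> s \<in> labels1 n"
    and fin: "\<And>s. s \<in> labels1 n \<Longrightarrow> finite {r. R r s \<noteq> 0}"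
    and id: "\<And>s x. s \<in> labels1 n \<Longrightarrow> x \<in> {-pi..pi} - \<theta> ` {1..n+1} \<Longrightarrow>
           basis (-1) n \<theta> s x = (\<Sum>r | R r s \<noteq> 0. basis 0 n \<theta> r x * R r s)"
    using R unfolding is_connection_matrix_def by blast+
  show "R r s = conn r s"
  proof (cases "r \<in> labels0 n \<and> s \<in> labels1 n")
    case True
    then obtain e i j where eij: "r = lab e i j" "e < 2" "i \<in> {1..n}" unfolding labels0_eq by blast
    have s: "s \<in> labels1 n" using True by simp
    interpret arc_weight "half_len \<theta> i" e 0 by (rule elem_arc_weight[OF eij(3)])
    have sub: "{r. R r s \<noteq> 0} \<subseteq> labels0 n" using nz by blast
    obtain K where K: "\<And>e i j. e < 2 \<Longrightarrow> i \<in> {1..n} \<Longrightarrow> j \<ge> K \<Longrightarrow> R (lab e i j) s = 0"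
      "\<And>x. x \<in> inner_elem i \<Longrightarrow> (\<Sum>r | R r s \<noteq> 0. basis 0 n \<theta> r x * R r s) = parity_sum (\<lambda>e y. \<Sum>j<K. R (lab e i j) s * poly (elem_fam i e 0 j) y) i x"
      using label_support_sum[OF fin[OF s] sub] eij(3) by blast
    have "conn r s = coeffs0 n \<theta> (basis (-1) n \<theta> s) (lab e i j)" using True eij(1) by (simp add: conn_def)
    also have "\<dots> = coeff_of (\<lambda>y. \<Sum>q<K. R (lab e i q) s * poly (fam q) y) j"
    proof (rule coeffs0_parity_sum[OF eij(3) _ eij(2), where A = "\<lambda>e y. \<Sum>q<K. R (lab e i q) s * poly (elem_fam i e 0 q) y"])
      show "basis (-1) n \<theta> s x = parity_sum (\<lambda>e y. \<Sum>q<K. R (lab e i q) s * poly (elem_fam i e 0 q) y) i x" if "x \<in> inner_elem i" for x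
        using id[OF s inner_elem_not_node[OF eij(3) that]] K(2)[OF that] by simp
    qed (intro continuous_intros)
    also have "\<dots> = (\<Sum>q<K. R (lab e i q) s * (if q = j then 1 else 0))"
      by (subst coeff_of_sum) (auto simp: coeff_of_cmult coeff_of_fam intro!: continuous_intros)
    also have "\<dots> = (\<Sum>q<K. if q = j then R (lab e i j) s else 0)" by (intro sum.cong) auto
    also have "\<dots> = R (lab e i j) s" using K(1)[OF eij(2,3), of j] by (auto simp: not_less)
    finally show ?thesis using eij(1) by simp
  next
    case False
    thus ?thesis using nz[of r s] by (auto simp: conn_def)
  qed
qed

lemma connection_matrix_eq: "connection_matrix n \<theta> = conn"
  unfolding connection_matrix_def using connection_matrix_exists connection_matrix_unique by (rule the_equality)

text \<open>The coefficient of \<open>1 - \<sigma>\<close> times the degree-\<open>q\<close>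
  polynomial for \<open>b = 1\<close> along the degree-\<open>j\<close> polynomial for
  \<open>b = 0\<close>, with the factor absorbed into the weight.\<close>

definition conn_entry :: "nat \<Rightarrow> nat \<Rightarrow> nat \<Rightarrow> nat \<Rightarrow> real" where
  "conn_entry e i q j = elem_ip i e 1 (poly (elem_fam i e 1 q)) (poly (elem_fam i e 0 j)) / arc_weight.nrm (half_len \<theta> i) e 0"

lemma conn_lab_lab:
  assumes "i \<in> {1..n}" "i' \<in> {1..n}" "e < 2" "e' < 2"
  shows "conn (lab e i j) (lab e' i' (Suc q)) = (if e' = e \<and> i' = i then conn_entry e i q j else 0)"
proof -
  note a = elem_arc_weight[OF assms(1)]
  have "conn (lab e i j) (lab e' i' (Suc q)) = elem_coeff i e 0 (poly (restr_poly (lab e' i' (Suc q)) i e)) j"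
    using assms by (intro conn_lab lab_in_labels1)
  also have "\<dots> = (if e' = e \<and> i' = i then conn_entry e i q j else 0)"
  proof (cases "e' = e \<and> i' = i")
    case True
    have "poly (restr_poly (lab e' i' (Suc q)) i e) = (\<lambda>y. (1 - y) * poly (elem_fam i e 1 q) y)"
      using True assms by (auto simp: restr_poly_lab left_diff_distrib)
    thus ?thesis using True ip_shift_weight[OF a, of e "poly (elem_fam i e 1 q)" "poly (elem_fam i e 0 j)"]
      by (simp add: arc_weight.coeff_of_def[OF a] conn_entry_def)
  next
    case False
    hence "poly (restr_poly (lab e' i' (Suc q)) i e) = (\<lambda>_. 0)" using assms by (auto simp: restr_poly_lab)
    hence "elem_coeff i e 0 (poly (restr_poly (lab e' i' (Suc q)) i e)) j = 0"
      by (simp add: arc_weight.coeff_of_def[OF a] arc_weight.ip_zero_left[OF a])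
    thus ?thesis using False by auto
  qed
  finally show ?thesis .
qed

text \<open>The degree-\<open>q\<close> polynomial for \<open>b = 1\<close> is orthogonal to all
  lower degrees, so entries with \<open>q > j\<close> vanish: within each element and parity the
  system is lower triangular, and every row is finite.\<close>

lemma row_has_sum:
  assumes i: "i \<in> {1..n}" and e: "e < 2"
  shows "((\<lambda>s. conn (lab e i j) s * c s) has_sum
    (elem_coeff i e 0 (\<lambda>_. \<Sum>l=1..n. c (Hat l) * hat_coeff l i e) j + (\<Sum>q\<le>j. conn_entry e i q j * c (lab e i (Suc q))))) (labels1 n)"
proof (rule has_sum_finite_neutralI)
  note a = elem_arc_weight[OF i]
  let ?T = "Hat ` {1..n} \<union> (\<lambda>q. lab e i (Suc q)) ` {..j}"
  show "finite ?T" by simp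
  show "?T \<subseteq> labels1 n" using i e lab_in_labels1 by auto
  show "conn (lab e i j) s * c s = 0" if s: "s \<in> labels1 n - ?T" for s
  proof -
    obtain e' i' q where eq: "s = lab e' i' (Suc q)" "e' < 2" "i' \<in> {1..n}" using s unfolding labels1_eq by blast
    have "e' = e \<and> i' = i \<Longrightarrow> j < q" using s eq by (metis DiffD2 UnI2 atMost_iff image_eqI not_le)
    hence "e' = e \<and> i' = i \<Longrightarrow> conn_entry e i q j = 0"
      using arc_weight.ip_poly_fam_eq_0[OF a, of "elem_fam i e 0 j" q e 1] arc_weight.degree_fam[OF a]
        arc_weight.ip_commute[OF a, of e 1] by (simp add: conn_entry_def)
    thus ?thesis using conn_lab_lab[OF i eq(3) e eq(2)] eq(1) by simp
  qed
  have "(\<Sum>s\<in>?T. conn (lab e i j) s * c s) = (\<Sum>s\<in>Hat ` {1..n}. conn (lab e i j) s * c s) + (\<Sum>s\<in>(\<lambda>q. lab e i (Suc q)) ` {..j}. conn (lab e i j) s * c s)"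
    by (rule sum.union_disjoint) auto
  also have "(\<Sum>s\<in>Hat ` {1..n}. conn (lab e i j) s * c s) = (\<Sum>l=1..n. conn (lab e i j) (Hat l) * c (Hat l))"
    by (subst sum.reindex) (auto simp: inj_on_def)
  also have "\<dots> = (\<Sum>l=1..n. elem_coeff i e 0 (\<lambda>_. c (Hat l) * hat_coeff l i e) j)"
  proof (intro sum.cong refl)
    fix l assume l: "l \<in> {1..n}"
    have "poly [:hat_coeff l i e:] = (\<lambda>_. hat_coeff l i e)" by auto
    thus "conn (lab e i j) (Hat l) * c (Hat l) = elem_coeff i e 0 (\<lambda>_. c (Hat l) * hat_coeff l i e) j"
      using conn_lab[OF lab_in_labels1(2)[OF l] i e] arc_weight.coeff_of_cmult[OF a, of e 0 "c (Hat l)" "\<lambda>_. hat_coeff l i e"] by simp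
  qed
  also have "\<dots> = elem_coeff i e 0 (\<lambda>_. \<Sum>l=1..n. c (Hat l) * hat_coeff l i e) j"
    by (subst arc_weight.coeff_of_sum[OF a]) auto
  also have "(\<Sum>s\<in>(\<lambda>q. lab e i (Suc q)) ` {..j}. conn (lab e i j) s * c s) = (\<Sum>q\<le>j. conn_entry e i q j * c (lab e i (Suc q)))"
    using e by (subst sum.reindex) (auto simp: inj_on_def lab_inject conn_lab_lab[OF i i e e])
  finally show "elem_coeff i e 0 (\<lambda>_. \<Sum>l=1..n. c (Hat l) * hat_coeff l i e) j + (\<Sum>q\<le>j. conn_entry e i q j * c (lab e i (Suc q))) =
     (\<Sum>s\<in>?T. conn (lab e i j) s * c s)" by simp
qed

text \<open>Were the entry zero, the degree-\<open>q\<close> polynomial for \<open>b = 0\<close>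
  would expand for \<open>b = 1\<close> without its term of degree \<open>q\<close>, contradicting
  its degree.\<close>

lemma conn_entry_diagonal:
  assumes i: "i \<in> {1..n}" shows "conn_entry e i q q \<noteq> 0"
proof
  note a = elem_arc_weight[OF i]
  interpret w1: arc_weight "half_len \<theta> i" e 1 by (rule a)
  let ?p = "elem_fam i e 0 q"
  have p: "degree ?p = q" "?p \<noteq> 0" using arc_weight.degree_fam[OF a] arc_weight.fam_nonzero[OF a] by blast+
  assume "conn_entry e i q q = 0"
  hence "w1.ip (poly (w1.fam q)) (poly ?p) = 0" using arc_weight.nrm_pos[OF a, of e 0] by (simp add: conn_entry_def)
  hence "w1.coeff_of (poly ?p) q = 0"
    unfolding w1.coeff_of_def w1.ip_commute[of "poly ?p" "poly (w1.fam q)"] by (simp only: div_0)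
  hence "w1.psum (poly ?p) (Suc q) = w1.psum (poly ?p) q"
    unfolding w1.psum_def sum.lessThan_Suc by (simp only: smult_0_left add_0_right)
  moreover have "w1.psum (poly ?p) (Suc q) = ?p" by (rule w1.psum_poly) (simp add: p)
  ultimately have eq: "?p = w1.psum (poly ?p) q" by simp
  show False
  proof (cases "q = 0")
    case True
    hence "w1.psum (poly ?p) q = 0" unfolding w1.psum_def by simp
    thus False using eq p(2) by (simp only:)
  next
    case False
    thus False using w1.degree_psum[of q "poly ?p"] eq p(1) by simp
  qed
qed

end

section \<open>Coefficients and error for \<open>b = -1\<close>\<close>

context arc_expansion begin

text \<open>The explicit solution: nodal values for the hats, and the coefficients of the quotients
  \<open>k\<close> for the weight with \<open>b = 1\<close>.\<close>

definition expansion_coeffs :: "label \<Rightarrow> real" where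
  "expansion_coeffs s = (case s of Hat i \<Rightarrow> if i \<in> {1..n} then F (\<theta> i) else 0
     | Ev i j \<Rightarrow> if i \<in> {1..n} \<and> 1 \<le> j then elem_coeff i 0 1 (k i 0) (j - 1) else 0
     | Od i j \<Rightarrow> if i \<in> {1..n} \<and> 2 \<le> j then elem_coeff i 1 1 (k i 1) (j - 2) else 0)"

lemma expansion_coeffs_Hat: "i \<in> {1..n} \<Longrightarrow> expansion_coeffs (Hat i) = F (\<theta> i)"
  by (simp add: expansion_coeffs_def)

lemma expansion_coeffs_lab: "i \<in> {1..n} \<Longrightarrow> e < 2 \<Longrightarrow> expansion_coeffs (lab e i (Suc j)) = elem_coeff i e 1 (k i e) j"
  by (auto simp: expansion_coeffs_def lab_def less_2_cases_iff)

lemma expansion_coeffs_outside: "s \<notin> labels1 n \<Longrightarrow> expansion_coeffs s = 0"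
  by (cases s) (auto simp: expansion_coeffs_def labels1_def)

text \<open>The even boundary value is the mean of the two end values, the odd one their difference
  over \<open>2 * sin (half_len \<theta> i)\<close>, exactly as in \<open>hat_coeff\<close>. On the
  last element the right end value is read at the first node by periodicity.\<close>

lemma hat_part:
  assumes i: "i \<in> {1..n}" and e: "e < 2"
  shows "(\<Sum>j=1..n. expansion_coeffs (Hat j) * hat_coeff j i e) = g i e 1"
proof -
  let ?s = "sin (half_len \<theta> i)"
  have s: "?s > 0" by (rule sin_half_len[OF i])
  have ends: "\<theta> i \<in> elem \<theta> i" "\<theta> (Suc i) \<in> elem \<theta> i" using \<theta>_Suc[OF i] by (auto simp: elem_def)
  have l: "F (\<theta> i) = g i 0 1 - ?s * g i 1 1"
    using F_parity[OF i ends(1)] by (simp add: parity_sum_def numeral_2_eq_2 sg_ends[OF i] sn_def loc_left)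
  have r: "F (\<theta> (Suc i)) = g i 0 1 + ?s * g i 1 1"
    using F_parity[OF i ends(2)] by (simp add: parity_sum_def numeral_2_eq_2 sg_ends[OF i] sn_def loc_right)
  have nx: "F (\<theta> (nxt i)) = F (\<theta> (Suc i))" using F_per \<theta>1 \<theta>n by (auto simp: nxt_def)
  have "(\<Sum>j=1..n. expansion_coeffs (Hat j) * hat_coeff j i e) = (\<Sum>j\<in>{i, nxt i}. expansion_coeffs (Hat j) * hat_coeff j i e)"
    using i nxt_range[OF i] by (intro sum.mono_neutral_right) (auto simp: hat_coeff_def)
  also have "\<dots> = F (\<theta> i) * hat_coeff i i e + F (\<theta> (Suc i)) * hat_coeff (nxt i) i e"
    using nxt_neq[OF i] i nxt_range[OF i] by (simp add: expansion_coeffs_Hat nx)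
  also have "\<dots> = g i e 1"
    using e s nxt_neq[OF i] by (auto simp: less_2_cases_iff hat_coeff_def l r field_simps)
  finally show ?thesis .
qed

lemma partial_sum1_expansion_coeffs:
  assumes i: "i \<in> {1..n}" and x: "x \<in> inner_elem i"
  shows "partial_sum (-1) n \<theta> expansion_coeffs m x =
    parity_sum (\<lambda>e y. g i e 1 + (1 - y) * poly (elem_psum i e 1 (k i e) (num_terms e m)) y) i x"
  unfolding partial_sum1_inner[OF i x]
  by (intro parity_sum_cong) (simp add: hat_part[OF i] arc_weight.poly_psum[OF elem_arc_weight[OF i]] expansion_coeffs_lab[OF i] del: One_nat_def)

lemma F_inner:
  assumes i: "i \<in> {1..n}" and x: "x \<in> inner_elem i"
  shows "F x = parity_sum (\<lambda>e y. g i e 1 + (1 - y) * k i e y) i x"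
proof -
  have xe: "x \<in> elem \<theta> i" using x inner_elem_subset by auto
  have "F x = parity_sum (g i) i x" by (rule F_parity[OF i xe])
  also have "\<dots> = parity_sum (\<lambda>e y. g i e 1 + (1 - y) * k i e y) i x"
    by (rule parity_sum_cong) (rule gk[OF i sg_bounds[OF i xe]])
  finally show ?thesis .
qed

lemma num_terms_at_top: "filterlim (num_terms e) at_top sequentially"
proof (rule filterlim_at_top_mono[of "\<lambda>m. m - 1"])
  show "filterlim (\<lambda>m. m - 1) at_top sequentially" by (rule filterlim_minus_const_nat_at_top)
  show "\<forall>\<^sub>F m in sequentially. m - 1 \<le> num_terms e m" by (rule always_eventually) (auto simp: num_terms_def)
qed

text \<open>At a grid point the partial sums are constant. Inside an element the hats supply
  \<open>g i e 1\<close> exactly, and the rest converges by the Nikolskii inequality.\<close>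

lemma partial_sum1_tendsto:
  assumes x: "x \<in> {-pi..pi}"
  shows "(\<lambda>m. partial_sum (-1) n \<theta> expansion_coeffs m x) \<longlonglongrightarrow> F x"
proof (cases "x \<in> \<theta> ` {1..n+1}")
  case True
  then obtain i where i: "i \<in> {1..n+1}" "x = \<theta> i" by blast
  have "expansion_coeffs (Hat (if i = Suc n then 1 else i)) = F x"
    using i n2 F_per \<theta>1 \<theta>n by (auto simp: expansion_coeffs_Hat)
  thus ?thesis using partial_sum1_node[OF i(1)] i(2) by simp
next
  case False
  then obtain i where i: "i \<in> {1..n}" and xi: "x \<in> inner_elem i" using inner_elem_iff x by blast
  have xe: "x \<in> elem \<theta> i" using xi inner_elem_subset by auto
  have t: "(\<lambda>m. sn i x ^ e * ((1 - sg i x) * poly (elem_psum i e 1 (k i e) (num_terms e m)) (sg i x)))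
      \<longlonglongrightarrow> sn i x ^ e * ((1 - sg i x) * k i e (sg i x))" if "e < 2" for e
    using filterlim_compose[OF arc_weight.arc_psum_tendsto[OF elem_arc_weight[OF i] refl _ rk[OF i] \<rho> loc_bounds[OF xe], of e] num_terms_at_top] that
    by (simp add: sn_def sg_def elem_h_def del: One_nat_def)
  have "(\<lambda>m. \<Sum>e<2. sn i x ^ e * g i e 1 + sn i x ^ e * ((1 - sg i x) * poly (elem_psum i e 1 (k i e) (num_terms e m)) (sg i x)))
      \<longlonglongrightarrow> (\<Sum>e<2. sn i x ^ e * g i e 1 + sn i x ^ e * ((1 - sg i x) * k i e (sg i x)))"
    by (intro tendsto_sum tendsto_add tendsto_const t) simp
  thus ?thesis unfolding partial_sum1_expansion_coeffs[OF i xi] F_inner[OF i xi] parity_sum_def by (simp only: distrib_left)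
qed

text \<open>After its first \<open>j + 1\<close> terms, the remainder of \<open>k\<close> is
  orthogonal for \<open>b = 1\<close> to the degree-\<open>j\<close> polynomial for
  \<open>b = 0\<close>. Row \<open>j\<close> therefore sees a finite sum and no limit is
  involved.\<close>

lemma row_expansion_coeffs:
  assumes i: "i \<in> {1..n}" and e: "e < 2"
  shows "((\<lambda>s. conn (lab e i j) s * expansion_coeffs s) has_sum coeffs0 n \<theta> F (lab e i j)) (labels1 n)"
proof -
  note a = elem_arc_weight[OF i]
  interpret w0: arc_weight "half_len \<theta> i" e 0 by (rule a)
  interpret w1: arc_weight "half_len \<theta> i" e 1 by (rule a)
  let ?p = "poly (w0.fam j)"
  have c: "continuous_on {0..1} (k i e)" by (rule ck[OF i])
  have cp: "continuous_on {0..1} (poly (w1.psum (k i e) (Suc j)))" by simp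
  have "w1.ip (k i e) ?p - w1.ip (poly (w1.psum (k i e) (Suc j))) ?p = 0"
    using w1.psum_orthogonal[OF c, of "w0.fam j" "Suc j"] w1.ip_diff[OF c cp] by simp
  hence "w1.ip (k i e) ?p = w1.ip (\<lambda>y. \<Sum>q<Suc j. w1.coeff_of (k i e) q * poly (w1.fam q) y) ?p"
    by (simp only: w1.poly_psum[abs_def] eta_contract_eq right_minus_eq)
  also have "\<dots> = (\<Sum>q<Suc j. w1.ip (\<lambda>y. w1.coeff_of (k i e) q * poly (w1.fam q) y) ?p)"
    by (rule w1.ip_sum) (auto intro!: continuous_intros)
  also have "\<dots> = (\<Sum>q<Suc j. w1.coeff_of (k i e) q * w1.ip (poly (w1.fam q)) ?p)"
    by (simp only: w1.ip_cmult)
  finally have kk: "w1.ip (k i e) ?p = (\<Sum>q\<le>j. w1.coeff_of (k i e) q * w1.ip (poly (w1.fam q)) ?p)"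
    by (simp only: lessThan_Suc_atMost)
  have "w0.coeff_of (g i e) j = w0.coeff_of (\<lambda>y. g i e 1 + (1 - y) * k i e y) j"
    by (rule w0.coeff_of_cong) (rule gk[OF i])
  also have "\<dots> = w0.coeff_of (\<lambda>_. g i e 1) j + w0.coeff_of (\<lambda>y. (1 - y) * k i e y) j"
    by (rule w0.coeff_of_add) (auto intro!: continuous_intros c)
  also have "w0.coeff_of (\<lambda>y. (1 - y) * k i e y) j = w1.ip (k i e) ?p / w0.nrm"
    using ip_shift_weight[OF a, of e "k i e" ?p] by (simp add: w0.coeff_of_def)
  also have "\<dots> = (\<Sum>q\<le>j. conn_entry e i q j * expansion_coeffs (lab e i (Suc q)))"
    unfolding kk by (simp add: conn_entry_def expansion_coeffs_lab[OF i e] sum_divide_distrib mult.commute del: One_nat_def)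
  finally have "w0.coeff_of (\<lambda>_. \<Sum>l=1..n. expansion_coeffs (Hat l) * hat_coeff l i e) j + (\<Sum>q\<le>j. conn_entry e i q j * expansion_coeffs (lab e i (Suc q))) = coeffs0 n \<theta> F (lab e i j)"
    unfolding hat_part[OF i e] coeffs0_F[OF i e] by simp
  thus ?thesis using row_has_sum[OF i e, of j expansion_coeffs] by simp
qed

lemma expansion_coeffs_is_expansion: "is_expansion1 n \<theta> F expansion_coeffs"
  unfolding is_expansion1_def connection_matrix_eq
  using expansion_coeffs_outside row_expansion_coeffs partial_sum1_tendsto by (auto simp: labels0_eq)

text \<open>Convergence at the nodes fixes the hat coefficients; forward substitution along the
  nonzero diagonal fixes the rest.\<close>

lemma expansion_unique:
  assumes c: "is_expansion1 n \<theta> F c" shows "c = expansion_coeffs"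
proof -
  have out: "\<And>s. s \<notin> labels1 n \<Longrightarrow> c s = 0"
    and row: "\<And>r. r \<in> labels0 n \<Longrightarrow> ((\<lambda>s. conn r s * c s) has_sum coeffs0 n \<theta> F r) (labels1 n)"
    and lim: "\<And>x. x \<in> {-pi..pi} \<Longrightarrow> (\<lambda>m. partial_sum (-1) n \<theta> c m x) \<longlonglongrightarrow> F x"
    using c unfolding is_expansion1_def connection_matrix_eq by blast+
  have hat: "c (Hat i) = expansion_coeffs (Hat i)" if i: "i \<in> {1..n}" for i
  proof -
    have "\<theta> 1 \<le> \<theta> i" "\<theta> i \<le> \<theta> (n + 1)" using i by (auto intro!: \<theta>_le)
    hence "(\<lambda>m. partial_sum (-1) n \<theta> c m (\<theta> i)) \<longlonglongrightarrow> F (\<theta> i)" using \<theta>1 \<theta>n by (intro lim) auto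
    moreover have "partial_sum (-1) n \<theta> c m (\<theta> i) = c (Hat i)" for m
      using partial_sum1_node[of i c m] i by auto
    ultimately have "(\<lambda>m :: nat. c (Hat i)) \<longlonglongrightarrow> F (\<theta> i)" by (simp only:)
    thus ?thesis using LIMSEQ_unique[OF _ tendsto_const] expansion_coeffs_Hat[OF i] by fastforce
  qed
  have lb: "c (lab e i (Suc q)) = expansion_coeffs (lab e i (Suc q))" if i: "i \<in> {1..n}" and e: "e < 2" for e i q
  proof (induction q rule: less_induct)
    case (less q)
    have "elem_coeff i e 0 (\<lambda>_. \<Sum>l=1..n. c (Hat l) * hat_coeff l i e) q + (\<Sum>j\<le>q. conn_entry e i j q * c (lab e i (Suc j))) = coeffs0 n \<theta> F (lab e i q)"
      using has_sum_unique[OF row_has_sum[OF i e] row[OF lab_in_labels0[OF e i]]] .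
    moreover have "elem_coeff i e 0 (\<lambda>_. \<Sum>l=1..n. expansion_coeffs (Hat l) * hat_coeff l i e) q + (\<Sum>j\<le>q. conn_entry e i j q * expansion_coeffs (lab e i (Suc j))) = coeffs0 n \<theta> F (lab e i q)"
      using has_sum_unique[OF row_has_sum[OF i e] row_expansion_coeffs[OF i e]] .
    moreover have "(\<Sum>l=1..n. c (Hat l) * hat_coeff l i e) = (\<Sum>l=1..n. expansion_coeffs (Hat l) * hat_coeff l i e)"
      by (intro sum.cong refl) (simp add: hat)
    ultimately have "(\<Sum>j\<le>q. conn_entry e i j q * c (lab e i (Suc j))) = (\<Sum>j\<le>q. conn_entry e i j q * expansion_coeffs (lab e i (Suc j)))" by simp
    moreover have "(\<Sum>j<q. conn_entry e i j q * c (lab e i (Suc j))) = (\<Sum>j<q. conn_entry e i j q * expansion_coeffs (lab e i (Suc j)))"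
      by (intro sum.cong refl) (simp add: less.IH)
    ultimately have "conn_entry e i q q * c (lab e i (Suc q)) = conn_entry e i q q * expansion_coeffs (lab e i (Suc q))"
      by (simp add: lessThan_Suc_atMost[symmetric])
    thus ?case using conn_entry_diagonal[OF i] by simp
  qed
  show ?thesis
  proof
    fix s show "c s = expansion_coeffs s"
    proof (cases "s \<in> labels1 n")
      case True
      thus ?thesis using hat lb unfolding labels1_eq by blast
    qed (simp add: out expansion_coeffs_outside)
  qed
qed

lemma arc_coeffs1: "arc_coeffs (-1) n \<theta> F = expansion_coeffs"
proof -
  have "(THE c. is_expansion1 n \<theta> F c) = expansion_coeffs"
    using expansion_coeffs_is_expansion expansion_unique by (rule the_equality)
  thus ?thesis by (simp add: arc_coeffs_def)
qed

text \<open>On an element the error is \<open>1 - \<sigma>\<close> times the error of the quotients,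
  and \<open>cos x - h = (1 - h) * (1 - \<sigma>)\<close>. The singular norm is thus the norm of the
  quotient error for \<open>b = 1\<close>, up to the constant \<open>Q\<close>.\<close>

lemma expansion1:
  shows "(\<forall>m. arc_norm_finite (-1) n \<theta> (\<lambda>x. F x - S_sum (-1) n \<theta> F m x)) \<and>
         (\<lambda>m. arc_norm (-1) n \<theta> (\<lambda>x. F x - S_sum (-1) n \<theta> F m x)) \<in> O(\<lambda>m. 1 / \<rho> ^ m) \<and>
         (\<forall>i\<in>{1..n}. (\<lambda>m. arc_coeffs (-1) n \<theta> F (Ev i m)) \<in> O(\<lambda>m. 1 / \<rho> ^ m) \<and>
                       (\<lambda>m. arc_coeffs (-1) n \<theta> F (Od i m)) \<in> O(\<lambda>m. 1 / \<rho> ^ m))"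
proof -
  define E where "E m i e y = k i e y - poly (elem_psum i e 1 (k i e) (num_terms e m)) y" for m i e y
  define Q where "Q i = 1 / (1 - elem_h \<theta> i)" for i
  have cE: "i \<in> {1..n} \<Longrightarrow> continuous_on {0..1} (E m i e)" for m i e
    unfolding E_def by (intro continuous_intros ck)
  have h: "elem_h \<theta> i < 1" if "i \<in> {1..n}" for i
    using half_len_bounds[OF that] cos_less_one by (simp add: elem_h_def)
  define V where "V m i = Q i * (\<Sum>e<2. 2 * (1 - elem_h \<theta> i) ^ (2 * e) * elem_ip i e 1 (E m i e) (E m i e))" for m i
  have I: "((\<lambda>x. (F x - S_sum (-1) n \<theta> F m x)\<^sup>2 * (1 / (cos (loc \<theta> i x) - elem_h \<theta> i))) has_integral V m i) {\<theta> i..\<theta> (i + 1)}"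
    if i: "i \<in> {1..n}" for m i
  proof -
    \<comment> \<open>Scaled by \<open>1 - h\<close> so that the weight is exactly
      \<open>1 - \<sigma>\<close>; multiplication by \<open>Q i\<close> undoes it.\<close>
    define f where "f x = (1 - elem_h \<theta> i) * ((F x - S_sum (-1) n \<theta> F m x)\<^sup>2 * (1 / (cos (loc \<theta> i x) - elem_h \<theta> i)))" for x
    have "(f has_integral (\<Sum>e<2. 2 * (1 - elem_h \<theta> i) ^ (2 * e) * elem_ip i e 1 (E m i e) (E m i e))) (elem \<theta> i)"
    proof (rule has_integral_elem[OF i cE[OF i] cE[OF i]])
      fix x assume x: "x \<in> inner_elem i"
      define s where "s = 1 - sg i x"
      have "\<bar>loc \<theta> i x\<bar> < half_len \<theta> i"
        using x by (auto simp: inner_elem_def loc_def midpt_def half_len_def abs_less_iff field_simps)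
      hence s: "s > 0" using sig_less_one[of "loc \<theta> i x" "half_len \<theta> i"] half_len_bounds[OF i] by (simp add: s_def sg_def elem_h_def)
      have "cos (loc \<theta> i x) - elem_h \<theta> i = (1 - elem_h \<theta> i) * s"
        using h[OF i] by (simp add: s_def sg_def sig_def field_simps)
      moreover have "F x - S_sum (-1) n \<theta> F m x = s * parity_sum (E m i) i x"
        unfolding S_sum_def arc_coeffs1 partial_sum1_expansion_coeffs[OF i x] F_inner[OF i x] parity_sum_diff
        by (simp add: parity_sum_def E_def s_def sum_distrib_left right_diff_distrib mult.left_commute)
      ultimately have "f x = (1 - elem_h \<theta> i) * ((s * parity_sum (E m i) i x)\<^sup>2 * (1 / ((1 - elem_h \<theta> i) * s)))"
        by (simp only: f_def)
      also have "\<dots> = parity_sum (E m i) i x * parity_sum (E m i) i x * s ^ 1" using s h[OF i] by (simp add: power2_eq_square)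
      finally show "f x = parity_sum (E m i) i x * parity_sum (E m i) i x * (1 - sg i x) ^ 1" by (simp only: s_def)
    qed
    from has_integral_mult_right[OF this, of "Q i"] show ?thesis
      using h[OF i] by (simp add: f_def Q_def V_def elem_def)
  qed
  have norm: "arc_norm (-1) n \<theta> (\<lambda>x. F x - S_sum (-1) n \<theta> F m x) = sqrt (\<Sum>i=1..n. V m i)" for m
    unfolding arc_norm_def using integral_unique[OF I] by simp
  have "\<exists>C. \<forall>m. sqrt (\<Sum>i=1..n. V m i) \<le> C / \<rho> ^ m"
    unfolding V_def E_def[abs_def]
  proof (rule error_sum_bound)
    show "0 \<le> Q i" if "i \<in> {1..n}" for i using h[OF that] by (simp add: Q_def)
  qed (auto simp: num_terms_def intro: rk)
  then obtain C where C: "\<And>m. sqrt (\<Sum>i=1..n. V m i) \<le> C / \<rho> ^ m" by blast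
  have V0: "0 \<le> V m i" if i: "i \<in> {1..n}" for m i
  proof -
    have "0 \<le> elem_ip i e 1 (E m i e) (E m i e)" for e
      by (rule arc_weight.ip_nonneg[OF elem_arc_weight[OF i] cE[OF i]])
    moreover have "0 \<le> Q i" using h[OF i] by (simp add: Q_def)
    ultimately show ?thesis unfolding V_def using h[OF i] by (intro mult_nonneg_nonneg sum_nonneg) auto
  qed
  have "(\<lambda>m. arc_norm (-1) n \<theta> (\<lambda>x. F x - S_sum (-1) n \<theta> F m x)) \<in> O(\<lambda>m. 1 / \<rho> ^ m)"
  proof (intro bigo_inverse_power[OF \<rho>, of 0 _ C])
    show "\<bar>arc_norm (-1) n \<theta> (\<lambda>x. F x - S_sum (-1) n \<theta> F m x)\<bar> \<le> C / \<rho> ^ m" for m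
    proof -
      have "0 \<le> (\<Sum>i=1..n. V m i)" by (intro sum_nonneg V0)
      thus ?thesis unfolding norm using C[of m] by simp
    qed
  qed
  moreover have "arc_norm_finite (-1) n \<theta> (\<lambda>x. F x - S_sum (-1) n \<theta> F m x)" for m
    using has_integral_integrable[OF I[of _ m]] by (simp add: arc_norm_finite_def)
  moreover have "(\<lambda>m. arc_coeffs (-1) n \<theta> F (Ev i m)) \<in> O(\<lambda>m. 1 / \<rho> ^ m)" if i: "i \<in> {1..n}" for i
  proof -
    obtain C where C: "\<And>j. \<bar>elem_coeff i 0 1 (k i 0) j\<bar> \<le> C / \<rho> ^ j"
      using arc_weight.rapprox_coeff_of[OF elem_arc_weight[OF i] rk[OF i] \<rho>] by blast
    have "\<bar>expansion_coeffs (Ev i m)\<bar> \<le> (C * \<rho>) / \<rho> ^ m" if "m \<ge> 1" for m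
      using C[of "m - 1"] that \<rho> i by (cases m) (simp_all add: expansion_coeffs_def)
    thus ?thesis unfolding arc_coeffs1 by (intro bigo_inverse_power[OF \<rho>, of 1]) auto
  qed
  moreover have "(\<lambda>m. arc_coeffs (-1) n \<theta> F (Od i m)) \<in> O(\<lambda>m. 1 / \<rho> ^ m)" if i: "i \<in> {1..n}" for i
  proof -
    obtain C where C: "\<And>j. \<bar>elem_coeff i 1 1 (k i 1) j\<bar> \<le> C / \<rho> ^ j"
      using arc_weight.rapprox_coeff_of[OF elem_arc_weight[OF i] rk[OF i] \<rho>] by blast
    \<comment> \<open>Here \<open>q\<^sub>m\<close> carries a polynomial of degree
      \<open>m - 2\<close>, whence two factors \<open>\<rho>\<close>.\<close>
    have "\<bar>expansion_coeffs (Od i m)\<bar> \<le> (C * \<rho>\<^sup>2) / \<rho> ^ m" if m: "m \<ge> 2" for m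
    proof -
      obtain q where q: "m = Suc (Suc q)" using m by (metis add_2_eq_Suc le_Suc_ex)
      have "\<bar>expansion_coeffs (Od i m)\<bar> \<le> C / \<rho> ^ q" using C[of q] i q by (simp add: expansion_coeffs_def)
      also have "\<dots> = (C * \<rho>\<^sup>2) / \<rho> ^ m" using \<rho> q by (simp add: power2_eq_square)
      finally show ?thesis .
    qed
    thus ?thesis unfolding arc_coeffs1 by (intro bigo_inverse_power[OF \<rho>, of 2]) auto
  qed
  ultimately show ?thesis by blast
qed

end

section \<open>Assembly of the elements\<close>

lemma arc_decomposition_elem:
  assumes i: "0 < half_len \<theta> i" "half_len \<theta> i < pi" and r: "r > 1" and bc: "bounded_continuation \<theta> i r F"
  shows "\<exists>g k :: nat \<Rightarrow> real \<Rightarrow> real. (\<forall>e. rapprox r (g e) \<and> rapprox r (k e)) \<and>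
     (\<forall>e. \<forall>y\<in>{0..1}. g e y = g e 1 + (1 - y) * k e y) \<and>
     (\<forall>x\<in>elem \<theta> i. F x = (\<Sum>e<2. sin (loc \<theta> i x) ^ e * g e (sig (elem_h \<theta> i) (loc \<theta> i x))))"
proof -
  obtain G where hol: "G holomorphic_on D_elem \<theta> i r" and bd: "bounded (G ` D_elem \<theta> i r)"
    and per: "\<And>z. z \<in> D_elem \<theta> i r \<Longrightarrow> G (z + 2 * of_real pi) = G z"
    and ext: "\<And>x. x \<in> elem \<theta> i \<Longrightarrow> G (of_real x) = of_real (F x)"
    using bc unfolding bounded_continuation_def by blast
  define H where "H z = G (z + of_real (midpt \<theta> i))" for z
  define h where "h = cos (half_len \<theta> i)"
  have D: "z + of_real (midpt \<theta> i) \<in> D_elem \<theta> i r" if "z \<in> D_region h r" for z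
    using that by (auto simp: D_elem_def elem_h_def h_def)
  have "H holomorphic_on D_region h r"
  proof -
    have "(\<lambda>z. z + of_real (midpt \<theta> i)) holomorphic_on D_region h r" by (intro holomorphic_intros)
    moreover have "(\<lambda>z. z + of_real (midpt \<theta> i)) ` D_region h r \<subseteq> D_elem \<theta> i r" using D by blast
    ultimately have "(G \<circ> (\<lambda>z. z + of_real (midpt \<theta> i))) holomorphic_on D_region h r"
      using holomorphic_on_compose_gen hol by blast
    thus ?thesis by (simp add: comp_def H_def[abs_def])
  qed
  moreover obtain M where "\<And>z. z \<in> D_region h r \<Longrightarrow> norm (H z) \<le> M"
    using bd D unfolding bounded_iff H_def by blast
  moreover have "H (z + 2 * of_real pi) = H z" if "z \<in> D_region h r" for z
    using per[OF D[OF that]] by (simp add: H_def algebra_simps)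
  moreover have "H (of_real t) = of_real (F (t + midpt \<theta> i))" if "\<bar>t\<bar> \<le> half_len \<theta> i" for t
  proof -
    have "t + midpt \<theta> i \<in> elem \<theta> i" using that by (auto simp: elem_def midpt_def half_len_def abs_le_iff field_simps)
    thus ?thesis using ext[of "t + midpt \<theta> i"] by (simp add: H_def)
  qed
  ultimately obtain g k :: "nat \<Rightarrow> real \<Rightarrow> real" where gk: "\<And>e. rapprox r (g e) \<and> rapprox r (k e)"
     "\<And>e y. y \<in> {0..1} \<Longrightarrow> g e y = g e 1 + (1 - y) * k e y"
     "\<And>x. \<bar>x\<bar> \<le> half_len \<theta> i \<Longrightarrow> F (x + midpt \<theta> i) = g 0 (sig h x) + sin x * g 1 (sig h x)"
    using arc_decomposition[OF i r, of H M "\<lambda>t. F (t + midpt \<theta> i)"] unfolding h_def by blast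
  have "F x = (\<Sum>e<2. sin (loc \<theta> i x) ^ e * g e (sig (elem_h \<theta> i) (loc \<theta> i x)))" if "x \<in> elem \<theta> i" for x
  proof -
    have "\<bar>loc \<theta> i x\<bar> \<le> half_len \<theta> i"
      using that by (auto simp: elem_def loc_def midpt_def half_len_def abs_le_iff field_simps)
    from gk(3)[OF this] show ?thesis by (simp add: loc_def h_def elem_h_def numeral_2_eq_2)
  qed
  thus ?thesis using gk(1,2) by blast
qed

text \<open>The coefficient claim concerns the labels that carry a growing degree; the hat
  coefficients are \<open>n\<close> fixed numbers.\<close>

theorem theorem6:
  fixes f :: "real \<Rightarrow> real \<Rightarrow> real" and F :: "real \<Rightarrow> real"
    and b :: real and n :: nat and \<theta> :: "nat \<Rightarrow> real"
    and \<rho>s :: "nat \<Rightarrow> real" and \<rho> :: real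
  assumes F_eq: "\<And>x. F x = f (cos x) (sin x)"
    and b: "b \<in> {-1, 0}"
    and grid: "is_grid n \<theta>"
    and \<rho>s_gt: "\<And>i. i \<in> {1..n} \<Longrightarrow> \<rho>s i > 1"
    and cont: "\<And>i. i \<in> {1..n} \<Longrightarrow> bounded_continuation \<theta> i (\<rho>s i) F"
    and \<rho>_eq: "\<rho> = Min (\<rho>s ` {1..n})"
  shows "(\<forall>m. arc_norm_finite b n \<theta> (\<lambda>x. F x - S_sum b n \<theta> F m x)) \<and>
         (\<lambda>m. arc_norm b n \<theta> (\<lambda>x. F x - S_sum b n \<theta> F m x)) \<in> O(\<lambda>m. 1 / \<rho> ^ m) \<and>
         (\<forall>i\<in>{1..n}. (\<lambda>m. arc_coeffs b n \<theta> F (Ev i m)) \<in> O(\<lambda>m. 1 / \<rho> ^ m) \<and>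
                       (\<lambda>m. arc_coeffs b n \<theta> F (Od i m)) \<in> O(\<lambda>m. 1 / \<rho> ^ m))"
proof -
  interpret arc_grid n \<theta> by (unfold_locales) (rule grid)
  have ne: "finite (\<rho>s ` {1..n})" "\<rho>s ` {1..n} \<noteq> {}" using n2 by auto
  have \<rho>1: "\<rho> > 1" unfolding \<rho>_eq using ne \<rho>s_gt by (subst Min_gr_iff) auto
  have le: "\<rho> \<le> \<rho>s i" if "i \<in> {1..n}" for i unfolding \<rho>_eq using ne that by (intro Min_le) auto
  define P where "P i g k \<longleftrightarrow> (\<forall>e. rapprox (\<rho>s i) (g e) \<and> rapprox (\<rho>s i) (k e)) \<and>
     (\<forall>e. \<forall>y\<in>{0..1}. g e y = g e 1 + (1 - y) * k e y) \<and>
     (\<forall>x\<in>elem \<theta> i. F x = (\<Sum>e<2. sin (loc \<theta> i x) ^ e * g e (sig (elem_h \<theta> i) (loc \<theta> i x))))"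
    for i and g k :: "nat \<Rightarrow> real \<Rightarrow> real"
  have "\<forall>i\<in>{1..n}. \<exists>g k. P i g k"
    using arc_decomposition_elem[OF half_len_bounds \<rho>s_gt cont] unfolding P_def by blast
  then obtain g k where "\<And>i. i \<in> {1..n} \<Longrightarrow> P i (g i) (k i)" by metis
  hence gk: "\<And>i e. i \<in> {1..n} \<Longrightarrow> rapprox (\<rho>s i) (g i e) \<and> rapprox (\<rho>s i) (k i e)"
     "\<And>i e y. i \<in> {1..n} \<Longrightarrow> y \<in> {0..1} \<Longrightarrow> g i e y = g i e 1 + (1 - y) * k i e y"
     "\<And>i x. i \<in> {1..n} \<Longrightarrow> x \<in> elem \<theta> i \<Longrightarrow> F x = (\<Sum>e<2. sin (loc \<theta> i x) ^ e * g i e (sig (elem_h \<theta> i) (loc \<theta> i x)))"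
    unfolding P_def by blast+
  \<comment> \<open>The rate of each element is weakened to the common minimum, and
    \<open>F_per\<close> holds because \<open>F\<close> depends on the angle only through cosine and
    sine.\<close>
  interpret arc_expansion n \<theta> F g k \<rho>
  proof
    show "\<rho> > 1" by (rule \<rho>1)
    show "rapprox \<rho> (g i e)" if "i \<in> {1..n}" for i e
      using gk(1)[OF that, of e] le[OF that] \<rho>1 by (blast intro: rapprox_mono)
    show "rapprox \<rho> (k i e)" if "i \<in> {1..n}" for i e
      using gk(1)[OF that, of e] le[OF that] \<rho>1 by (blast intro: rapprox_mono)
    show "g i e y = g i e 1 + (1 - y) * k i e y" if "i \<in> {1..n}" "y \<in> {0..1}" for i e y
      by (rule gk(2)[OF that])
    show "F x = parity_sum (g i) i x" if "i \<in> {1..n}" "x \<in> elem \<theta> i" for i x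
      using gk(3)[OF that] by (simp add: parity_sum_def sn_def sg_def)
    show "F pi = F (- pi)" by (simp add: F_eq)
  qed
  from b show ?thesis using expansion0 expansion1 by auto
qed

end
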